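(* Let $R$ be a principal ideal domain. The path-loop construction $\mathfrak{PL}(C,\Psi)$ on any Alexander-Whitney coalgebra $(C,\Psi)$ (with $C_1=C_2=0$) is cofree over $\widetilde\Omega(C,\Psi)$, with cobasis $\mathfrak{PL}(C,\Psi)\,\square_{\widetilde\Omega(C,\Psi)}R$, which is a sub chain algebra of $\mathfrak{PL}(C,\Psi)$. More generally, for any morphism $\theta:(C',\Psi')\to(C,\Psi)$ of Alexander-Whitney coalgebras (with $C_1=C_2=0$), $\widetilde\Omega\big((C',\Psi')\coprod\mathfrak P(C,\Psi)\big)$ is cofree over $\widetilde\Omega(C,\Psi)$, with cobasis $\widetilde\Omega\big((C',\Psi')\coprod\mathfrak P(C,\Psi)\big)\,\square_{\widetilde\Omega(C,\Psi)}R$, which is a sub chain algebra of $\widetilde\Omega\big((C',\Psi')\coprod\mathfrak P(C,\Psi)\big)$.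
   Context: Conventions. Chain (co)algebras are over $R$, with $R$-free underlying graded modules, and the Koszul sign convention is used. $V_+=V_{>0}$; $s^{-1}$ is desuspension; $s^{-1}1:=0$. A chain coalgebra $C$ is coassociative, counital, coaugmented and non-negatively graded with $C_0=R$; it is simply connected if also $C_1=0$. $\Omega C=(T(s^{-1}C_+),d_\Omega)$, $d_\Omega(s^{-1}c)=-s^{-1}(dc)+\sum(-1)^{|c_i|}s^{-1}c_i\,s^{-1}c^i$, where $\overline\Delta(c)=\sum c_i\otimes c^i$ is the reduced comultiplication. Strong homotopy maps. A strongly homotopy morphism from $C$ to $C'$ is a chain algebra map $\theta:\Omega C\to\Omega C'$; its linear part is the chain map $\theta_1:C\to C'$ with $\theta(s^{-1}c)-s^{-1}\theta_1(c)$ of word length $\ge2$. Write $\theta(s^{-1}c)=\sum_k\sum s^{-1}c_1\cdots s^{-1}c_k$ and let $\Delta^{(k)}(d)=\sum d_{(1)}\otimes\cdots\otimes d_{(k)}$ be the $k$-fold unreduced comultiplication. Define chain algebra maps $\theta\curlywedge D:\Omega(C\otimes D)\to\Omega(C'\otimes D)$ and $D\curlywedge\theta:\Omega(D\otimes C)\to\Omega(D\otimes C')$ by $s^{-1}(1\otimes d)\mapsto s^{-1}(1\otimes d)$, $s^{-1}(d\otimes1)\mapsto s^{-1}(d\otimes1)$ respectively and, for $c\in C_+$, $s^{-1}(c\otimes d)\mapsto\sum\pm s^{-1}(c_1\otimes d_{(1)})\cdots s^{-1}(c_k\otimes d_{(k)})$ and $s^{-1}(d\otimes c)\mapsto\sum\pm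 s^{-1}(d_{(1)}\otimes c_1)\cdots s^{-1}(d_{(k)}\otimes c_k)$, with the Koszul sign of interleaving the symbols $s^{-1}c_j$ and $d_{(j)}$. For $\theta:\Omega C\to\Omega C'$, $\theta':\Omega D\to\Omega D'$ put $\theta\curlywedge\theta'=(C'\curlywedge\theta')\circ(\theta\curlywedge D)$. Alexander-Whitney coalgebras. Milgram's map $q:\Omega(C\otimes D)\to\Omega C\otimes\Omega D$ is the chain algebra map with $q(s^{-1}(c\otimes1))=s^{-1}c\otimes1$, $q(s^{-1}(1\otimes d))=1\otimes s^{-1}d$, $q(s^{-1}(c\otimes d))=0$ for $c\in C_+,d\in D_+$. An Alexander-Whitney coalgebra is a pair $(C,\Psi)$ with $C$ simply connected and $\Psi:\Omega C\to\Omega(C\otimes C)$ a chain algebra map with linear part the comultiplication $\Delta$, such that $\psi=q\Psi$ is coassociative; $\widetilde\Omega(C,\Psi)$ is the chain Hopf algebra $(\Omega C,\psi)$. A morphism $\theta:(C',\Psi')\to(C,\Psi)$ is a chain algebra map $\theta:\Omega C'\to\Omega C$ with $\Psi\theta=(\theta\curlywedge\theta)\Psi'$; it is then a Hopf algebra map. Based paths. For $C$ with $C_1=C_2=0$, $\mathfrak P(C)=R\oplus C_+\oplus\overline C_+$, $\overline C_+=s^{-1}C_+$, $\bar c=s^{-1}c$, with $\tilde dc=dc-\bar c$, $\tilde d\bar c=-\overline{dc}$, comultiplication extending $\Delta$ and $\widetilde\Delta(\bar c)=(\sigma\otimes\iota+\iota\otimes\sigma)\Delta(c)$, where $\iota(c)=c$,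 $\sigma(c)=\bar c$, $\sigma(1)=0$; $\pi:\mathfrak P(C)\to C$ is the projection killing $\overline C_+$. Let $\iota:\Omega C\to\Omega\mathfrak P(C)$ be the (nondifferential) inclusion of algebras and $\kappa:\Omega C\to\Omega\mathfrak P(C)$ the degree $-1$ $(\iota,\iota)$-derivation with $\kappa(s^{-1}c)=-s^{-1}\bar c$. $\mathfrak{PL}(C,\Psi)$ is the chain Hopf algebra $\Omega\mathfrak P(C)$ with comultiplication the algebra map $\tilde\psi$ with $\tilde\psi(s^{-1}c)=(\iota\otimes\iota)\psi(s^{-1}c)$, $\tilde\psi(s^{-1}\bar c)=-(\kappa\otimes\iota+\iota\otimes\kappa)\psi(s^{-1}c)$. $\widetilde\Omega((C',\Psi')\coprod\mathfrak P(C,\Psi))$ is the coproduct of algebras $\Omega C'\coprod\Omega\mathfrak P(C)$ with comultiplication $\psi''$ restricting to $\psi'$ and $\tilde\psi$; $\widetilde\Omega(\theta+\pi):\Omega C'\coprod\Omega\mathfrak P(C)\to\Omega C$ is the Hopf map restricting to $\theta$ and $\Omega\pi$. Comodules. A surjection $p:H'\to H$ of chain Hopf algebras makes $H'$ a right $H$-comodule with coaction $\nu=(1\otimes p)\Delta_{H'}$, and $H'\square_HR=\{x\in H':\nu(x)=x\otimes1\}$. In the statement the coactions are those induced by $\Omega\pi$ and $\widetilde\Omega(\theta+\pi)$. "Cofree over $H$ with cobasis $B$" means that the underlying (nondifferential) graded right $H$-comodule of $H'$ is isomorphic to $B\otimes H$ with coaction $1\otimes\Delta_H$. *)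

theory Defs
  imports Complex_Main "HOL-Library.Poly_Mapping"
begin

class pid = idom +
  assumes principal_ideal:
    "0 \<in> I \<Longrightarrow> (\<And>x y. x \<in> I \<Longrightarrow> y \<in> I \<Longrightarrow> x + y \<in> I) \<Longrightarrow> (\<And>a x. x \<in> I \<Longrightarrow> a * x \<in> I)
      \<Longrightarrow> \<exists>g. I = range (\<lambda>a. a * g)"


section \<open>Free graded modules\<close>

text \<open>
  All modules considered are free, so a graded module is presented by a homogeneous basis: a set of
  generators together with their degrees. The module itself is the set \<open>fmod A\<close> of finitely
  supported \<open>R\<close>-valued functions on that set. The basis of a tensor product is the product of the
  bases, and the basis of a tensor algebra is the set of words in the basis of the generating module.
  Maps are total HOL functions of which only the values on \<open>fmod A\<close> matter.
\<close>

definition smul :: "'r::comm_ring_1 \<Rightarrow> ('x \<Rightarrow>\<^sub>0 'r) \<Rightarrow> ('x \<Rightarrow>\<^sub>0 'r)" (infixr "\<odot>" 75)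
  where "a \<odot> p = Poly_Mapping.map ((*) a) p"

lemma lookup_smul [simp]: "Poly_Mapping.lookup (a \<odot> p) x = a * Poly_Mapping.lookup p x"
  by (simp add: smul_def Poly_Mapping.map.rep_eq when_def)

interpretation fm: module "smul :: 'r::comm_ring_1 \<Rightarrow> ('x \<Rightarrow>\<^sub>0 'r) \<Rightarrow> ('x \<Rightarrow>\<^sub>0 'r)"
  by standard (auto intro!: poly_mapping_eqI simp: lookup_add algebra_simps)

abbreviation bas :: "'x \<Rightarrow> ('x \<Rightarrow>\<^sub>0 'r::comm_ring_1)"
  where "bas x \<equiv> Poly_Mapping.single x 1"

definition lin :: "('x \<Rightarrow> ('y \<Rightarrow>\<^sub>0 'r)) \<Rightarrow> ('x \<Rightarrow>\<^sub>0 'r::comm_ring_1) \<Rightarrow> ('y \<Rightarrow>\<^sub>0 'r)"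
  where "lin F p = (\<Sum>x\<in>Poly_Mapping.keys p. Poly_Mapping.lookup p x \<odot> F x)"

definition bilin ::
  "('x \<Rightarrow> 'y \<Rightarrow> ('z \<Rightarrow>\<^sub>0 'r)) \<Rightarrow> ('x \<Rightarrow>\<^sub>0 'r::comm_ring_1) \<Rightarrow> ('y \<Rightarrow>\<^sub>0 'r) \<Rightarrow> ('z \<Rightarrow>\<^sub>0 'r)"
  where "bilin F p q = (\<Sum>x\<in>Poly_Mapping.keys p. \<Sum>y\<in>Poly_Mapping.keys q. (Poly_Mapping.lookup p x * Poly_Mapping.lookup q y) \<odot> F x y)"

definition tens :: "('x \<Rightarrow>\<^sub>0 'r::comm_ring_1) \<Rightarrow> ('y \<Rightarrow>\<^sub>0 'r) \<Rightarrow> ('x \<times> 'y \<Rightarrow>\<^sub>0 'r)" (infixr "\<otimes>" 75)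
  where "p \<otimes> q = bilin (\<lambda>x y. bas (x, y)) p q"

definition assoc :: "(('x \<times> 'y) \<times> 'z \<Rightarrow>\<^sub>0 'r::comm_ring_1) \<Rightarrow> ('x \<times> ('y \<times> 'z) \<Rightarrow>\<^sub>0 'r)"
  where "assoc = lin (\<lambda>((x, y), z). bas (x, (y, z)))"

record 'x graded_basis =
  gens :: "'x set"
  deg :: "'x \<Rightarrow> nat"

definition fmod :: "('x, 'm) graded_basis_scheme \<Rightarrow> ('x \<Rightarrow>\<^sub>0 'r::comm_ring_1) set"
  where "fmod A = {p. Poly_Mapping.keys p \<subseteq> gens A}"

definition tensor_basis ::
  "('x, 'm) graded_basis_scheme \<Rightarrow> ('y, 'n) graded_basis_scheme \<Rightarrow> ('x \<times> 'y) graded_basis"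
  where "tensor_basis A B = \<lparr>gens = gens A \<times> gens B, deg = (\<lambda>(x, y). deg A x + deg B y)\<rparr>"

definition sum_basis ::
  "('x, 'm) graded_basis_scheme \<Rightarrow> ('y, 'n) graded_basis_scheme \<Rightarrow> ('x + 'y) graded_basis"
  where "sum_basis A B = \<lparr>gens = gens A <+> gens B, deg = case_sum (deg A) (deg B)\<rparr>"

definition words :: "('x, 'm) graded_basis_scheme \<Rightarrow> 'x list graded_basis"
  where "words V = \<lparr>gens = lists (gens V), deg = (\<lambda>w. sum_list (map (deg V) w))\<rparr>"

definition graded_map ::
  "int \<Rightarrow> ('x, 'm) graded_basis_scheme \<Rightarrow> ('y, 'n) graded_basis_scheme
    \<Rightarrow> (('x \<Rightarrow>\<^sub>0 'r::comm_ring_1) \<Rightarrow> ('y \<Rightarrow>\<^sub>0 'r)) \<Rightarrow> bool"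
  where "graded_map k A B f \<longleftrightarrow>
    (\<forall>p\<in>fmod A. f p \<in> fmod B) \<and>
    (\<forall>p\<in>fmod A. \<forall>q\<in>fmod A. f (p + q) = f p + f q) \<and>
    (\<forall>a. \<forall>p\<in>fmod A. f (a \<odot> p) = a \<odot> f p) \<and>
    (\<forall>x\<in>gens A. \<forall>y\<in>Poly_Mapping.keys (f (bas x)). int (deg B y) = int (deg A x) + k)"

text \<open>
  \<open>tmap A k f g\<close> is the tensor product \<open>f \<otimes> g\<close> on \<open>A \<otimes> B\<close>, where \<open>k\<close> is (up to parity) the degree
  of \<open>g\<close>: \<open>(f \<otimes> g)(x \<otimes> y) = (-1)\<^sup>k\<^sup>|\<^sup>x\<^sup>| f x \<otimes> g y\<close>. Degree \<open>-1\<close> is entered as \<open>k = 1\<close>.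
\<close>

definition tmap ::
  "('x, 'm) graded_basis_scheme \<Rightarrow> nat \<Rightarrow> (('x \<Rightarrow>\<^sub>0 'r::comm_ring_1) \<Rightarrow> ('u \<Rightarrow>\<^sub>0 'r))
    \<Rightarrow> (('y \<Rightarrow>\<^sub>0 'r) \<Rightarrow> ('v \<Rightarrow>\<^sub>0 'r)) \<Rightarrow> ('x \<times> 'y \<Rightarrow>\<^sub>0 'r) \<Rightarrow> ('u \<times> 'v \<Rightarrow>\<^sub>0 'r)"
  where "tmap A k f g =
    lin (\<lambda>(x, y). (-1) ^ (k * deg A x) \<odot> (f (bas x) \<otimes> g (bas y)))"

definition component :: "('x, 'm) graded_basis_scheme \<Rightarrow> nat \<Rightarrow> ('x \<Rightarrow>\<^sub>0 'r::comm_ring_1) \<Rightarrow> ('x \<Rightarrow>\<^sub>0 'r)"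
  where "component A n = lin (\<lambda>x. if deg A x = n then bas x else 0)"

definition graded_submodule ::
  "('x, 'm) graded_basis_scheme \<Rightarrow> ('x \<Rightarrow>\<^sub>0 'r::comm_ring_1) set \<Rightarrow> bool"
  where "graded_submodule A B \<longleftrightarrow>
    B \<subseteq> fmod A \<and> fm.subspace B \<and> (\<forall>p\<in>B. \<forall>n. component A n p \<in> B)"


section \<open>Chain coalgebras and chain algebras\<close>

record (overloaded) ('x, 'r::comm_ring_1) dgm = "'x graded_basis" +
  dif :: "('x \<Rightarrow>\<^sub>0 'r) \<Rightarrow> ('x \<Rightarrow>\<^sub>0 'r)"

record (overloaded) ('x, 'r::comm_ring_1) coalg = "('x, 'r) dgm" +
  comult :: "('x \<Rightarrow>\<^sub>0 'r) \<Rightarrow> ('x \<times> 'x \<Rightarrow>\<^sub>0 'r)"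
  one :: 'x

record (overloaded) ('x, 'r::comm_ring_1) alg = "('x, 'r) dgm" +
  mult :: "('x \<Rightarrow>\<^sub>0 'r) \<Rightarrow> ('x \<Rightarrow>\<^sub>0 'r) \<Rightarrow> ('x \<Rightarrow>\<^sub>0 'r)"
  munit :: "'x \<Rightarrow>\<^sub>0 'r"

record (overloaded) ('x, 'r::comm_ring_1) hopf = "('x, 'r) alg" +
  hcomult :: "('x \<Rightarrow>\<^sub>0 'r) \<Rightarrow> ('x \<times> 'x \<Rightarrow>\<^sub>0 'r)"

definition tdif ::
  "('x, 'r::comm_ring_1, 'm) dgm_scheme \<Rightarrow> ('y, 'r, 'n) dgm_scheme
    \<Rightarrow> ('x \<times> 'y \<Rightarrow>\<^sub>0 'r) \<Rightarrow> ('x \<times> 'y \<Rightarrow>\<^sub>0 'r)"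
  where "tdif A B t = tmap A 0 (dif A) id t + tmap A 1 id (dif B) t"

text \<open>
  \<open>C\<^sub>0 = R\<close>: the coaugmentation identifies \<open>R\<close> with \<open>C\<^sub>0\<close>, and the basis of \<open>C\<^sub>0\<close> is taken to be the
  image \<open>one C\<close> of \<open>1\<close>. The counit, having degree \<open>0\<close> and splitting the coaugmentation, is then the
  coefficient at \<open>one C\<close>.
\<close>

definition counit :: "('x, 'r::comm_ring_1) coalg \<Rightarrow> ('x \<Rightarrow>\<^sub>0 'r) \<Rightarrow> 'r"
  where "counit C c = Poly_Mapping.lookup c (one C)"

definition chain_coalgebra :: "('x, 'r::comm_ring_1) coalg \<Rightarrow> bool"
  where "chain_coalgebra C \<longleftrightarrow>
    {x \<in> gens C. deg C x = 0} = {one C} \<and>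
    graded_map (-1) C C (dif C) \<and>
    (\<forall>c\<in>fmod C. dif C (dif C c) = 0) \<and>
    graded_map 0 C (tensor_basis C C) (comult C) \<and>
    (\<forall>c\<in>fmod C. tdif C C (comult C c) = comult C (dif C c)) \<and>
    (\<forall>c\<in>fmod C. assoc (tmap C 0 (comult C) id (comult C c)) = tmap C 0 id (comult C) (comult C c)) \<and>
    (\<forall>c\<in>fmod C. lin (\<lambda>(x, y). counit C (bas x) \<odot> bas y) (comult C c) = c) \<and>
    (\<forall>c\<in>fmod C. lin (\<lambda>(x, y). counit C (bas y) \<odot> bas x) (comult C c) = c) \<and>
    (\<forall>c\<in>fmod C. counit C (dif C c) = 0) \<and>
    comult C (bas (one C)) = bas (one C) \<otimes> bas (one C)"

definition simply_connected :: "('x, 'r::comm_ring_1) coalg \<Rightarrow> bool"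
  where "simply_connected C \<longleftrightarrow> chain_coalgebra C \<and> (\<forall>x\<in>gens C. deg C x \<noteq> 1)"

definition tensor_coalg ::
  "('x, 'r::comm_ring_1) coalg \<Rightarrow> ('y, 'r) coalg \<Rightarrow> ('x \<times> 'y, 'r) coalg"
  where "tensor_coalg C D =
    \<lparr>gens = gens (tensor_basis C D), deg = deg (tensor_basis C D),
     dif = tdif C D,
     comult = lin (\<lambda>(x, y).
        bilin (\<lambda>(x1, x2) (y1, y2). (-1) ^ (deg C x2 * deg D y1) \<odot> bas ((x1, y1), (x2, y2)))
          (comult C (bas x)) (comult D (bas y))),
     one = (one C, one D)\<rparr>"

definition tensor_alg ::
  "('x, 'r::comm_ring_1, 'm) alg_scheme \<Rightarrow> ('y, 'r, 'n) alg_scheme \<Rightarrow> ('x \<times> 'y, 'r) alg"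
  where "tensor_alg A B =
    \<lparr>gens = gens (tensor_basis A B), deg = deg (tensor_basis A B),
     dif = tdif A B,
     mult = bilin (\<lambda>(x, y) (x', y').
        (-1) ^ (deg B y * deg A x') \<odot> (mult A (bas x) (bas x') \<otimes> mult B (bas y) (bas y'))),
     munit = munit A \<otimes> munit B\<rparr>"

definition chain_algebra_map ::
  "('x, 'r::comm_ring_1, 'm) alg_scheme \<Rightarrow> ('y, 'r, 'n) alg_scheme
    \<Rightarrow> (('x \<Rightarrow>\<^sub>0 'r) \<Rightarrow> ('y \<Rightarrow>\<^sub>0 'r)) \<Rightarrow> bool"
  where "chain_algebra_map A B f \<longleftrightarrow>
    graded_map 0 A B f \<and>
    f (munit A) = munit B \<and>
    (\<forall>p\<in>fmod A. \<forall>q\<in>fmod A. f (mult A p q) = mult B (f p) (f q)) \<and>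
    (\<forall>p\<in>fmod A. f (dif A p) = dif B (f p))"

definition sub_chain_algebra ::
  "('x, 'r::comm_ring_1, 'm) alg_scheme \<Rightarrow> ('x \<Rightarrow>\<^sub>0 'r) set \<Rightarrow> bool"
  where "sub_chain_algebra A B \<longleftrightarrow>
    graded_submodule A B \<and>
    munit A \<in> B \<and>
    (\<forall>p\<in>B. \<forall>q\<in>B. mult A p q \<in> B) \<and>
    (\<forall>p\<in>B. dif A p \<in> B)"


section \<open>Tensor algebras and the cobar construction\<close>

definition wmult :: "('x list \<Rightarrow>\<^sub>0 'r::comm_ring_1) \<Rightarrow> ('x list \<Rightarrow>\<^sub>0 'r) \<Rightarrow> ('x list \<Rightarrow>\<^sub>0 'r)" (infixr "\<star>" 75)
  where "p \<star> q = bilin (\<lambda>u v. bas (u @ v)) p q"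

definition wmap :: "('x \<Rightarrow> 'y) \<Rightarrow> ('x list \<Rightarrow>\<^sub>0 'r::comm_ring_1) \<Rightarrow> ('y list \<Rightarrow>\<^sub>0 'r)"
  where "wmap f = lin (\<lambda>w. bas (map f w))"

text \<open>The algebra map out of a tensor algebra with prescribed values \<open>F\<close> on the generators.\<close>

definition alg_ext ::
  "('y, 'r::comm_ring_1, 'm) alg_scheme \<Rightarrow> ('x \<Rightarrow> ('y \<Rightarrow>\<^sub>0 'r)) \<Rightarrow> ('x list \<Rightarrow>\<^sub>0 'r) \<Rightarrow> ('y \<Rightarrow>\<^sub>0 'r)"
  where "alg_ext B F = lin (\<lambda>w. foldr (\<lambda>x p. mult B (F x) p) w (munit B))"

text \<open>
  The degree \<open>-1\<close> \<open>(\<iota>, \<iota>)\<close>-derivation with prescribed values \<open>F\<close> on the generators, where \<open>\<iota>\<close> is the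
  inclusion of tensor algebras induced by the map \<open>i\<close> of basis elements:
  \<open>D(x w) = F(x) \<iota>(w) + (-1)\<^sup>|\<^sup>x\<^sup>| \<iota>(x) D(w)\<close>.
\<close>

primrec der_word ::
  "('x, 'm) graded_basis_scheme \<Rightarrow> ('x \<Rightarrow> 'y) \<Rightarrow> ('x \<Rightarrow> ('y list \<Rightarrow>\<^sub>0 'r::comm_ring_1))
    \<Rightarrow> 'x list \<Rightarrow> ('y list \<Rightarrow>\<^sub>0 'r)" where
  "der_word V i F [] = 0"
| "der_word V i F (x # w) =
     F x \<star> bas (map i w) + (-1) ^ deg V x \<odot> (bas [i x] \<star> der_word V i F w)"

definition der_ext ::
  "('x, 'm) graded_basis_scheme \<Rightarrow> ('x \<Rightarrow> 'y) \<Rightarrow> ('x \<Rightarrow> ('y list \<Rightarrow>\<^sub>0 'r::comm_ring_1))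
    \<Rightarrow> ('x list \<Rightarrow>\<^sub>0 'r) \<Rightarrow> ('y list \<Rightarrow>\<^sub>0 'r)"
  where "der_ext V i F = lin (der_word V i F)"

definition tensor_algebra ::
  "('x, 'm) graded_basis_scheme \<Rightarrow> ('x \<Rightarrow> ('x list \<Rightarrow>\<^sub>0 'r::comm_ring_1)) \<Rightarrow> ('x list, 'r) alg"
  where "tensor_algebra V \<delta> =
    \<lparr>gens = gens (words V), deg = deg (words V),
     dif = der_ext V id \<delta>, mult = wmult, munit = bas []\<rparr>"

text \<open>Basis of \<open>s\<^sup>-\<^sup>1 C\<^sub>+\<close>; the generator \<open>s\<^sup>-\<^sup>1 x\<close> is denoted by \<open>x\<close> itself.\<close>

definition desusp :: "('x, 'r::comm_ring_1) coalg \<Rightarrow> 'x graded_basis"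
  where "desusp C = \<lparr>gens = {x \<in> gens C. deg C x > 0}, deg = (\<lambda>x. deg C x - 1)\<rparr>"

definition sinv :: "('x, 'r::comm_ring_1) coalg \<Rightarrow> ('x \<Rightarrow>\<^sub>0 'r) \<Rightarrow> ('x list \<Rightarrow>\<^sub>0 'r)"
  where "sinv C = lin (\<lambda>x. if x = one C then 0 else bas [x])"

definition red_comult :: "('x, 'r::comm_ring_1) coalg \<Rightarrow> ('x \<Rightarrow>\<^sub>0 'r) \<Rightarrow> ('x \<times> 'x \<Rightarrow>\<^sub>0 'r)"
  where "red_comult C c = comult C c - c \<otimes> bas (one C) - bas (one C) \<otimes> c"

definition cobar :: "('x, 'r::comm_ring_1) coalg \<Rightarrow> ('x list, 'r) alg"
  where "cobar C = tensor_algebra (desusp C) (\<lambda>x.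
    - sinv C (dif C (bas x)) +
    lin (\<lambda>(y, z). (-1) ^ deg C y \<odot> (sinv C (bas y) \<star> sinv C (bas z))) (red_comult C (bas x)))"


section \<open>Strongly homotopy maps\<close>

definition has_linear_part ::
  "('x, 'r::comm_ring_1) coalg \<Rightarrow> ('y, 'r) coalg \<Rightarrow> (('x list \<Rightarrow>\<^sub>0 'r) \<Rightarrow> ('y list \<Rightarrow>\<^sub>0 'r))
    \<Rightarrow> (('x \<Rightarrow>\<^sub>0 'r) \<Rightarrow> ('y \<Rightarrow>\<^sub>0 'r)) \<Rightarrow> bool"
  where "has_linear_part C C' \<theta> \<theta>1 \<longleftrightarrow>
    (\<forall>c\<in>fmod C. \<forall>w\<in>Poly_Mapping.keys (\<theta> (sinv C c) - sinv C' (\<theta>1 c)). length w \<ge> 2)"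

text \<open>\<open>iter_comult C k x\<close> is \<open>\<Delta>\<^sup>(\<^sup>k\<^sup>)(x)\<close>, an element of the \<open>k\<close>-fold tensor power of \<open>C\<close>.\<close>

primrec iter_comult :: "('x, 'r::comm_ring_1) coalg \<Rightarrow> nat \<Rightarrow> 'x \<Rightarrow> ('x list \<Rightarrow>\<^sub>0 'r)" where
  "iter_comult C 0 x = counit C (bas x) \<odot> bas []"
| "iter_comult C (Suc k) x = lin (\<lambda>(y, z). bas [y] \<star> iter_comult C k z) (comult C (bas x))"

text \<open>
  \<open>x\<^sub>1 \<dots> x\<^sub>k \<otimes> y\<^sub>1 \<dots> y\<^sub>k \<mapsto> \<plusminus> (x\<^sub>1, y\<^sub>1) \<dots> (x\<^sub>k, y\<^sub>k)\<close> with the Koszul sign of the permutation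
  to \<open>x\<^sub>1 y\<^sub>1 \<dots> x\<^sub>k y\<^sub>k\<close>: each \<open>x\<^sub>j\<close> moves past the \<open>y\<^sub>i\<close> with \<open>i < j\<close>. It is only applied to words of
  equal length.
\<close>

definition interleave ::
  "('x, 'm) graded_basis_scheme \<Rightarrow> ('y, 'n) graded_basis_scheme
    \<Rightarrow> ('x list \<Rightarrow>\<^sub>0 'r::comm_ring_1) \<Rightarrow> ('y list \<Rightarrow>\<^sub>0 'r) \<Rightarrow> (('x \<times> 'y) list \<Rightarrow>\<^sub>0 'r)"
  where "interleave A B = bilin (\<lambda>u v.
    (-1) ^ (\<Sum>j<length u. \<Sum>i<j. deg B (v ! i) * deg A (u ! j)) \<odot> bas (zip u v))"

text \<open>
  In \<open>D \<curlywedge> \<theta>\<close> the signs from moving \<open>s\<^sup>-\<^sup>1\<close> past \<open>d\<close> in \<open>s\<^sup>-\<^sup>1(d \<otimes> c)\<close> and past each \<open>d\<^sub>(\<^sub>j\<^sub>)\<close> in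
  \<open>s\<^sup>-\<^sup>1(d\<^sub>(\<^sub>j\<^sub>) \<otimes> c\<^sub>j)\<close> cancel, as \<open>|d|\<close> is the sum of the \<open>|d\<^sub>(\<^sub>j\<^sub>)|\<close>; only the interleaving sign remains.
\<close>

definition sh_left ::
  "('x, 'r::comm_ring_1) coalg \<Rightarrow> ('y, 'r) coalg \<Rightarrow> (('x list \<Rightarrow>\<^sub>0 'r) \<Rightarrow> ('y list \<Rightarrow>\<^sub>0 'r))
    \<Rightarrow> ('z, 'r) coalg \<Rightarrow> (('x \<times> 'z) list \<Rightarrow>\<^sub>0 'r) \<Rightarrow> (('y \<times> 'z) list \<Rightarrow>\<^sub>0 'r)"
  where "sh_left C C' \<theta> D = alg_ext (cobar (tensor_coalg C' D)) (\<lambda>(c, d).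
    if c = one C then bas [(one C', d)]
    else lin (\<lambda>w. interleave (desusp C') D (bas w) (iter_comult D (length w) d)) (\<theta> (bas [c])))"

definition sh_right ::
  "('z, 'r::comm_ring_1) coalg \<Rightarrow> ('x, 'r) coalg \<Rightarrow> ('y, 'r) coalg
    \<Rightarrow> (('x list \<Rightarrow>\<^sub>0 'r) \<Rightarrow> ('y list \<Rightarrow>\<^sub>0 'r)) \<Rightarrow> (('z \<times> 'x) list \<Rightarrow>\<^sub>0 'r) \<Rightarrow> (('z \<times> 'y) list \<Rightarrow>\<^sub>0 'r)"
  where "sh_right D C C' \<theta> = alg_ext (cobar (tensor_coalg D C')) (\<lambda>(d, c).
    if c = one C then bas [(d, one C')]
    else lin (\<lambda>w. interleave D (desusp C') (iter_comult D (length w) d) (bas w)) (\<theta> (bas [c])))"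

text \<open>\<open>\<theta> \<curlywedge> \<theta>'\<close> for \<open>\<theta> : \<Omega>C \<rightarrow> \<Omega>C'\<close> and \<open>\<theta>' : \<Omega>D \<rightarrow> \<Omega>D'\<close>\<close>

definition sh_tensor ::
  "('x, 'r::comm_ring_1) coalg \<Rightarrow> ('y, 'r) coalg \<Rightarrow> (('x list \<Rightarrow>\<^sub>0 'r) \<Rightarrow> ('y list \<Rightarrow>\<^sub>0 'r))
    \<Rightarrow> ('u, 'r) coalg \<Rightarrow> ('v, 'r) coalg \<Rightarrow> (('u list \<Rightarrow>\<^sub>0 'r) \<Rightarrow> ('v list \<Rightarrow>\<^sub>0 'r))
    \<Rightarrow> (('x \<times> 'u) list \<Rightarrow>\<^sub>0 'r) \<Rightarrow> (('y \<times> 'v) list \<Rightarrow>\<^sub>0 'r)"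
  where "sh_tensor C C' \<theta> D D' \<theta>' = sh_right C' D D' \<theta>' \<circ> sh_left C C' \<theta> D"


section \<open>Alexander-Whitney coalgebras\<close>

definition milgram ::
  "('x, 'r::comm_ring_1) coalg \<Rightarrow> ('y, 'r) coalg
    \<Rightarrow> (('x \<times> 'y) list \<Rightarrow>\<^sub>0 'r) \<Rightarrow> ('x list \<times> 'y list \<Rightarrow>\<^sub>0 'r)"
  where "milgram C D = alg_ext (tensor_alg (cobar C) (cobar D)) (\<lambda>(c, d).
    if d = one D then bas [c] \<otimes> bas []
    else if c = one C then bas [] \<otimes> bas [d]
    else 0)"

definition loop_comult ::
  "('x, 'r::comm_ring_1) coalg \<Rightarrow> (('x list \<Rightarrow>\<^sub>0 'r) \<Rightarrow> (('x \<times> 'x) list \<Rightarrow>\<^sub>0 'r))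
    \<Rightarrow> ('x list \<Rightarrow>\<^sub>0 'r) \<Rightarrow> ('x list \<times> 'x list \<Rightarrow>\<^sub>0 'r)"
  where "loop_comult C \<Psi> = milgram C C \<circ> \<Psi>"

definition AW_coalgebra ::
  "('x, 'r::comm_ring_1) coalg \<Rightarrow> (('x list \<Rightarrow>\<^sub>0 'r) \<Rightarrow> (('x \<times> 'x) list \<Rightarrow>\<^sub>0 'r)) \<Rightarrow> bool"
  where "AW_coalgebra C \<Psi> \<longleftrightarrow>
    simply_connected C \<and>
    chain_algebra_map (cobar C) (cobar (tensor_coalg C C)) \<Psi> \<and>
    has_linear_part C (tensor_coalg C C) \<Psi> (comult C) \<and>
    (let \<psi> = loop_comult C \<Psi> in
      \<forall>p\<in>fmod (cobar C).
        assoc (tmap (cobar C) 0 \<psi> id (\<psi> p)) = tmap (cobar C) 0 id \<psi> (\<psi> p))"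

definition AW_morphism ::
  "('x, 'r::comm_ring_1) coalg \<Rightarrow> (('x list \<Rightarrow>\<^sub>0 'r) \<Rightarrow> (('x \<times> 'x) list \<Rightarrow>\<^sub>0 'r))
    \<Rightarrow> ('y, 'r) coalg \<Rightarrow> (('y list \<Rightarrow>\<^sub>0 'r) \<Rightarrow> (('y \<times> 'y) list \<Rightarrow>\<^sub>0 'r))
    \<Rightarrow> (('x list \<Rightarrow>\<^sub>0 'r) \<Rightarrow> ('y list \<Rightarrow>\<^sub>0 'r)) \<Rightarrow> bool"
  where "AW_morphism C' \<Psi>' C \<Psi> \<theta> \<longleftrightarrow>
    chain_algebra_map (cobar C') (cobar C) \<theta> \<and>
    (\<forall>p\<in>fmod (cobar C'). \<Psi> (\<theta> p) = sh_tensor C' C \<theta> C' C \<theta> (\<Psi>' p))"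

definition with_comult ::
  "('x, 'r) alg \<Rightarrow> (('x \<Rightarrow>\<^sub>0 'r) \<Rightarrow> ('x \<times> 'x \<Rightarrow>\<^sub>0 'r::comm_ring_1)) \<Rightarrow> ('x, 'r) hopf"
  where "with_comult A \<psi> =
    \<lparr>gens = gens A, deg = deg A, dif = dif A, mult = mult A, munit = munit A, hcomult = \<psi>\<rparr>"

text \<open>The chain Hopf algebra \<open>(\<Omega>C, \<psi>)\<close>\<close>

definition AW_cobar ::
  "('x, 'r::comm_ring_1) coalg \<Rightarrow> (('x list \<Rightarrow>\<^sub>0 'r) \<Rightarrow> (('x \<times> 'x) list \<Rightarrow>\<^sub>0 'r)) \<Rightarrow> ('x list, 'r) hopf"
  where "AW_cobar C \<Psi> = with_comult (cobar C) (loop_comult C \<Psi>)"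


section \<open>Based paths and the path-loop construction\<close>

datatype 'x path = Base 'x | Bar 'x

definition path_incl :: "('x \<Rightarrow>\<^sub>0 'r::comm_ring_1) \<Rightarrow> ('x path \<Rightarrow>\<^sub>0 'r)"
  where "path_incl = lin (\<lambda>x. bas (Base x))"

definition path_bar :: "('x, 'r::comm_ring_1) coalg \<Rightarrow> ('x \<Rightarrow>\<^sub>0 'r) \<Rightarrow> ('x path \<Rightarrow>\<^sub>0 'r)"
  where "path_bar C = lin (\<lambda>x. if x = one C then 0 else bas (Bar x))"

definition path_coalg :: "('x, 'r::comm_ring_1) coalg \<Rightarrow> ('x path, 'r) coalg"
  where "path_coalg C =
    \<lparr>gens = Base ` gens C \<union> Bar ` {x \<in> gens C. deg C x > 0},
     deg = case_path (\<lambda>x. deg C x) (\<lambda>x. deg C x - 1),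
     dif = lin (case_path
        (\<lambda>x. path_incl (dif C (bas x)) - path_bar C (bas x))
        (\<lambda>x. - path_bar C (dif C (bas x)))),
     comult = lin (case_path
        (\<lambda>x. tmap C 0 path_incl path_incl (comult C (bas x)))
        (\<lambda>x. tmap C 0 (path_bar C) path_incl (comult C (bas x)) +
             tmap C 1 path_incl (path_bar C) (comult C (bas x)))),
     one = Base (one C)\<rparr>"

definition path_proj :: "('x path \<Rightarrow>\<^sub>0 'r::comm_ring_1) \<Rightarrow> ('x \<Rightarrow>\<^sub>0 'r)"
  where "path_proj = lin (case_path bas (\<lambda>x. 0))"

definition cobar_path_proj ::
  "('x, 'r::comm_ring_1) coalg \<Rightarrow> ('x path list \<Rightarrow>\<^sub>0 'r) \<Rightarrow> ('x list \<Rightarrow>\<^sub>0 'r)"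
  where "cobar_path_proj C = alg_ext (cobar C) (\<lambda>z. sinv C (path_proj (bas z)))"

definition path_kappa ::
  "('x, 'r::comm_ring_1) coalg \<Rightarrow> ('x list \<Rightarrow>\<^sub>0 'r) \<Rightarrow> ('x path list \<Rightarrow>\<^sub>0 'r)"
  where "path_kappa C = der_ext (desusp C) Base (\<lambda>x. - bas [Bar x])"

definition path_loop_comult ::
  "('x, 'r::comm_ring_1) coalg \<Rightarrow> (('x list \<Rightarrow>\<^sub>0 'r) \<Rightarrow> (('x \<times> 'x) list \<Rightarrow>\<^sub>0 'r))
    \<Rightarrow> ('x path list \<Rightarrow>\<^sub>0 'r) \<Rightarrow> ('x path list \<times> 'x path list \<Rightarrow>\<^sub>0 'r)"
  where "path_loop_comult C \<Psi> =
    (let \<psi> = loop_comult C \<Psi>; \<iota> = wmap Base; \<kappa> = path_kappa C in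
     alg_ext (tensor_alg (cobar (path_coalg C)) (cobar (path_coalg C))) (case_path
       (\<lambda>x. tmap (cobar C) 0 \<iota> \<iota> (\<psi> (bas [x])))
       (\<lambda>x. - (tmap (cobar C) 0 \<kappa> \<iota> (\<psi> (bas [x])) + tmap (cobar C) 1 \<iota> \<kappa> (\<psi> (bas [x]))))))"

definition path_loop ::
  "('x, 'r::comm_ring_1) coalg \<Rightarrow> (('x list \<Rightarrow>\<^sub>0 'r) \<Rightarrow> (('x \<times> 'x) list \<Rightarrow>\<^sub>0 'r)) \<Rightarrow> ('x path list, 'r) hopf"
  where "path_loop C \<Psi> = with_comult (cobar (path_coalg C)) (path_loop_comult C \<Psi>)"


section \<open>Coproducts\<close>

text \<open>
  The coproduct of two tensor algebras \<open>T V\<close> and \<open>T W\<close> is \<open>T (V \<oplus> W)\<close>, with \<open>wmap Inl\<close> and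
  \<open>wmap Inr\<close> as the canonical inclusions.
\<close>

definition cobar_coprod ::
  "('x, 'r::comm_ring_1) coalg \<Rightarrow> ('y, 'r) coalg \<Rightarrow> (('x + 'y) list, 'r) alg"
  where "cobar_coprod C D = tensor_algebra (sum_basis (desusp C) (desusp D)) (case_sum
    (\<lambda>x. wmap Inl (dif (cobar C) (bas [x])))
    (\<lambda>y. wmap Inr (dif (cobar D) (bas [y]))))"

definition coprod_path ::
  "('y, 'r::comm_ring_1) coalg \<Rightarrow> (('y list \<Rightarrow>\<^sub>0 'r) \<Rightarrow> (('y \<times> 'y) list \<Rightarrow>\<^sub>0 'r))
    \<Rightarrow> ('x, 'r) coalg \<Rightarrow> (('x list \<Rightarrow>\<^sub>0 'r) \<Rightarrow> (('x \<times> 'x) list \<Rightarrow>\<^sub>0 'r))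
    \<Rightarrow> (('y + 'x path) list, 'r) hopf"
  where "coprod_path C' \<Psi>' C \<Psi> =
    (let A = cobar_coprod C' (path_coalg C) in
     with_comult A (alg_ext (tensor_alg A A) (case_sum
       (\<lambda>x. tmap (cobar C') 0 (wmap Inl) (wmap Inl) (loop_comult C' \<Psi>' (bas [x])))
       (\<lambda>y. tmap (cobar (path_coalg C)) 0 (wmap Inr) (wmap Inr) (path_loop_comult C \<Psi> (bas [y]))))))"

text \<open>The map \<open>\<theta> + \<pi>\<close> on cobar constructions\<close>

definition coprod_path_map ::
  "('x, 'r::comm_ring_1) coalg \<Rightarrow> (('y list \<Rightarrow>\<^sub>0 'r) \<Rightarrow> ('x list \<Rightarrow>\<^sub>0 'r))
    \<Rightarrow> (('y + 'x path) list \<Rightarrow>\<^sub>0 'r) \<Rightarrow> ('x list \<Rightarrow>\<^sub>0 'r)"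
  where "coprod_path_map C \<theta> = alg_ext (cobar C) (case_sum
    (\<lambda>x. \<theta> (bas [x]))
    (\<lambda>y. cobar_path_proj C (bas [y])))"


section \<open>Comodules\<close>

definition coaction ::
  "('x, 'r::comm_ring_1) hopf \<Rightarrow> (('x \<Rightarrow>\<^sub>0 'r) \<Rightarrow> ('y \<Rightarrow>\<^sub>0 'r)) \<Rightarrow> ('x \<Rightarrow>\<^sub>0 'r) \<Rightarrow> ('x \<times> 'y \<Rightarrow>\<^sub>0 'r)"
  where "coaction H' p x = tmap H' 0 id p (hcomult H' x)"

definition cotensor ::
  "('x, 'r::comm_ring_1) hopf \<Rightarrow> (('x \<Rightarrow>\<^sub>0 'r) \<Rightarrow> ('x \<times> 'y \<Rightarrow>\<^sub>0 'r)) \<Rightarrow> ('y, 'r) hopf \<Rightarrow> ('x \<Rightarrow>\<^sub>0 'r) set"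
  where "cotensor H' \<nu> H = {x \<in> fmod H'. \<nu> x = x \<otimes> munit H}"

text \<open>
  For a graded submodule \<open>B\<close> of \<open>fmod G\<close> and the free module \<open>H\<close>, the map from \<open>B \<otimes> H\<close> to \<open>G \<otimes> H\<close> is
  injective, so \<open>B \<otimes> H\<close> is realised as its image.
\<close>

definition sub_tensor ::
  "('x \<Rightarrow>\<^sub>0 'r::comm_ring_1) set \<Rightarrow> ('y, 'm) graded_basis_scheme \<Rightarrow> ('x \<times> 'y \<Rightarrow>\<^sub>0 'r) set"
  where "sub_tensor B H = fm.span {b \<otimes> h | b h. b \<in> B \<and> h \<in> fmod H}"

text \<open>
  The graded right \<open>H\<close>-comodule \<open>(M, \<nu>)\<close> is isomorphic to \<open>B \<otimes> H\<close> with coaction \<open>1 \<otimes> \<Delta>\<^sub>H\<close>, where \<open>B\<close>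
  is a graded submodule of \<open>fmod G\<close>.
\<close>

definition cofree_comodule ::
  "('z, 'm) graded_basis_scheme \<Rightarrow> (('z \<Rightarrow>\<^sub>0 'r) \<Rightarrow> ('z \<times> 'y \<Rightarrow>\<^sub>0 'r)) \<Rightarrow> ('y, 'r::comm_ring_1) hopf
    \<Rightarrow> ('x, 'n) graded_basis_scheme \<Rightarrow> ('x \<Rightarrow>\<^sub>0 'r) set \<Rightarrow> bool"
  where "cofree_comodule M \<nu> H G B \<longleftrightarrow>
    graded_submodule G B \<and>
    (\<exists>\<phi>. graded_map 0 M (tensor_basis G H) \<phi> \<and>
         bij_betw \<phi> (fmod M) (sub_tensor B H) \<and>
         (\<forall>x\<in>fmod M. assoc (tmap M 0 \<phi> id (\<nu> x)) = tmap G 0 id (hcomult H) (\<phi> x)))"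

end

theory Submission
  imports Defs
begin

text \<open>
  Let \<open>H = (\<Omega>C, \<psi>)\<close>, and let \<open>H'\<close> be the path-loop algebra or its coproduct with \<open>\<Omega>C'\<close>. The inclusion
  \<open>\<iota> : H \<rightarrow> H'\<close> is not a chain map, but it is a section of the projection \<open>p\<close> and respects products
  and coproducts. Hence \<open>H'\<close> is a Hopf module: \<open>H\<close> acts by right multiplication through \<open>\<iota>\<close> and coacts
  by \<open>\<nu> = (1 \<otimes> p) \<Delta>\<close>. As \<open>H\<close> is connected, the structure theorem for Hopf modules identifies \<open>H'\<close> with
  \<open>B \<otimes> H\<close>, where \<open>B\<close> consists of the coinvariants.

  The coaction \<open>\<nu>\<close> is an algebra map with \<open>\<nu>\<iota> = (\<iota> \<otimes> 1)\<psi>\<close> and \<open>\<nu>\<kappa> = (\<kappa> \<otimes> 1)\<psi>\<close>, so its coassociativity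
  and counitality follow from those of \<open>\<psi>\<close>. The counit of \<open>\<psi>\<close> is not part of the definition of an
  Alexander-Whitney coalgebra: coassociativity makes \<open>(1 \<otimes> \<epsilon>)\<psi>\<close> idempotent, while the condition on the
  linear part makes it injective, so it is the identity. Finally \<open>d\<iota> = \<iota>d - \<kappa>\<close> and
  \<open>d\<kappa> = -\<kappa>d\<close> show that \<open>\<nu>\<close> is a chain map, so that \<open>B\<close> is closed under the differential.
\<close>

text \<open>The projection onto coinvariants is classically
  \<open>x \<mapsto> \<Sum> x\<^sub>0 S(x\<^sub>1)\<close>. No antipode is given, so the projection
  is built by recursion on the degree, which \<open>H\<^sub>0 = R\<close> makes possible. The
  coaction is computed on letters: applying \<open>p\<close> to the second factor kills the summand
  \<open>\<iota> \<otimes> \<kappa>\<close> of the comultiplication. Both sides of nearly every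
  identity are algebra maps, or derivations along one algebra map, and are compared on letters. The
  exception is \<open>d\<kappa> + \<kappa>d\<close>, of degree -2. Two facts about Milgram's map
  \<open>q\<close> lead from \<Psi> to \<psi>. It commutes with the differentials, so \<psi> is a
  chain map; there the mixed terms of the quadratic part cancel. And it carries
  \<open>\<theta> \<curlywedge> \<theta>\<close> to \<open>\<theta> \<otimes> \<theta>\<close>, so a
  morphism respects the comultiplications; there \<open>q\<close> kills words having a letter with
  two nontrivial components. The second fact governs the coaction on the letters of
  \<open>\<Omega>C'\<close>, which is \<open>1 \<otimes> \<theta>\<close> after
  \<open>\<psi>'\<close>.\<close>

declare One_nat_def [simp del]

subsection \<open>Linear maps on free modules\<close>

abbreviation keys where "keys \<equiv> Poly_Mapping.keys"
abbreviation lookup where "lookup \<equiv> Poly_Mapping.lookup"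

lemma lin_superset:
  assumes "finite S" "keys p \<subseteq> S"
  shows "lin F p = (\<Sum>x\<in>S. lookup p x \<odot> F x)"
  unfolding lin_def
  by (rule sum.mono_neutral_left) (use assms in \<open>auto simp: in_keys_iff\<close>)

lemma lin_add [simp]: "lin F (p + q) = lin F p + lin F q"
proof -
  let ?S = "keys p \<union> keys q"
  have "keys (p + q) \<subseteq> ?S" by (rule Poly_Mapping.keys_add)
  then show ?thesis
    by (simp add: lin_superset[of ?S] lookup_add fm.scale_left_distrib sum.distrib)
qed

lemma lin_smul [simp]: "lin F (a \<odot> p) = a \<odot> lin F p"
proof -
  have "keys (a \<odot> p) \<subseteq> keys p" by (auto simp: in_keys_iff)
  then show ?thesis
    by (simp add: lin_superset[of "keys p"] fm.scale_sum_right)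
qed

lemma lin_zero [simp]: "lin F 0 = 0"
  by (simp add: lin_def)

lemma lin_bas [simp]: "lin F (bas x) = F x"
  by (simp add: lin_def)

lemma lin_uminus [simp]: "lin F (- p) = - lin F p"
  using lin_smul[of F "-1" p] by simp

lemma lin_diff [simp]: "lin F (p - q) = lin F p - lin F q"
  using lin_add[of F p "- q"] by simp

lemma lin_sum: "lin F (sum g S) = (\<Sum>i\<in>S. lin F (g i))"
  by (induction S rule: infinite_finite_induct) auto

lemma lin_cong [fundef_cong]: "p = q \<Longrightarrow> (\<And>x. x \<in> keys q \<Longrightarrow> F x = G x) \<Longrightarrow> lin F p = lin G q"
  by (auto simp: lin_def intro: sum.cong)

lemma lin_bas_id [simp]: "lin bas p = p"
proof (rule poly_mapping_eqI)
  fix k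
  have "(\<Sum>x\<in>keys p. lookup p x * (1 when x = k)) = (\<Sum>x\<in>keys p. if x = k then lookup p x else 0)"
    by (rule sum.cong) auto
  then show "lookup (lin bas p) k = lookup p k"
    by (simp add: lin_def lookup_sum lookup_single in_keys_iff)
qed

lemma lin_lin: "lin F (lin G p) = lin (\<lambda>x. lin F (G x)) p"
  by (simp add: lin_def[of G] lin_def[of "\<lambda>x. lin F (G x)"] lin_sum)

lemma lin_fun_add: "lin (\<lambda>x. F x + G x) p = lin F p + lin G p"
  by (simp add: lin_def fm.scale_right_distrib sum.distrib)

lemma lin_fun_smul: "lin (\<lambda>x. a \<odot> F x) p = a \<odot> lin F p"
  by (simp add: lin_def fm.scale_sum_right mult.commute)

lemma lin_fun_uminus: "lin (\<lambda>x. - F x) p = - lin F p"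
  by (simp add: lin_def sum_negf)

lemma lin_fun_diff: "lin (\<lambda>x. F x - G x) p = lin F p - lin G p"
  by (simp add: lin_def fm.scale_right_diff_distrib sum_subtractf)

lemma lin_fun_zero [simp]: "lin (\<lambda>x. 0) p = 0"
  by (simp add: lin_def)

lemma keys_lin: "keys (lin F p) \<subseteq> (\<Union>x\<in>keys p. keys (F x))"
proof -
  have "keys (lin F p) \<subseteq> (\<Union>x\<in>keys p. keys (lookup p x \<odot> F x))"
    unfolding lin_def by (rule Poly_Mapping.keys_sum)
  also have "\<dots> \<subseteq> (\<Union>x\<in>keys p. keys (F x))"
    by (intro UN_mono order_refl) (auto simp: in_keys_iff)
  finally show ?thesis .
qed

lemma in_keys_linE:
  assumes "y \<in> keys (lin F p)" obtains x where "x \<in> keys p" "y \<in> keys (F x)"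
  using keys_lin[of F p] assms by blast

lemma bilin_lin: "bilin F p q = lin (\<lambda>x. lin (F x) q) p"
  by (simp add: bilin_def lin_def fm.scale_sum_right)

lemma bilin_lin': "bilin F p q = lin (\<lambda>y. lin (\<lambda>x. F x y) p) q"
  unfolding bilin_lin unfolding lin_def fm.scale_sum_right
  by (subst sum.swap) (simp add: mult.commute)

lemma bilin_bas [simp]: "bilin F (bas x) (bas y) = F x y"
  by (simp add: bilin_lin)

lemma bilin_simps [simp]:
  "bilin F (p + p') q = bilin F p q + bilin F p' q"
  "bilin F p (q + q') = bilin F p q + bilin F p q'"
  "bilin F (a \<odot> p) q = a \<odot> bilin F p q"
  "bilin F p (a \<odot> q) = a \<odot> bilin F p q"
  "bilin F 0 q = 0" "bilin F p 0 = 0"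
  "bilin F (- p) q = - bilin F p q"
  "bilin F p (- q) = - bilin F p q"
  "bilin F (p - p') q = bilin F p q - bilin F p' q"
  "bilin F p (q - q') = bilin F p q - bilin F p q'"
  by (simp_all add: bilin_lin lin_fun_add lin_fun_smul lin_fun_uminus lin_fun_diff)

lemma bilin_cong:
  "(\<And>x y. x \<in> keys p \<Longrightarrow> y \<in> keys q \<Longrightarrow> F x y = G x y) \<Longrightarrow> bilin F p q = bilin G p q"
  by (auto simp: bilin_lin intro!: lin_cong)

lemma bilin_fun_add: "bilin (\<lambda>x y. F x y + G x y) p q = bilin F p q + bilin G p q"
  by (simp add: bilin_lin lin_fun_add)

lemma lin_bilin: "lin F (bilin G p q) = bilin (\<lambda>x y. lin F (G x y)) p q"
  by (simp add: bilin_lin lin_lin)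

lemma in_keys_bilinE:
  assumes "z \<in> keys (bilin F p q)"
  obtains x y where "x \<in> keys p" "y \<in> keys q" "z \<in> keys (F x y)"
  using assms unfolding bilin_lin by (blast elim!: in_keys_linE)

lemma tens_bas [simp]: "bas x \<otimes> bas y = bas (x, y)"
  by (simp add: tens_def)

lemma tens_simps [simp]:
  "(p + p') \<otimes> q = p \<otimes> q + p' \<otimes> q"
  "p \<otimes> (q + q') = p \<otimes> q + p \<otimes> q'"
  "(a \<odot> p) \<otimes> q = a \<odot> (p \<otimes> q)"
  "p \<otimes> (a \<odot> q) = a \<odot> (p \<otimes> q)"
  "0 \<otimes> q = 0" "p \<otimes> 0 = 0"
  "(- p) \<otimes> q = - (p \<otimes> q)"
  "p \<otimes> (- q) = - (p \<otimes> q)"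
  "(p - p') \<otimes> q = p \<otimes> q - p' \<otimes> q"
  "p \<otimes> (q - q') = p \<otimes> q - p \<otimes> q'"
  by (simp_all add: tens_def)

lemma lin_tens: "lin F (p \<otimes> q) = lin (\<lambda>x. lin (\<lambda>y. F (x, y)) q) p"
  by (simp add: tens_def lin_bilin) (simp add: bilin_lin)

lemma tens_lin: "lin F p \<otimes> lin G q = bilin (\<lambda>x y. F x \<otimes> G y) p q"
proof -
  have 1: "lin F p \<otimes> r = lin (\<lambda>x. F x \<otimes> r) p" for r
    by (simp add: tens_def bilin_lin lin_lin)
  have 2: "r \<otimes> lin G q = lin (\<lambda>y. r \<otimes> G y) q" for r
    unfolding tens_def bilin_lin' by (simp add: lin_lin)
  show ?thesis unfolding bilin_lin 1 by (simp only: 2)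
qed

lemma tens_lin_left: "lin F p \<otimes> r = lin (\<lambda>x. F x \<otimes> r) p"
  by (simp add: tens_def bilin_lin lin_lin)

lemma tens_lin_right: "r \<otimes> lin G q = lin (\<lambda>y. r \<otimes> G y) q"
  unfolding tens_def bilin_lin' by (simp add: lin_lin)

lemma lookup_tens: "lookup (p \<otimes> q) (x, y) = lookup p x * lookup q y"
proof -
  have "lookup (p \<otimes> q) (x, y) = (\<Sum>u\<in>keys p. \<Sum>v\<in>keys q. lookup p u * lookup q v * (1 when (u, v) = (x, y)))"
    by (simp add: tens_def bilin_def lookup_sum lookup_single)
  also have "\<dots> = (\<Sum>u\<in>keys p. \<Sum>v\<in>keys q. if v = y then (if u = x then lookup p u * lookup q v else 0) else 0)"
    by (intro sum.cong refl) auto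
  also have "\<dots> = (\<Sum>u\<in>keys p. if u = x then lookup p u * lookup q y else 0)"
    by (intro sum.cong refl) (auto simp: in_keys_iff)
  also have "\<dots> = lookup p x * lookup q y"
    by (auto simp: in_keys_iff)
  finally show ?thesis .
qed

lemma keys_tens: "keys (p \<otimes> q) \<subseteq> keys p \<times> keys q"
  by (auto simp: in_keys_iff lookup_tens)

subsection \<open>Homogeneous elements and graded maps\<close>

lemma gens_tensor_basis [simp]: "gens (tensor_basis A B) = gens A \<times> gens B"
  by (simp add: tensor_basis_def)

lemma deg_tensor_basis [simp]: "deg (tensor_basis A B) (x, y) = deg A x + deg B y"
  by (simp add: tensor_basis_def)

lemma fmod_simps [simp]:
  "0 \<in> fmod A"
  "p \<in> fmod A \<Longrightarrow> q \<in> fmod A \<Longrightarrow> p + q \<in> fmod A"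
  "p \<in> fmod A \<Longrightarrow> q \<in> fmod A \<Longrightarrow> p - q \<in> fmod A"
  "p \<in> fmod A \<Longrightarrow> a \<odot> p \<in> fmod A"
  "p \<in> fmod A \<Longrightarrow> - p \<in> fmod A"
  "bas x \<in> fmod A \<longleftrightarrow> x \<in> gens A"
proof -
  show "p \<in> fmod A \<Longrightarrow> q \<in> fmod A \<Longrightarrow> p + q \<in> fmod A"
    using Poly_Mapping.keys_add[of p q] by (auto simp: fmod_def)
  show "p \<in> fmod A \<Longrightarrow> q \<in> fmod A \<Longrightarrow> p - q \<in> fmod A"
    using keys_diff[of p q] by (auto simp: fmod_def)
  show "p \<in> fmod A \<Longrightarrow> a \<odot> p \<in> fmod A"
    by (fastforce simp: fmod_def in_keys_iff)
qed (auto simp: fmod_def)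

lemma fmod_sum: "(\<And>i. i \<in> S \<Longrightarrow> g i \<in> fmod A) \<Longrightarrow> sum g S \<in> fmod A"
  by (induction S rule: infinite_finite_induct) auto

lemma lin_in_fmod: "p \<in> fmod A \<Longrightarrow> (\<And>x. x \<in> gens A \<Longrightarrow> F x \<in> fmod B) \<Longrightarrow> lin F p \<in> fmod B"
  unfolding lin_def by (rule fmod_sum) (auto simp: fmod_def[of A])

lemma fmod_keysD: "p \<in> fmod A \<Longrightarrow> x \<in> keys p \<Longrightarrow> x \<in> gens A"
  by (auto simp: fmod_def)

lemma tens_in_fmod [simp]: "p \<in> fmod A \<Longrightarrow> q \<in> fmod B \<Longrightarrow> p \<otimes> q \<in> fmod (tensor_basis A B)"
  using keys_tens[of p q] by (auto simp: fmod_def)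

lemma fmod_cong: "gens A = gens B \<Longrightarrow> fmod A = fmod B"
  by (simp add: fmod_def)

lemma fmod_induct [consumes 1, case_names zero add smul bas]:
  assumes "p \<in> fmod A" "P 0"
    and "\<And>p q. p \<in> fmod A \<Longrightarrow> q \<in> fmod A \<Longrightarrow> P p \<Longrightarrow> P q \<Longrightarrow> P (p + q)"
    and "\<And>a p. p \<in> fmod A \<Longrightarrow> P p \<Longrightarrow> P (a \<odot> p)"
    and "\<And>x. x \<in> gens A \<Longrightarrow> P (bas x)"
  shows "P p"
proof -
  have "P (\<Sum>x\<in>S. lookup p x \<odot> bas x) \<and> (\<Sum>x\<in>S. lookup p x \<odot> bas x) \<in> fmod A"
    if "finite S" "S \<subseteq> keys p" for S
    using that
  proof (induction S rule: finite_induct)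
    case (insert x S)
    then have "x \<in> gens A" using assms(1) by (auto dest: fmod_keysD)
    with insert show ?case using assms by simp
  qed (use assms in auto)
  from this[of "keys p"] have "P (lin bas p)" unfolding lin_def by simp
  then show ?thesis by simp
qed

text \<open>Maps such as \<open>\<Psi>\<close> and \<open>\<theta>\<close> are total functions
  constrained on \<open>fmod\<close> only, so linearity is relative to a basis. No degree is
  recorded: maps of degree 0 and -1 are treated alike.\<close>

definition flin ::
  "('x, 'm) graded_basis_scheme \<Rightarrow> ('y, 'n) graded_basis_scheme
    \<Rightarrow> (('x \<Rightarrow>\<^sub>0 'r::comm_ring_1) \<Rightarrow> ('y \<Rightarrow>\<^sub>0 'r)) \<Rightarrow> bool"
  where "flin A B f \<longleftrightarrow>
    (\<forall>p\<in>fmod A. f p \<in> fmod B) \<and>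
    (\<forall>p\<in>fmod A. \<forall>q\<in>fmod A. f (p + q) = f p + f q) \<and>
    (\<forall>a. \<forall>p\<in>fmod A. f (a \<odot> p) = a \<odot> f p)"

lemma flinD:
  assumes "flin A B f"
  shows "p \<in> fmod A \<Longrightarrow> f p \<in> fmod B"
    and "p \<in> fmod A \<Longrightarrow> q \<in> fmod A \<Longrightarrow> f (p + q) = f p + f q"
    and "p \<in> fmod A \<Longrightarrow> f (a \<odot> p) = a \<odot> f p"
  using assms by (auto simp: flin_def)

lemma flin_zero: "flin A B f \<Longrightarrow> f 0 = 0"
  using flinD(3)[of A B f 0 0] by simp

lemma flin_uminus_app: "flin A B f \<Longrightarrow> p \<in> fmod A \<Longrightarrow> f (- p) = - f p"
  using flinD(3)[of A B f p "-1"] by simp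

lemma flin_diff_app: "flin A B f \<Longrightarrow> p \<in> fmod A \<Longrightarrow> q \<in> fmod A \<Longrightarrow> f (p - q) = f p - f q"
  using flinD(2)[of A B f p "- q"] by (simp add: flin_uminus_app)

text \<open>Only linearity is compared, so the two codomain bases may differ.\<close>

lemma flin_eqI:
  assumes "flin A B f" "flin A B' g" "\<And>x. x \<in> gens A \<Longrightarrow> f (bas x) = g (bas x)" "p \<in> fmod A"
  shows "f p = g p"
  using assms(4) by (induction rule: fmod_induct) (auto simp: assms flin_zero[OF assms(1)] flin_zero[OF assms(2)] flinD[OF assms(1)] flinD[OF assms(2)])

lemma flin_lin: "(\<And>x. x \<in> gens A \<Longrightarrow> F x \<in> fmod B) \<Longrightarrow> flin A B (lin F)"
  by (auto simp: flin_def intro: lin_in_fmod)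

lemma flin_eq_lin: "flin A B f \<Longrightarrow> p \<in> fmod A \<Longrightarrow> f p = lin (\<lambda>x. f (bas x)) p"
  by (rule flin_eqI[of A B f B "lin (\<lambda>x. f (bas x))"]) (auto intro!: flin_lin simp: flinD)

lemma flin_comp: "flin A B f \<Longrightarrow> flin B C g \<Longrightarrow> flin A C (\<lambda>p. g (f p))"
  by (auto simp: flin_def)

lemma flin_id: "flin A A (\<lambda>p. p)" "flin A A id"
  by (auto simp: flin_def)

lemma flin_fun_add: "flin A B f \<Longrightarrow> flin A B g \<Longrightarrow> flin A B (\<lambda>p. f p + g p)"
  by (auto simp: flin_def fm.scale_right_distrib)

lemma flin_fun_uminus: "flin A B f \<Longrightarrow> flin A B (\<lambda>p. - f p)"
  by (auto simp: flin_def)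

lemma flin_fun_diff: "flin A B f \<Longrightarrow> flin A B g \<Longrightarrow> flin A B (\<lambda>p. f p - g p)"
  by (auto simp: flin_def fm.scale_right_diff_distrib)

lemma flin_tens_left: "q \<in> fmod B \<Longrightarrow> flin A (tensor_basis A B) (\<lambda>p. p \<otimes> q)"
  by (auto simp: flin_def)

lemma flin_tens_right: "p \<in> fmod A \<Longrightarrow> flin B (tensor_basis A B) (\<lambda>q. p \<otimes> q)"
  by (auto simp: flin_def)

lemma flin_lin_app:
  assumes "flin A B f" "p \<in> fmod X" "\<And>x. x \<in> gens X \<Longrightarrow> F x \<in> fmod A"
  shows "f (lin F p) = lin (\<lambda>x. f (F x)) p"
  by (rule flin_eqI[of X B "\<lambda>p. f (lin F p)" B "lin (\<lambda>x. f (F x))"])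
     (use assms in \<open>auto intro!: flin_lin flin_comp[OF flin_lin assms(1)] simp: flinD\<close>)

text \<open>Degrees are integers here, so that maps of degree -1 shift them without truncation. Zero
  is homogeneous of every degree.\<close>

definition homog :: "('x, 'm) graded_basis_scheme \<Rightarrow> int \<Rightarrow> ('x \<Rightarrow>\<^sub>0 'r::comm_ring_1) \<Rightarrow> bool"
  where "homog A n p \<longleftrightarrow> p \<in> fmod A \<and> (\<forall>x\<in>keys p. int (deg A x) = n)"

lemma homog_fmod: "homog A n p \<Longrightarrow> p \<in> fmod A"
  by (simp add: homog_def)

lemma homogD: "homog A n p \<Longrightarrow> x \<in> keys p \<Longrightarrow> int (deg A x) = n"
  by (simp add: homog_def)

lemma homog_simps [simp]:
  "homog A n 0"
  "homog A n p \<Longrightarrow> homog A n q \<Longrightarrow> homog A n (p + q)"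
  "homog A n p \<Longrightarrow> homog A n q \<Longrightarrow> homog A n (p - q)"
  "homog A n p \<Longrightarrow> homog A n (a \<odot> p)"
  "homog A n p \<Longrightarrow> homog A n (- p)"
  using Poly_Mapping.keys_add[of p q] keys_diff[of p q]
  by (auto simp: homog_def) (auto simp: in_keys_iff)

lemma homog_bas [simp]: "homog A n (bas x) \<longleftrightarrow> x \<in> gens A \<and> int (deg A x) = n"
  by (auto simp: homog_def)

lemma homog_bas': "x \<in> gens A \<Longrightarrow> homog A (int (deg A x)) (bas x)"
  by simp

lemma homog_lin:
  assumes "\<And>x. x \<in> keys p \<Longrightarrow> homog B n (F x)" shows "homog B n (lin F p)"
  using assms keys_lin[of F p] unfolding homog_def fmod_def by blast

lemma homog_tens: "homog A m p \<Longrightarrow> homog B n q \<Longrightarrow> homog (tensor_basis A B) (m + n) (p \<otimes> q)"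
  using keys_tens[of p q] by (auto simp: homog_def)

lemma homog_neg: "homog A n p \<Longrightarrow> n < 0 \<Longrightarrow> p = 0"
proof (rule ccontr)
  assume "homog A n p" "n < 0" "p \<noteq> 0"
  then obtain x where "x \<in> keys p" by (metis all_not_in_conv keys_eq_empty)
  then show False using homogD \<open>homog A n p\<close> \<open>n < 0\<close> by fastforce
qed

lemma homog_induct [consumes 1, case_names zero add smul bas]:
  fixes p :: "'x \<Rightarrow>\<^sub>0 'r::comm_ring_1"
  assumes "homog A n p" "P 0"
    and "\<And>p q. homog A n p \<Longrightarrow> homog A n q \<Longrightarrow> P p \<Longrightarrow> P q \<Longrightarrow> P (p + q)"
    and "\<And>a p. homog A n p \<Longrightarrow> P p \<Longrightarrow> P (a \<odot> p)"
    and "\<And>x. x \<in> gens A \<Longrightarrow> int (deg A x) = n \<Longrightarrow> P (bas x)"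
  shows "P p"
proof -
  \<comment> \<open>Keeping only the generators of degree \<open>n\<close> turns homogeneous
    elements into all elements of a free module.\<close>
  let ?A = "\<lparr>gens = {x \<in> gens A. int (deg A x) = n}, deg = deg A\<rparr>"
  have *: "q \<in> fmod ?A \<longleftrightarrow> homog A n q" for q :: "'x \<Rightarrow>\<^sub>0 'r"
    by (auto simp: homog_def fmod_def)
  have "p \<in> fmod ?A" using assms(1) * by simp
  then show ?thesis
    by (induction rule: fmod_induct) (use assms in \<open>auto simp: *\<close>)
qed

lemma graded_map_iff:
  "graded_map k A B f \<longleftrightarrow> flin A B f \<and> (\<forall>x\<in>gens A. homog B (int (deg A x) + k) (f (bas x)))"
  by (auto simp: graded_map_def flin_def homog_def)

lemma graded_flin: "graded_map k A B f \<Longrightarrow> flin A B f"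
  by (simp add: graded_map_iff)

lemma graded_bas: "graded_map k A B f \<Longrightarrow> x \<in> gens A \<Longrightarrow> homog B (int (deg A x) + k) (f (bas x))"
  by (simp add: graded_map_iff)

lemma graded_homog: "graded_map k A B f \<Longrightarrow> homog A n p \<Longrightarrow> homog B (n + k) (f p)"
proof -
  assume f: "graded_map k A B f" and "homog A n p"
  note fl = graded_flin[OF f]
  show ?thesis using \<open>homog A n p\<close>
    by (induction rule: homog_induct)
       (auto simp: flin_zero[OF fl] flinD[OF fl] homog_fmod intro: graded_bas[OF f])
qed

lemma graded_comp:
  "graded_map k A B f \<Longrightarrow> graded_map l B C g \<Longrightarrow> m = k + l \<Longrightarrow> graded_map m A C (\<lambda>p. g (f p))"
  unfolding graded_map_iff[of m] using graded_homog[of l B C g] graded_bas[of k A B f]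
  by (auto intro: flin_comp graded_flin simp: add.assoc[symmetric])

lemma graded_comp0:
  "graded_map 0 A B f \<Longrightarrow> graded_map 0 B C g \<Longrightarrow> graded_map 0 A C (\<lambda>p. g (f p))"
  by (rule graded_comp) auto

lemma graded_id: "graded_map 0 A A (\<lambda>p. p)" "graded_map 0 A A id"
  by (auto simp: graded_map_iff flin_id)

lemma graded_fun_add: "graded_map k A B f \<Longrightarrow> graded_map k A B g \<Longrightarrow> graded_map k A B (\<lambda>p. f p + g p)"
  by (auto simp: graded_map_iff intro: flin_fun_add)

lemma graded_fun_uminus: "graded_map k A B f \<Longrightarrow> graded_map k A B (\<lambda>p. - f p)"
  by (auto simp: graded_map_iff intro: flin_fun_uminus)

lemma graded_lin:
  "(\<And>x. x \<in> gens A \<Longrightarrow> homog B (int (deg A x) + k) (F x)) \<Longrightarrow> graded_map k A B (lin F)"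
  by (auto simp: graded_map_iff intro!: flin_lin intro: homog_fmod)

text \<open>The Koszul sign of an integer exponent: maps of degree -1 produce exponents such as
  \<open>|x| - 1\<close>, which truncated subtraction would spoil at 0.\<close>

definition ks :: "int \<Rightarrow> 'r::comm_ring_1" where "ks n = (if even n then 1 else -1)"

lemma minus_one_power_ks: "(-1) ^ n = ks (int n)"
  by (simp add: ks_def minus_one_power_iff)

lemma ks_simps [simp]: "ks 0 = 1" "ks 1 = -1" "ks (-1) = -1" "ks 2 = 1"
  by (auto simp: ks_def)

lemma ks_add: "ks (m + n) = ks m * ks n"
  by (auto simp: ks_def)

section \<open>Tensor products of maps\<close>

lemma tmap_bas: "tmap A k f g (bas (x, y)) = ks (int k * int (deg A x)) \<odot> (f (bas x) \<otimes> g (bas y))"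
  by (simp add: tmap_def minus_one_power_ks)

lemma tmap_eq: "tmap A k f g = lin (\<lambda>(x, y). ks (int k * int (deg A x)) \<odot> (f (bas x) \<otimes> g (bas y)))"
  by (simp add: tmap_def minus_one_power_ks)

lemma tmap_linear [simp]:
  "tmap A k f g (p + q) = tmap A k f g p + tmap A k f g q"
  "tmap A k f g (a \<odot> p) = a \<odot> tmap A k f g p"
  "tmap A k f g 0 = 0"
  "tmap A k f g (- p) = - tmap A k f g p"
  "tmap A k f g (p - q) = tmap A k f g p - tmap A k f g q"
  by (simp_all add: tmap_def)

lemma flin_tmap:
  assumes "flin A A' f" "flin B B' g"
  shows "flin (tensor_basis A B) (tensor_basis A' B') (tmap A k f g)"
  unfolding tmap_def by (rule flin_lin) (use assms in \<open>auto simp: flinD\<close>)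

lemma graded_tmap:
  assumes "graded_map m A A' f" "graded_map n B B' g" "l = m + n"
  shows "graded_map l (tensor_basis A B) (tensor_basis A' B') (tmap A k f g)"
  unfolding graded_map_iff[of l]
proof (safe)
  show "flin (tensor_basis A B) (tensor_basis A' B') (tmap A k f g)"
    using assms by (auto intro: flin_tmap graded_flin)
  fix x y assume "(x, y) \<in> gens (tensor_basis A B)"
  then show "homog (tensor_basis A' B') (int (deg (tensor_basis A B) (x, y)) + l) (tmap A k f g (bas (x, y)))"
    using homog_tens[OF graded_bas[OF assms(1), of x] graded_bas[OF assms(2), of y]] assms(3)
    by (simp add: tmap_bas algebra_simps)
qed

text \<open>The sign comes from moving \<open>g\<close> past \<open>p\<close>, so \<open>q\<close>
  may be inhomogeneous.\<close>

lemma tmap_tens: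
  assumes "flin A A' f" "flin B B' g" "homog A n p" "q \<in> fmod B"
  shows "tmap A k f g (p \<otimes> q) = ks (int k * n) \<odot> (f p \<otimes> g q)"
  using assms(3)
proof (induction rule: homog_induct)
  case (bas x)
  show ?case using assms(4)
    by (induction rule: fmod_induct)
       (use bas assms in \<open>auto simp: flin_zero[OF assms(2)] flinD tmap_bas fm.scale_right_distrib mult.commute\<close>)
qed (use assms in \<open>auto simp: flin_zero[OF assms(1)] flinD homog_fmod fm.scale_right_distrib mult.commute\<close>)

lemma tmap0_tens:
  assumes "flin A A' f" "flin B B' g" "p \<in> fmod A" "q \<in> fmod B"
  shows "tmap A 0 f g (p \<otimes> q) = f p \<otimes> g q"
  using assms(3)
proof (induction rule: fmod_induct)
  case (bas x)
  then show ?case using tmap_tens[OF assms(1,2) homog_bas' assms(4)] by simp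
qed (use assms in \<open>auto simp: flin_zero[OF assms(1)] flinD\<close>)

lemma tmap_cong:
  assumes "\<And>x. x \<in> gens A \<Longrightarrow> f (bas x) = f' (bas x)" "\<And>y. y \<in> gens B \<Longrightarrow> g (bas y) = g' (bas y)"
    "t \<in> fmod (tensor_basis A B)"
  shows "tmap A k f g t = tmap A k f' g' t"
  unfolding tmap_def by (rule lin_cong) (use assms in \<open>auto dest!: fmod_keysD\<close>)

text \<open>The outer pair has sign exponent 0, so the composite keeps just the inner sign.\<close>

lemma tmap0_tmap:
  assumes "flin A A' f" "flin B B' g" "flin A' A'' f'" "flin B' B'' g'"
    "t \<in> fmod (tensor_basis A B)"
  shows "tmap A' 0 f' g' (tmap A k f g t) = tmap A k (\<lambda>p. f' (f p)) (\<lambda>q. g' (g q)) t"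
  using assms(5)
proof (induction rule: fmod_induct)
  case (bas z)
  obtain x y where z: "z = (x, y)" "x \<in> gens A" "y \<in> gens B" using bas by (cases z) auto
  show ?case
    using tmap0_tens[OF assms(3,4), of "f (bas x)" "g (bas y)"] z assms
    by (simp add: z tmap_bas flinD algebra_simps)
qed auto

lemma tmap0_comp0:
  assumes "flin A A' f" "flin B B' g" "flin A' A'' f'" "flin B' B'' g'"
    "t \<in> fmod (tensor_basis A B)"
  shows "tmap A' 0 f' g' (tmap A 0 f g t) = tmap A 0 (\<lambda>p. f' (f p)) (\<lambda>q. g' (g q)) t"
  using tmap0_tmap[OF assms, of 0] .

lemma tmap0_id: "t \<in> fmod (tensor_basis A B) \<Longrightarrow> tmap A 0 (\<lambda>p. p) (\<lambda>q. q) t = t"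
  by (induction rule: fmod_induct) (auto simp: tmap_bas)

lemma assoc_linear [simp]:
  "assoc (p + q) = assoc p + assoc q" "assoc (a \<odot> p) = a \<odot> assoc p" "assoc 0 = 0"
  "assoc (- p) = - assoc p" "assoc (p - q) = assoc p - assoc q"
  by (simp_all add: assoc_def)

lemma assoc_bas [simp]: "assoc (bas ((x, y), z)) = bas (x, (y, z))"
  by (simp add: assoc_def)

lemma graded_assoc:
  "graded_map 0 (tensor_basis (tensor_basis A B) C) (tensor_basis A (tensor_basis B C)) assoc"
  unfolding assoc_def by (rule graded_lin) auto

lemma assoc_tens: "assoc ((p \<otimes> q) \<otimes> r) = p \<otimes> (q \<otimes> r)"
proof -
  have "assoc ((p \<otimes> q) \<otimes> r) = lin (\<lambda>x. lin (\<lambda>y. lin (\<lambda>z. bas (x, (y, z))) r) q) p"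
    by (simp add: assoc_def lin_tens)
  also have "\<dots> = lin (\<lambda>x. bas x \<otimes> (q \<otimes> r)) p"
  proof (rule lin_cong[OF refl])
    fix x
    have "q \<otimes> r = lin (\<lambda>y. lin (\<lambda>z. bas (y, z)) r) q"
      by (simp add: tens_def bilin_lin)
    then show "lin (\<lambda>y. lin (\<lambda>z. bas (x, (y, z))) r) q = bas x \<otimes> (q \<otimes> r)"
      by (simp add: tens_lin_right)
  qed
  also have "\<dots> = lin bas p \<otimes> (q \<otimes> r)" by (simp only: tens_lin_left)
  finally show ?thesis by simp
qed

lemma assoc_tmap:
  assumes "flin A A' f" "flin B B' g" "flin C C' h" "t \<in> fmod (tensor_basis (tensor_basis A B) C)"
  shows "assoc (tmap X 0 (tmap A 0 f g) h t) = tmap A 0 f (tmap B 0 g h) (assoc t)"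
  using assms(4)
proof (induction rule: fmod_induct)
  case (bas w)
  obtain x y z where w: "w = ((x, y), z)" by (metis prod.exhaust)
  then show ?case using bas by (simp add: tmap_bas assoc_tens)
qed auto

text \<open>Serves the coinvariants: a degree-preserving coaction makes their homogeneous components
  coinvariant again.\<close>

lemma component_graded:
  assumes f: "graded_map 0 A B f" and p: "p \<in> fmod A"
  shows "f (component A n p) = component B n (f p)"
proof -
  have c: "flin X X (component X n)" for X :: "('u,'v) graded_basis_scheme"
    unfolding component_def by (rule flin_lin) auto
  have h: "component B n q = (if int n = m then q else 0)" if "homog B m q" for m q
    using that
    by (induction rule: homog_induct) (auto simp: component_def)
  show ?thesis
  proof (rule flin_eqI[OF flin_comp[OF c graded_flin[OF f]] flin_comp[OF graded_flin[OF f] c] _ p])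
    fix x assume x: "x \<in> gens A"
    show "f (component A n (bas x)) = component B n (f (bas x))"
      using h[OF graded_bas[OF f x]] flin_zero[OF graded_flin[OF f]]
      by (auto simp: component_def)
  qed
qed

subsection \<open>Graded algebras, morphisms and derivations\<close>

text \<open>Bilinearity is demanded on all finitely supported functions, by equating
  \<open>mult\<close> with some \<open>bilin F\<close>. The other axioms are stated on basis
  elements and spread by linearity.\<close>

definition graded_alg :: "('x, 'r::comm_ring_1, 'm) alg_scheme \<Rightarrow> bool"
  where "graded_alg A \<longleftrightarrow>
    (\<exists>F. mult A = bilin F) \<and>
    (\<forall>x\<in>gens A. \<forall>y\<in>gens A. homog A (int (deg A x) + int (deg A y)) (mult A (bas x) (bas y))) \<and>
    (\<forall>x\<in>gens A. \<forall>y\<in>gens A. \<forall>z\<in>gens A.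
      mult A (mult A (bas x) (bas y)) (bas z) = mult A (bas x) (mult A (bas y) (bas z))) \<and>
    homog A 0 (munit A) \<and>
    (\<forall>x\<in>gens A. mult A (munit A) (bas x) = bas x \<and> mult A (bas x) (munit A) = bas x)"

lemma mult_linear_aux:
  fixes A :: "('x, 'r::comm_ring_1, 'm) alg_scheme"
  assumes F: "mult A = bilin F"
  shows
    "mult A (p + p') q = mult A p q + mult A p' q"
    "mult A p (q + q') = mult A p q + mult A p q'"
    "mult A (a \<odot> p) q = a \<odot> mult A p q"
    "mult A p (a \<odot> q) = a \<odot> mult A p q"
    "mult A 0 q = 0" "mult A p 0 = 0"
    "mult A (- p) q = - mult A p q"
    "mult A p (- q) = - mult A p q"
    "mult A (p - p') q = mult A p q - mult A p' q"
    "mult A p (q - q') = mult A p q - mult A p q'"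
  by (simp_all add: F)

context
  fixes A :: "('x, 'r::comm_ring_1, 'm) alg_scheme"
  assumes A: "graded_alg A"
begin

lemma mult_eq_bilin: "mult A = bilin (\<lambda>x y. mult A (bas x) (bas y))"
proof -
  obtain F where "mult A = bilin F" using A unfolding graded_alg_def by (elim conjE exE)
  then show ?thesis by simp
qed

lemma graded_algD:
  assumes "x \<in> gens A" "y \<in> gens A"
  shows "homog A (int (deg A x) + int (deg A y)) (mult A (bas x) (bas y))"
    and "z \<in> gens A \<Longrightarrow> mult A (mult A (bas x) (bas y)) (bas z) = mult A (bas x) (mult A (bas y) (bas z))"
    and "mult A (munit A) (bas x) = bas x" "mult A (bas x) (munit A) = bas x"
  using A assms unfolding graded_alg_def by blast+

lemmas mult_linear = mult_linear_aux[OF mult_eq_bilin]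

lemma homog_mult: "homog A m p \<Longrightarrow> homog A n q \<Longrightarrow> homog A (m + n) (mult A p q)"
proof (induction rule: homog_induct)
  case (bas x)
  from bas(3) show ?case
    by (induction rule: homog_induct) (use bas in \<open>auto simp: mult_linear graded_algD\<close>)
qed (auto simp: mult_linear)

lemma mult_fmod: "p \<in> fmod A \<Longrightarrow> q \<in> fmod A \<Longrightarrow> mult A p q \<in> fmod A"
proof (induction rule: fmod_induct)
  case (bas x)
  from bas(2) show ?case
    by (induction rule: fmod_induct)
       (use bas in \<open>auto simp: mult_linear graded_algD intro: homog_fmod[OF graded_algD(1)]\<close>)
qed (auto simp: mult_linear)

lemma mult_assoc:
  assumes "p \<in> fmod A" "q \<in> fmod A" "r \<in> fmod A"
  shows "mult A (mult A p q) r = mult A p (mult A q r)"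
  using assms(1)
proof (induction rule: fmod_induct)
  case x: (bas x)
  show ?case using assms(2)
  proof (induction rule: fmod_induct)
    case y: (bas y)
    show ?case using assms(3)
      by (induction rule: fmod_induct) (use x y in \<open>auto simp: mult_linear graded_algD\<close>)
  qed (auto simp: mult_linear)
qed (auto simp: mult_linear)

lemma homog_munit: "homog A 0 (munit A)"
  using A unfolding graded_alg_def by blast

lemma munit_fmod: "munit A \<in> fmod A"
  using homog_munit by (rule homog_fmod)

lemma mult_unit:
  assumes "p \<in> fmod A" shows "mult A (munit A) p = p" "mult A p (munit A) = p"
  using assms by (induction rule: fmod_induct) (auto simp: mult_linear graded_algD)

lemma flin_mult_right: "p \<in> fmod A \<Longrightarrow> flin A A (mult A p)"
  by (auto simp: flin_def mult_linear mult_fmod)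

end

text \<open>Modules, gradings and tensor maps look only at \<open>gens\<close> and
  \<open>deg\<close>. This moves facts between records that share these fields but carry different
  structure.\<close>

lemma basis_cong:
  fixes X :: "('x, 'm) graded_basis_scheme" and Y :: "('x, 'n) graded_basis_scheme"
  assumes "gens X = gens Y" "deg X = deg Y"
  shows "fmod X = fmod Y" "homog X = homog Y" "flin X A = flin Y A" "flin B X = flin B Y"
    "graded_map k X A = graded_map k Y A" "graded_map k B X = graded_map k B Y"
    "tensor_basis X A = tensor_basis Y A" "tensor_basis B X = tensor_basis B Y"
    "tmap X = tmap Y" "graded_submodule X = graded_submodule Y" "sub_tensor S X = sub_tensor S Y"
  by (simp_all add: fun_eq_iff fmod_def homog_def flin_def graded_map_def tensor_basis_def tmap_def
      graded_submodule_def component_def sub_tensor_def assms)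

section \<open>Tensor products of graded algebras\<close>

lemma tensor_alg_basis:
  "gens (tensor_alg A B) = gens (tensor_basis A B)" "deg (tensor_alg A B) = deg (tensor_basis A B)"
  by (simp_all add: tensor_alg_def)

lemmas tensor_alg_basis_cong [simp] = basis_cong[OF tensor_alg_basis]

lemma tensor_alg_simps [simp]:
  "gens (tensor_alg A B) = gens A \<times> gens B"
  "deg (tensor_alg A B) (x, y) = deg A x + deg B y"
  "munit (tensor_alg A B) = munit A \<otimes> munit B"
  "dif (tensor_alg A B) = tdif A B"
  by (simp_all add: tensor_alg_def)

lemma mult_tensor_bas:
  "mult (tensor_alg A B) (bas (x, y)) (bas (x', y')) =
    ks (int (deg B y) * int (deg A x')) \<odot> (mult A (bas x) (bas x') \<otimes> mult B (bas y) (bas y'))"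
  by (simp add: tensor_alg_def minus_one_power_ks)

lemma mult_tensor_linear:
  "mult (tensor_alg A B) (p + p') q = mult (tensor_alg A B) p q + mult (tensor_alg A B) p' q"
  "mult (tensor_alg A B) p (q + q') = mult (tensor_alg A B) p q + mult (tensor_alg A B) p q'"
  "mult (tensor_alg A B) (a \<odot> p) q = a \<odot> mult (tensor_alg A B) p q"
  "mult (tensor_alg A B) p (a \<odot> q) = a \<odot> mult (tensor_alg A B) p q"
  "mult (tensor_alg A B) 0 q = 0" "mult (tensor_alg A B) p 0 = 0"
  by (simp_all add: tensor_alg_def)

text \<open>The Koszul sign involves the two inner factors only, so the outer ones may be
  inhomogeneous.\<close>

lemma mult_tensor_tens:
  assumes A: "graded_alg A" and B: "graded_alg B"
    and p: "p \<in> fmod A" and q: "homog B m q" and p': "homog A n p'" and q': "q' \<in> fmod B"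
  shows "mult (tensor_alg A B) (p \<otimes> q) (p' \<otimes> q') = ks (m * n) \<odot> (mult A p p' \<otimes> mult B q q')"
  using p
proof (induction rule: fmod_induct)
  case x: (bas x)
  show ?case using q
  proof (induction rule: homog_induct)
    case y: (bas y)
    show ?case using p'
    proof (induction rule: homog_induct)
      case x': (bas x')
      show ?case using q'
        by (induction rule: fmod_induct)
           (use x' y in \<open>auto simp: mult_tensor_linear mult_linear[OF A] mult_linear[OF B] mult_tensor_bas fm.scale_right_distrib mult.commute\<close>)
    qed (auto simp: mult_tensor_linear mult_linear[OF A] mult_linear[OF B] fm.scale_right_distrib mult.commute)
  qed (auto simp: mult_tensor_linear mult_linear[OF A] mult_linear[OF B] fm.scale_right_distrib mult.commute)
qed (auto simp: mult_tensor_linear mult_linear[OF A] mult_linear[OF B] fm.scale_right_distrib mult.commute)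

lemma graded_alg_tensor:
  assumes A: "graded_alg A" and B: "graded_alg B"
  shows "graded_alg (tensor_alg A B)"
  unfolding graded_alg_def
proof (intro conjI ballI allI)
  let ?T = "tensor_alg A B"
  show "\<exists>F. mult ?T = bilin F"
    by (auto simp: tensor_alg_def)
  show "homog ?T 0 (munit ?T)"
    using homog_tens[OF homog_munit[OF A] homog_munit[OF B]] by simp
  fix s assume "s \<in> gens ?T"
  then obtain x y where s: "s = (x, y)" "x \<in> gens A" "y \<in> gens B" by auto
  show "mult ?T (munit ?T) (bas s) = bas s" "mult ?T (bas s) (munit ?T) = bas s"
    using mult_tensor_tens[OF A B _ homog_munit[OF B], of "munit A" "deg A x" "bas x" "bas y"]
      mult_tensor_tens[OF A B _ _ homog_munit[OF A], of "bas x" "deg B y" "bas y" "munit B"] s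
      munit_fmod[OF A] munit_fmod[OF B]
    by (simp_all add: mult_unit[OF A] mult_unit[OF B])
  fix t assume "t \<in> gens ?T"
  then obtain x' y' where t: "t = (x', y')" "x' \<in> gens A" "y' \<in> gens B" by auto
  note hA = homog_mult[OF A homog_bas' homog_bas'] and hB = homog_mult[OF B homog_bas' homog_bas']
  show "homog ?T (int (deg ?T s) + int (deg ?T t)) (mult ?T (bas s) (bas t))"
    using homog_tens[OF hA[OF s(2) t(2)] hB[OF s(3) t(3)]]
    by (simp add: s t mult_tensor_bas algebra_simps)
  fix u assume "u \<in> gens ?T"
  then obtain x'' y'' where u: "u = (x'', y'')" "x'' \<in> gens A" "y'' \<in> gens B" by auto
  have "mult ?T (mult ?T (bas s) (bas t)) (bas u) =
    (ks (int (deg B y) * int (deg A x')) * ks ((int (deg B y) + int (deg B y')) * int (deg A x''))) \<odot>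
      (mult A (mult A (bas x) (bas x')) (bas x'') \<otimes> mult B (mult B (bas y) (bas y')) (bas y''))"
    using mult_tensor_tens[OF A B _ hB[OF s(3) t(3)] homog_bas'[OF u(2)], of "mult A (bas x) (bas x')" "bas y''"]
      homog_fmod[OF hA[OF s(2) t(2)]] u
    by (simp add: s t mult_tensor_bas mult_tensor_linear)
  moreover have "mult ?T (bas s) (mult ?T (bas t) (bas u)) =
    (ks (int (deg B y') * int (deg A x'')) * ks (int (deg B y) * (int (deg A x') + int (deg A x'')))) \<odot>
      (mult A (bas x) (mult A (bas x') (bas x'')) \<otimes> mult B (bas y) (mult B (bas y') (bas y'')))"
    using mult_tensor_tens[OF A B _ homog_bas'[OF s(3)] hA[OF t(2) u(2)], of "bas x" "mult B (bas y') (bas y'')"]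
      homog_fmod[OF hB[OF t(3) u(3)]] s
    by (simp add: s t u mult_tensor_bas mult_tensor_linear)
  \<comment> \<open>Both bracketings carry the exponent
    \<open>|y||x'| + |y||x''| + |y'||x''|\<close>.\<close>
  ultimately show "mult ?T (mult ?T (bas s) (bas t)) (bas u) = mult ?T (bas s) (mult ?T (bas t) (bas u))"
    using s t u by (simp add: mult_assoc[OF A] mult_assoc[OF B] ks_add[symmetric] algebra_simps)
qed

text \<open>The grading is separated off because the two factors of \<open>sh_tensor\<close> are
  handled as plain algebra maps.\<close>

definition alg_mor ::
  "('x, 'r::comm_ring_1, 'm) alg_scheme \<Rightarrow> ('y, 'r, 'n) alg_scheme
    \<Rightarrow> (('x \<Rightarrow>\<^sub>0 'r) \<Rightarrow> ('y \<Rightarrow>\<^sub>0 'r)) \<Rightarrow> bool"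
  where "alg_mor A B f \<longleftrightarrow> flin A B f \<and> f (munit A) = munit B \<and>
    (\<forall>p\<in>fmod A. \<forall>q\<in>fmod A. f (mult A p q) = mult B (f p) (f q))"

definition alg_hom ::
  "('x, 'r::comm_ring_1, 'm) alg_scheme \<Rightarrow> ('y, 'r, 'n) alg_scheme
    \<Rightarrow> (('x \<Rightarrow>\<^sub>0 'r) \<Rightarrow> ('y \<Rightarrow>\<^sub>0 'r)) \<Rightarrow> bool"
  where "alg_hom A B f \<longleftrightarrow> alg_mor A B f \<and> graded_map 0 A B f"

lemma alg_morD:
  assumes "alg_mor A B f"
  shows "flin A B f" "f (munit A) = munit B"
    "p \<in> fmod A \<Longrightarrow> q \<in> fmod A \<Longrightarrow> f (mult A p q) = mult B (f p) (f q)"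
  using assms by (auto simp: alg_mor_def)

lemma alg_homD:
  assumes "alg_hom A B f"
  shows "alg_mor A B f" "flin A B f" "graded_map 0 A B f" "f (munit A) = munit B"
    "p \<in> fmod A \<Longrightarrow> q \<in> fmod A \<Longrightarrow> f (mult A p q) = mult B (f p) (f q)"
  using assms by (auto simp: alg_mor_def alg_hom_def)

lemma alg_morI:
  assumes A: "graded_alg A" and B: "graded_alg B" and f: "flin A B f" "f (munit A) = munit B"
    and m: "\<And>x y. x \<in> gens A \<Longrightarrow> y \<in> gens A \<Longrightarrow> f (mult A (bas x) (bas y)) = mult B (f (bas x)) (f (bas y))"
  shows "alg_mor A B f"
  unfolding alg_mor_def
proof (intro conjI ballI f)
  fix p q :: "'a \<Rightarrow>\<^sub>0 'b" assume p: "p \<in> fmod A" and q: "q \<in> fmod A"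
  note simps = mult_linear[OF A] mult_linear[OF B] flinD[OF f(1)] flin_zero[OF f(1)] mult_fmod[OF A]
  show "f (mult A p q) = mult B (f p) (f q)" using p
  proof (induction rule: fmod_induct)
    case x: (bas x)
    show ?case using q
      by (induction rule: fmod_induct) (use x m in \<open>auto simp: simps\<close>)
  qed (use q in \<open>auto simp: simps\<close>)
qed

lemma alg_mor_comp: "alg_mor A B f \<Longrightarrow> alg_mor B C g \<Longrightarrow> alg_mor A C (\<lambda>p. g (f p))"
  by (auto simp: alg_mor_def flinD intro: flin_comp)

lemma alg_hom_comp: "alg_hom A B f \<Longrightarrow> alg_hom B C g \<Longrightarrow> alg_hom A C (\<lambda>p. g (f p))"
  by (auto simp: alg_hom_def intro: alg_mor_comp graded_comp0)

lemma alg_hom_id: "alg_hom A A (\<lambda>p. p)"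
  by (auto simp: alg_hom_def alg_mor_def intro: flin_id graded_id)

lemma chain_algebra_map_alg_hom: "chain_algebra_map A B f \<Longrightarrow> alg_hom A B f"
  by (auto simp: chain_algebra_map_def alg_hom_def alg_mor_def intro: graded_flin)

lemma alg_hom_tmap:
  assumes A: "graded_alg A" "graded_alg A'" and B: "graded_alg B" "graded_alg B'"
    and f: "alg_hom A A' f" and g: "alg_hom B B' g"
  shows "alg_hom (tensor_alg A B) (tensor_alg A' B') (tmap A 0 f g)"
  unfolding alg_hom_def
proof (intro conjI alg_morI graded_alg_tensor assms)
  have gr: "graded_map 0 (tensor_basis A B) (tensor_basis A' B') (tmap A 0 f g)"
    by (rule graded_tmap[OF alg_homD(3)[OF f] alg_homD(3)[OF g]]) simp
  then show "graded_map 0 (tensor_alg A B) (tensor_alg A' B') (tmap A 0 f g)" by simp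
  then show "flin (tensor_alg A B) (tensor_alg A' B') (tmap A 0 f g)" by (rule graded_flin)
  note tt = tmap0_tens[OF alg_homD(2)[OF f] alg_homD(2)[OF g]]
  show "tmap A 0 f g (munit (tensor_alg A B)) = munit (tensor_alg A' B')"
    by (simp add: tt munit_fmod A B alg_homD(4)[OF f] alg_homD(4)[OF g])
  fix s t assume "s \<in> gens (tensor_alg A B)" "t \<in> gens (tensor_alg A B)"
  then obtain x y x' y' where s: "s = (x, y)" "x \<in> gens A" "y \<in> gens B"
    and t: "t = (x', y')" "x' \<in> gens A" "y' \<in> gens B" by auto
  have "homog B' (int (deg B y)) (g (bas y))" "homog A' (int (deg A x')) (f (bas x'))"
    using graded_bas[OF alg_homD(3)[OF g] s(3)] graded_bas[OF alg_homD(3)[OF f] t(2)] by auto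
  note mt = mult_tensor_tens[OF A(2) B(2) _ this]
  show "tmap A 0 f g (mult (tensor_alg A B) (bas s) (bas t)) =
    mult (tensor_alg A' B') (tmap A 0 f g (bas s)) (tmap A 0 f g (bas t))"
    using s t mt[of "f (bas x)" "g (bas y')"]
    by (simp add: mult_tensor_bas tt mult_fmod A B alg_homD(5)[OF f] alg_homD(5)[OF g] tmap_bas
        flinD[OF alg_homD(2)[OF f]] flinD[OF alg_homD(2)[OF g]])
qed

lemma alg_hom_assoc:
  assumes A: "graded_alg A" and B: "graded_alg B" and C: "graded_alg C"
  shows "alg_hom (tensor_alg (tensor_alg A B) C) (tensor_alg A (tensor_alg B C)) assoc"
  unfolding alg_hom_def
proof (intro conjI alg_morI graded_alg_tensor assms)
  show gr: "graded_map 0 (tensor_alg (tensor_alg A B) C) (tensor_alg A (tensor_alg B C)) assoc"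
    using graded_assoc by simp
  then show "flin (tensor_alg (tensor_alg A B) C) (tensor_alg A (tensor_alg B C)) assoc"
    by (rule graded_flin)
  show "assoc (munit (tensor_alg (tensor_alg A B) C)) = munit (tensor_alg A (tensor_alg B C))"
    by (simp add: assoc_tens)
  fix s t assume "s \<in> gens (tensor_alg (tensor_alg A B) C)" "t \<in> gens (tensor_alg (tensor_alg A B) C)"
  then obtain x y z x' y' z' where s: "s = ((x, y), z)" and t: "t = ((x', y'), z')" by auto
  show "assoc (mult (tensor_alg (tensor_alg A B) C) (bas s) (bas t)) =
    mult (tensor_alg A (tensor_alg B C)) (assoc (bas s)) (assoc (bas t))"
    by (simp add: s t mult_tensor_bas assoc_tens ks_add[symmetric] algebra_simps)
qed

text \<open>Differentials are the case where \<open>f\<close> is the identity,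
  \<open>\<kappa>\<close> the case \<open>f = \<iota>\<close>. A chain map identity becomes an
  equality of two derivations along the same algebra map.\<close>

definition deriv ::
  "('x, 'r::comm_ring_1, 'm) alg_scheme \<Rightarrow> ('y, 'r, 'n) alg_scheme
    \<Rightarrow> (('x \<Rightarrow>\<^sub>0 'r) \<Rightarrow> ('y \<Rightarrow>\<^sub>0 'r)) \<Rightarrow> (('x \<Rightarrow>\<^sub>0 'r) \<Rightarrow> ('y \<Rightarrow>\<^sub>0 'r)) \<Rightarrow> bool"
  where "deriv A B f D \<longleftrightarrow> graded_map (-1) A B D \<and>
    (\<forall>x\<in>gens A. \<forall>y\<in>gens A. D (mult A (bas x) (bas y)) =
      mult B (D (bas x)) (f (bas y)) + ks (int (deg A x)) \<odot> mult B (f (bas x)) (D (bas y)))"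

lemma deriv_graded: "deriv A B f D \<Longrightarrow> graded_map (-1) A B D"
  by (simp add: deriv_def)

lemma deriv_flin: "deriv A B f D \<Longrightarrow> flin A B D"
  by (auto simp: deriv_def intro: graded_flin)

lemma deriv_mult:
  assumes A: "graded_alg A" and B: "graded_alg B" and f: "flin A B f" and D: "deriv A B f D"
    and p: "homog A n p" and q: "q \<in> fmod A"
  shows "D (mult A p q) = mult B (D p) (f q) + ks n \<odot> mult B (f p) (D q)"
proof -
  note simps = mult_linear[OF A] mult_linear[OF B] flinD[OF f] flin_zero[OF f] mult_fmod[OF A]
    flinD[OF deriv_flin[OF D]] flin_zero[OF deriv_flin[OF D]] fm.scale_right_distrib mult.commute
  show ?thesis using p
  proof (induction rule: homog_induct)
    case x: (bas x)
    show ?case using q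
      by (induction rule: fmod_induct) (use x D in \<open>auto simp: simps deriv_def\<close>)
  qed (use q in \<open>auto simp: simps homog_fmod\<close>)
qed

lemma deriv_comp_hom:
  assumes A: "graded_alg A" and B: "graded_alg B" and f: "flin A B f" and D: "deriv A B f D"
    and g: "alg_hom B C g"
  shows "deriv A C (\<lambda>p. g (f p)) (\<lambda>p. g (D p))"
  unfolding deriv_def
proof (intro conjI ballI)
  show "graded_map (-1) A C (\<lambda>p. g (D p))"
    by (rule graded_comp[OF deriv_graded[OF D] alg_homD(3)[OF g]]) simp
  fix x y assume "x \<in> gens A" "y \<in> gens A"
  then show "g (D (mult A (bas x) (bas y))) =
    mult C (g (D (bas x))) (g (f (bas y))) + ks (int (deg A x)) \<odot> mult C (g (f (bas x))) (g (D (bas y)))"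
    using deriv_mult[OF A B f D homog_bas', of x "bas y"]
    by (simp add: flinD[OF alg_homD(2)[OF g]] alg_homD(5)[OF g] mult_fmod[OF B] flinD[OF f] flinD[OF deriv_flin[OF D]])
qed

lemma hom_comp_deriv:
  assumes A: "graded_alg A" and B: "graded_alg B" and C: "graded_alg C"
    and f: "flin B C f" and D: "deriv B C f D"
    and g: "alg_hom A B g"
  shows "deriv A C (\<lambda>p. f (g p)) (\<lambda>p. D (g p))"
  unfolding deriv_def
proof (intro conjI ballI)
  show "graded_map (-1) A C (\<lambda>p. D (g p))"
    by (rule graded_comp[OF alg_homD(3)[OF g] deriv_graded[OF D]]) simp
  fix x y assume "x \<in> gens A" "y \<in> gens A"
  then show "D (g (mult A (bas x) (bas y))) =
    mult C (D (g (bas x))) (f (g (bas y))) + ks (int (deg A x)) \<odot> mult C (f (g (bas x))) (D (g (bas y)))"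
    using deriv_mult[OF B C f D graded_bas[OF alg_homD(3)[OF g]], of x "g (bas y)"]
    by (simp add: flinD[OF alg_homD(2)[OF g]] alg_homD(5)[OF g])
qed

lemma deriv_add: "graded_alg B \<Longrightarrow> deriv A B f D \<Longrightarrow> deriv A B f D' \<Longrightarrow> deriv A B f (\<lambda>p. D p + D' p)"
  by (auto simp: deriv_def mult_linear fm.scale_right_distrib algebra_simps intro: graded_fun_add)

lemma deriv_uminus: "graded_alg B \<Longrightarrow> deriv A B f D \<Longrightarrow> deriv A B f (\<lambda>p. - D p)"
  by (auto simp: deriv_def mult_linear algebra_simps intro: graded_fun_uminus)

lemma deriv_diff: "graded_alg B \<Longrightarrow> deriv A B f D \<Longrightarrow> deriv A B f D' \<Longrightarrow> deriv A B f (\<lambda>p. D p - D' p)"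
  using deriv_add[of B A f D "\<lambda>p. - D' p"] deriv_uminus[of B A f D'] by simp

text \<open>The image of the unit has degree -1, where there are no generators.\<close>

lemma deriv_munit:
  assumes A: "graded_alg A" and D: "deriv A B f D" shows "D (munit A) = 0"
  using homog_neg[OF graded_homog[OF deriv_graded[OF D] homog_munit[OF A]]] by simp

lemma deriv_tmap_left:
  assumes A: "graded_alg A" "graded_alg A'" and B: "graded_alg B" "graded_alg B'"
    and f: "alg_hom A A' f" and D: "deriv A A' f D" and g: "alg_hom B B' g"
  shows "deriv (tensor_alg A B) (tensor_alg A' B') (tmap A 0 f g) (tmap A 0 D g)"
  unfolding deriv_def
proof (intro conjI ballI)
  show "graded_map (-1) (tensor_alg A B) (tensor_alg A' B') (tmap A 0 D g)"
    using graded_tmap[OF deriv_graded[OF D] alg_homD(3)[OF g]] by simp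
  note tt = tmap0_tens[OF deriv_flin[OF D] alg_homD(2)[OF g]]
  note fs = flinD[OF alg_homD(2)[OF f]] flinD[OF alg_homD(2)[OF g]] flinD[OF deriv_flin[OF D]]
  fix s t assume "s \<in> gens (tensor_alg A B)" "t \<in> gens (tensor_alg A B)"
  then obtain x y x' y' where s: "s = (x, y)" "x \<in> gens A" "y \<in> gens B"
    and t: "t = (x', y')" "x' \<in> gens A" "y' \<in> gens B" by auto
  have 1: "homog B' (int (deg B y)) (g (bas y))" "homog A' (int (deg A x')) (f (bas x'))"
    "homog A' (int (deg A x') - 1) (D (bas x'))"
    using graded_bas[OF alg_homD(3)[OF g] s(3)] graded_bas[OF alg_homD(3)[OF f] t(2)]
      graded_bas[OF deriv_graded[OF D] t(2)] by auto
  have "mult (tensor_alg A' B') (D (bas x) \<otimes> g (bas y)) (f (bas x') \<otimes> g (bas y')) =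
     ks (int (deg B y) * int (deg A x')) \<odot> (mult A' (D (bas x)) (f (bas x')) \<otimes> mult B' (g (bas y)) (g (bas y')))"
    using s t by (intro mult_tensor_tens[OF A(2) B(2) _ 1(1,2)]) (auto simp: fs)
  moreover have "mult (tensor_alg A' B') (f (bas x) \<otimes> g (bas y)) (D (bas x') \<otimes> g (bas y')) =
     ks (int (deg B y) * (int (deg A x') - 1)) \<odot> (mult A' (f (bas x)) (D (bas x')) \<otimes> mult B' (g (bas y)) (g (bas y')))"
    using s t by (intro mult_tensor_tens[OF A(2) B(2) _ 1(1,3)]) (auto simp: fs)
  \<comment> \<open>The \<open>|y|\<close> of the total degree cancels the \<open>-|y|\<close> that
    arises because \<open>D\<close> lowers the degree of \<open>x'\<close>.\<close>
  moreover have "ks (int (deg A x) + int (deg B y)) * ks (int (deg B y) * (int (deg A x') - 1)) =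
      ks (int (deg B y) * int (deg A x')) * (ks (int (deg A x)) :: 'b)"
    by (simp add: ks_def)
  moreover have "D (mult A (bas x) (bas x')) =
      mult A' (D (bas x)) (f (bas x')) + ks (int (deg A x)) \<odot> mult A' (f (bas x)) (D (bas x'))"
    using D s t by (simp add: deriv_def)
  ultimately show "tmap A 0 D g (mult (tensor_alg A B) (bas s) (bas t)) =
    mult (tensor_alg A' B') (tmap A 0 D g (bas s)) (tmap A 0 f g (bas t)) +
    ks (int (deg (tensor_alg A B) s)) \<odot> mult (tensor_alg A' B') (tmap A 0 f g (bas s)) (tmap A 0 D g (bas t))"
    using s t
    by (simp add: mult_tensor_bas tt mult_fmod A B alg_homD(5)[OF g] tmap_bas fs fm.scale_right_distrib)
qed

lemma deriv_tmap_right: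
  assumes A: "graded_alg A" "graded_alg A'" and B: "graded_alg B" "graded_alg B'"
    and f: "alg_hom A A' f" and g: "alg_hom B B' g" and D: "deriv B B' g D"
  shows "deriv (tensor_alg A B) (tensor_alg A' B') (tmap A 0 f g) (tmap A 1 f D)"
  unfolding deriv_def
proof (intro conjI ballI)
  show "graded_map (-1) (tensor_alg A B) (tensor_alg A' B') (tmap A 1 f D)"
    using graded_tmap[OF alg_homD(3)[OF f] deriv_graded[OF D]] by simp
  note fs = flinD[OF alg_homD(2)[OF f]] flinD[OF alg_homD(2)[OF g]] flinD[OF deriv_flin[OF D]]
  fix s t assume "s \<in> gens (tensor_alg A B)" "t \<in> gens (tensor_alg A B)"
  then obtain x y x' y' where s: "s = (x, y)" "x \<in> gens A" "y \<in> gens B"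
    and t: "t = (x', y')" "x' \<in> gens A" "y' \<in> gens B" by auto
  have 1: "homog B' (int (deg B y)) (g (bas y))" "homog A' (int (deg A x')) (f (bas x'))"
    "homog B' (int (deg B y) - 1) (D (bas y))"
    using graded_bas[OF alg_homD(3)[OF g] s(3)] graded_bas[OF alg_homD(3)[OF f] t(2)]
      graded_bas[OF deriv_graded[OF D] s(3)] by auto
  have tt: "tmap A 1 f D (mult A (bas x) (bas x') \<otimes> mult B (bas y) (bas y')) =
     ks (int (deg A x) + int (deg A x')) \<odot> (f (mult A (bas x) (bas x')) \<otimes> D (mult B (bas y) (bas y')))"
    using tmap_tens[OF alg_homD(2)[OF f] deriv_flin[OF D] homog_mult[OF A(1) homog_bas' homog_bas'], of x x' "mult B (bas y) (bas y')" 1]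
      s t by (simp add: mult_fmod B)
  have "mult (tensor_alg A' B') (f (bas x) \<otimes> D (bas y)) (f (bas x') \<otimes> g (bas y')) =
     ks ((int (deg B y) - 1) * int (deg A x')) \<odot> (mult A' (f (bas x)) (f (bas x')) \<otimes> mult B' (D (bas y)) (g (bas y')))"
    using s t by (intro mult_tensor_tens[OF A(2) B(2) _ 1(3,2)]) (auto simp: fs)
  moreover have "mult (tensor_alg A' B') (f (bas x) \<otimes> g (bas y)) (f (bas x') \<otimes> D (bas y')) =
     ks (int (deg B y) * int (deg A x')) \<odot> (mult A' (f (bas x)) (f (bas x')) \<otimes> mult B' (g (bas y)) (D (bas y')))"
    using s t by (intro mult_tensor_tens[OF A(2) B(2) _ 1(1,2)]) (auto simp: fs)
  \<comment> \<open>Lowering the degree of \<open>y\<close> contributes \<open>|x'|\<close> to the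
    exponent; with \<open>|x|\<close> it makes up the degree of the whole first factor, past which
    \<open>D\<close> has moved.\<close>
  moreover have "ks (int (deg A x)) * ks ((int (deg B y) - 1) * int (deg A x')) =
      ks (int (deg B y) * int (deg A x')) * (ks (int (deg A x) + int (deg A x')) :: 'b)"
    by (simp add: ks_def)
  moreover have "ks (int (deg A x) + int (deg B y)) * (ks (int (deg A x')) * ks (int (deg B y) * int (deg A x'))) =
      ks (int (deg B y) * int (deg A x')) * (ks (int (deg A x) + int (deg A x')) * ks (int (deg B y)) :: 'b)"
    by (simp add: ks_def)
  moreover have "D (mult B (bas y) (bas y')) =
      mult B' (D (bas y)) (g (bas y')) + ks (int (deg B y)) \<odot> mult B' (g (bas y)) (D (bas y'))"
    using D s t by (simp add: deriv_def)
  ultimately show "tmap A 1 f D (mult (tensor_alg A B) (bas s) (bas t)) =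
    mult (tensor_alg A' B') (tmap A 1 f D (bas s)) (tmap A 0 f g (bas t)) +
    ks (int (deg (tensor_alg A B) s)) \<odot> mult (tensor_alg A' B') (tmap A 0 f g (bas s)) (tmap A 1 f D (bas t))"
    using s t
    by (simp add: mult_tensor_bas tt mult_fmod A B alg_homD(5)[OF f] tmap_bas fs fm.scale_right_distrib
        mult_tensor_linear)
qed

lemma tmap_id_left: "tmap A k id f = tmap A k (\<lambda>p. p) f"
  by (simp add: id_def)

lemma tmap_id_right: "tmap A k f id = tmap A k f (\<lambda>p. p)"
  by (simp add: id_def)

lemma deriv_tdif:
  assumes A: "graded_alg A" and B: "graded_alg B"
    and dA: "deriv A A (\<lambda>p. p) (dif A)" and dB: "deriv B B (\<lambda>p. p) (dif B)"
  shows "deriv (tensor_alg A B) (tensor_alg A B) (\<lambda>t. t) (tdif A B)"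
proof -
  let ?T = "tensor_alg A B"
  have *: "deriv ?T ?T (tmap A 0 (\<lambda>p. p) (\<lambda>p. p)) (\<lambda>t. tmap A 0 (dif A) (\<lambda>p. p) t + tmap A 1 (\<lambda>p. p) (dif B) t)"
    by (intro deriv_add deriv_tmap_left deriv_tmap_right graded_alg_tensor alg_hom_id assms)
  moreover have "tdif A B = (\<lambda>t. tmap A 0 (dif A) (\<lambda>p. p) t + tmap A 1 (\<lambda>p. p) (dif B) t)"
    by (simp add: tdif_def fun_eq_iff tmap_id_left tmap_id_right)
  \<comment> \<open>\<open>deriv\<close> evaluates the accompanying map on basis elements only, and
    there the tensor product of two identities is the identity.\<close>
  ultimately show ?thesis
    by (auto simp: deriv_def tmap_bas)
qed

subsection \<open>Tensor algebras\<close>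

lemma wmult_bas [simp]: "bas u \<star> bas v = bas (u @ v)"
  by (simp add: wmult_def)

lemma wmult_linear [simp]:
  "(p + p') \<star> q = p \<star> q + p' \<star> q"
  "p \<star> (q + q') = p \<star> q + p \<star> q'"
  "(a \<odot> p) \<star> q = a \<odot> (p \<star> q)"
  "p \<star> (a \<odot> q) = a \<odot> (p \<star> q)"
  "0 \<star> q = 0" "p \<star> 0 = 0"
  "(- p) \<star> q = - (p \<star> q)"
  "p \<star> (- q) = - (p \<star> q)"
  "(p - p') \<star> q = p \<star> q - p' \<star> q"
  "p \<star> (q - q') = p \<star> q - p \<star> q'"
  by (simp_all add: wmult_def)

lemma tensor_algebra_simps [simp]:
  "gens (tensor_algebra V \<delta>) = lists (gens V)"
  "deg (tensor_algebra V \<delta>) w = sum_list (map (deg V) w)"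
  "mult (tensor_algebra V \<delta>) = wmult"
  "munit (tensor_algebra V \<delta>) = bas []"
  "dif (tensor_algebra V \<delta>) = der_ext V id \<delta>"
  by (simp_all add: tensor_algebra_def words_def)

lemma fmod_UNIV_induct [case_names zero add smul bas]:
  fixes p :: "'x \<Rightarrow>\<^sub>0 'r::comm_ring_1"
  assumes "P 0" "\<And>p q. P p \<Longrightarrow> P q \<Longrightarrow> P (p + q)" "\<And>a p. P p \<Longrightarrow> P (a \<odot> p)" "\<And>x. P (bas x)"
  shows "P p"
proof -
  have "p \<in> fmod \<lparr>gens = UNIV, deg = \<lambda>_. 0\<rparr>" by (simp add: fmod_def)
  then show ?thesis by (induction rule: fmod_induct) (use assms in auto)
qed

lemma wmult_assoc: "(p \<star> q) \<star> r = p \<star> (q \<star> r)"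
proof (induction p rule: fmod_UNIV_induct)
  case x: (bas x)
  show ?case
  proof (induction q rule: fmod_UNIV_induct)
    case (bas y)
    show ?case by (induction r rule: fmod_UNIV_induct) auto
  qed auto
qed auto

lemma wmult_Nil [simp]: "bas [] \<star> p = p" "p \<star> bas [] = p"
  by (induction p rule: fmod_UNIV_induct) auto

lemma graded_alg_tensor_algebra: "graded_alg (tensor_algebra V \<delta>)"
  unfolding graded_alg_def by (auto simp: wmult_def fun_eq_iff)

section \<open>Algebra maps out of a tensor algebra, and comparison on letters\<close>

lemma alg_ext_linear [simp]:
  "alg_ext B F (p + q) = alg_ext B F p + alg_ext B F q"
  "alg_ext B F (a \<odot> p) = a \<odot> alg_ext B F p"
  "alg_ext B F 0 = 0" "alg_ext B F (- p) = - alg_ext B F p"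
  "alg_ext B F (p - q) = alg_ext B F p - alg_ext B F q"
  by (simp_all add: alg_ext_def)

lemma alg_ext_Nil [simp]: "alg_ext B F (bas []) = munit B"
  and alg_ext_Cons: "alg_ext B F (bas (x # w)) = mult B (F x) (alg_ext B F (bas w))"
  by (simp_all add: alg_ext_def)

lemma alg_ext_word_fmod:
  assumes "graded_alg B" "\<And>x. x \<in> gens V \<Longrightarrow> F x \<in> fmod B" "w \<in> lists (gens V)"
  shows "alg_ext B F (bas w) \<in> fmod B"
  using assms(3) by (induction w) (auto simp: alg_ext_Cons munit_fmod mult_fmod assms)

lemma alg_mor_alg_ext:
  assumes B: "graded_alg B" and F: "\<And>x. x \<in> gens V \<Longrightarrow> F x \<in> fmod B"
  shows "alg_mor (tensor_algebra V \<delta>) B (alg_ext B F)"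
proof (rule alg_morI[OF graded_alg_tensor_algebra B])
  have wf: "alg_ext B F (bas w) \<in> fmod B" if "w \<in> lists (gens V)" for w
    using alg_ext_word_fmod[OF B F that] .
  then show "flin (tensor_algebra V \<delta>) B (alg_ext B F)"
    unfolding alg_ext_def by (intro flin_lin) simp
  fix u v assume "u \<in> gens (tensor_algebra V \<delta>)" and v: "v \<in> gens (tensor_algebra V \<delta>)"
  then have "u \<in> lists (gens V)" by simp
  then show "alg_ext B F (mult (tensor_algebra V \<delta>) (bas u) (bas v)) =
      mult B (alg_ext B F (bas u)) (alg_ext B F (bas v))"
  proof (induction u)
    case Nil
    then show ?case using wf v by (simp add: mult_unit[OF B])
  next
    case (Cons x u)
    then show ?case
      using wf F v by (simp add: alg_ext_Cons mult_assoc[OF B])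
  qed
qed simp

lemma alg_ext_gen: "graded_alg B \<Longrightarrow> F x \<in> fmod B \<Longrightarrow> alg_ext B F (bas [x]) = F x"
  by (simp add: alg_ext_Cons mult_unit)

lemma alg_hom_alg_ext:
  assumes B: "graded_alg B" and F: "\<And>x. x \<in> gens V \<Longrightarrow> homog B (int (deg V x)) (F x)"
  shows "alg_hom (tensor_algebra V \<delta>) B (alg_ext B F)"
  unfolding alg_hom_def
proof
  show *: "alg_mor (tensor_algebra V \<delta>) B (alg_ext B F)"
    using F by (intro alg_mor_alg_ext[OF B]) (auto intro: homog_fmod)
  have "homog B (int (sum_list (map (deg V) w))) (alg_ext B F (bas w))" if "w \<in> lists (gens V)" for w
    using that by (induction w) (auto simp: alg_ext_Cons homog_munit[OF B] intro!: homog_mult[OF B] F)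
  then show "graded_map 0 (tensor_algebra V \<delta>) B (alg_ext B F)"
    using alg_morD(1)[OF *] by (simp add: graded_map_iff)
qed

lemma alg_mor_eqI:
  assumes f: "alg_mor (tensor_algebra V \<delta>) B f" and g: "alg_mor (tensor_algebra V \<delta>) B g"
    and eq: "\<And>x. x \<in> gens V \<Longrightarrow> f (bas [x]) = g (bas [x])" and p: "p \<in> fmod (tensor_algebra V \<delta>)"
  shows "f p = g p"
proof (rule flin_eqI[OF alg_morD(1)[OF f] alg_morD(1)[OF g] _ p])
  fix w assume "w \<in> gens (tensor_algebra V \<delta>)"
  then have "w \<in> lists (gens V)" by simp
  then show "f (bas w) = g (bas w)"
  proof (induction w)
    case Nil
    then show ?case using alg_morD(2)[OF f] alg_morD(2)[OF g] by simp
  next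
    case (Cons x w)
    then show ?case
      using alg_morD(3)[OF f, of "bas [x]" "bas w"] alg_morD(3)[OF g, of "bas [x]" "bas w"] eq
      by simp
  qed
qed

text \<open>The Leibniz rule determines a derivation by its values on letters and by the
  accompanying map. The accompanying maps are compared on the module only, so that \<open>f\<close>
  may be a composite which merely simplifies to \<open>f'\<close> there.\<close>

lemma deriv_eqI:
  assumes B: "graded_alg B"
    and D: "deriv (tensor_algebra V \<delta>) B f D" and E: "deriv (tensor_algebra V \<delta>) B f' E"
    and f: "\<And>p. p \<in> fmod (tensor_algebra V \<delta>) \<Longrightarrow> f p = f' p"
    and eq: "\<And>x. x \<in> gens V \<Longrightarrow> D (bas [x]) = E (bas [x])" and p: "p \<in> fmod (tensor_algebra V \<delta>)"
  shows "D p = E p"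
proof (rule flin_eqI[OF deriv_flin[OF D] deriv_flin[OF E] _ p])
  fix w assume "w \<in> gens (tensor_algebra V \<delta>)"
  then have "w \<in> lists (gens V)" by simp
  then show "D (bas w) = E (bas w)"
  proof (induction w)
    case Nil
    then show ?case
      using deriv_munit[OF graded_alg_tensor_algebra D] deriv_munit[OF graded_alg_tensor_algebra E] by simp
  next
    case (Cons x w)
    have "D (bas [x] \<star> bas w) = mult B (D (bas [x])) (f (bas w)) + ks (int (deg V x)) \<odot> mult B (f (bas [x])) (D (bas w))"
      using D Cons(1,2) unfolding deriv_def
      by (auto simp del: wmult_bas dest!: bspec[where x = "[x]"] bspec[where x = w])
    moreover have "E (bas [x] \<star> bas w) = mult B (E (bas [x])) (f' (bas w)) + ks (int (deg V x)) \<odot> mult B (f' (bas [x])) (E (bas w))"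
      using E Cons(1,2) unfolding deriv_def
      by (auto simp del: wmult_bas dest!: bspec[where x = "[x]"] bspec[where x = w])
    ultimately show ?case using Cons f[of "bas [x]"] f[of "bas w"] eq by simp
  qed
qed

section \<open>Relabelled letters and derivations with prescribed values\<close>

lemma wmap_linear [simp]:
  "wmap i (p + q) = wmap i p + wmap i q" "wmap i (a \<odot> p) = a \<odot> wmap i p" "wmap i 0 = 0"
  "wmap i (- p) = - wmap i p" "wmap i (p - q) = wmap i p - wmap i q"
  by (simp_all add: wmap_def)

lemma wmap_bas [simp]: "wmap i (bas w) = bas (map i w)"
  by (simp add: wmap_def)

lemma wmap_wmult: "wmap i (p \<star> q) = wmap i p \<star> wmap i q"
proof (induction p rule: fmod_UNIV_induct)
  case (bas u)
  show ?case by (induction q rule: fmod_UNIV_induct) auto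
qed auto

lemma wmap_wmap: "wmap j (wmap i p) = wmap (\<lambda>x. j (i x)) p"
  by (induction p rule: fmod_UNIV_induct) (auto simp: comp_def)

lemma alg_mor_wmap:
  assumes "\<And>x. x \<in> gens V \<Longrightarrow> i x \<in> gens W"
  shows "alg_mor (tensor_algebra V \<delta>) (tensor_algebra W \<delta>') (wmap i)"
  unfolding alg_mor_def
proof (intro conjI ballI)
  show "flin (tensor_algebra V \<delta>) (tensor_algebra W \<delta>') (wmap i)"
    unfolding wmap_def using assms by (intro flin_lin) auto
qed (auto simp: wmap_wmult)

lemma alg_hom_wmap:
  assumes "\<And>x. x \<in> gens V \<Longrightarrow> i x \<in> gens W \<and> deg W (i x) = deg V x"
  shows "alg_hom (tensor_algebra V \<delta>) (tensor_algebra W \<delta>') (wmap i)"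
  unfolding alg_hom_def
proof
  show "graded_map 0 (tensor_algebra V \<delta>) (tensor_algebra W \<delta>') (wmap i)"
    unfolding wmap_def using assms
    by (intro graded_lin) (auto intro!: arg_cong[of _ _ sum_list] simp: in_lists_conv_set)
qed (use assms in \<open>auto intro: alg_mor_wmap\<close>)

lemma der_word_append:
  fixes F :: "'x \<Rightarrow> ('y list \<Rightarrow>\<^sub>0 'r::comm_ring_1)"
  shows "der_word V i F (u @ v) = der_word V i F u \<star> bas (map i v)
     + ks (int (sum_list (map (deg V) u))) \<odot> (bas (map i u) \<star> der_word V i F v)"
proof (induction u)
  case (Cons x u)
  have "bas (i x # map i u) \<star> p = bas [i x] \<star> (bas (map i u) \<star> p)" for p :: "'y list \<Rightarrow>\<^sub>0 'r"
    by (simp add: wmult_assoc[symmetric])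
  with Cons show ?case
    by (simp add: wmult_assoc minus_one_power_ks ks_add algebra_simps fm.scale_right_distrib)
qed simp

lemma der_ext_gen [simp]: "der_ext V i F (bas [x]) = F x"
  by (simp add: der_ext_def)

lemma deriv_der_ext:
  fixes F :: "'x \<Rightarrow> ('y list \<Rightarrow>\<^sub>0 'r::comm_ring_1)"
  assumes i: "\<And>x. x \<in> gens V \<Longrightarrow> i x \<in> gens W \<and> deg W (i x) = deg V x"
    and F: "\<And>x. x \<in> gens V \<Longrightarrow> homog (tensor_algebra W \<delta>') (int (deg V x) - 1) (F x)"
  shows "deriv (tensor_algebra V \<delta>) (tensor_algebra W \<delta>') (wmap i) (der_ext V i F)"
  unfolding deriv_def
proof (intro conjI ballI)
  let ?W = "tensor_algebra W \<delta>'"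
  note W = graded_alg_tensor_algebra[of W \<delta>']
  have "homog ?W (int (sum_list (map (deg V) w)) - 1) (der_word V i F w)"
    if "w \<in> lists (gens V)" for w
    using that
  proof (induction w)
    case (Cons x w)
    have sl: "sum_list (map (deg W \<circ> i) w) = sum_list (map (deg V) w)"
      using Cons i by (intro arg_cong[of _ _ sum_list]) (auto simp: in_lists_conv_set)
    have "homog ?W (int (deg V x) - 1 + int (sum_list (map (deg V) w))) (mult ?W (F x) (bas (map i w)))"
      using Cons i by (intro homog_mult[OF W] F) (auto simp: sl)
    moreover have "homog ?W (int (deg V x) + (int (sum_list (map (deg V) w)) - 1)) (mult ?W (bas [i x]) (der_word V i F w))"
      using Cons i by (intro homog_mult[OF W]) auto
    ultimately show ?case by (simp add: algebra_simps)
  qed auto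
  then show "graded_map (-1) (tensor_algebra V \<delta>) ?W (der_ext V i F)"
    unfolding der_ext_def by (intro graded_lin) simp
qed (simp add: der_ext_def der_word_append)

lemma tensor_algebra_dif_deriv:
  assumes "\<And>x. x \<in> gens V \<Longrightarrow> homog (tensor_algebra V \<delta>) (int (deg V x) - 1) (\<delta> x)"
  shows "deriv (tensor_algebra V \<delta>) (tensor_algebra V \<delta>) (\<lambda>p. p) (dif (tensor_algebra V \<delta>))"
proof -
  have "deriv (tensor_algebra V \<delta>) (tensor_algebra V \<delta>) (wmap id) (dif (tensor_algebra V \<delta>))"
    unfolding tensor_algebra_simps by (rule deriv_der_ext) (use assms in simp_all)
  then show ?thesis by (auto simp: deriv_def)
qed

subsection \<open>Hopf modules over a connected coalgebra\<close>

text \<open>\<open>H\<close> enters as a connected coalgebra whose degree 0 part is spanned by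
  \<open>e\<close>, and \<open>\<mu>\<close> as a linear map. Every product formed has a coinvariant
  \<open>b\<close> on the left, whence the form \<open>\<nu>(b h) = b \<psi>(h)\<close> of the
  compatibility.\<close>

locale hopf_module =
  fixes M :: "('z, 'm) graded_basis_scheme" and H :: "('h, 'n) graded_basis_scheme" and e :: 'h
    and \<nu> :: "('z \<Rightarrow>\<^sub>0 'r::comm_ring_1) \<Rightarrow> ('z \<times> 'h \<Rightarrow>\<^sub>0 'r)"
    and \<psi> :: "('h \<Rightarrow>\<^sub>0 'r) \<Rightarrow> ('h \<times> 'h \<Rightarrow>\<^sub>0 'r)"
    and \<mu> :: "('z \<times> 'h \<Rightarrow>\<^sub>0 'r) \<Rightarrow> ('z \<Rightarrow>\<^sub>0 'r)"
  assumes conn: "{h \<in> gens H. deg H h = 0} = {e}"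
    and nu: "graded_map 0 M (tensor_basis M H) \<nu>"
    and psi: "graded_map 0 H (tensor_basis H H) \<psi>"
    and mu: "graded_map 0 (tensor_basis M H) M \<mu>"
    and nu_coassoc: "p \<in> fmod M \<Longrightarrow> assoc (tmap M 0 \<nu> id (\<nu> p)) = tmap M 0 id \<psi> (\<nu> p)"
    and nu_counit: "p \<in> fmod M \<Longrightarrow> lin (\<lambda>(x, y). if y = e then bas x else 0) (\<nu> p) = p"
    and psi_e: "\<psi> (bas e) = bas (e, e)"
    and psi_left: "h \<in> gens H \<Longrightarrow> lin (\<lambda>(x, y). if x = e then bas y else 0) (\<psi> (bas h)) = bas h"
    and psi_right: "h \<in> gens H \<Longrightarrow> lin (\<lambda>(x, y). if y = e then bas x else 0) (\<psi> (bas h)) = bas h"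
    and mu_unit: "p \<in> fmod M \<Longrightarrow> \<mu> (p \<otimes> bas e) = p"
    and mu_coact: "b \<in> fmod M \<Longrightarrow> \<nu> b = b \<otimes> bas e \<Longrightarrow> h \<in> gens H \<Longrightarrow>
      \<nu> (\<mu> (b \<otimes> bas h)) = tmap H 0 (\<lambda>k. \<mu> (b \<otimes> k)) id (\<psi> (bas h))"
begin

abbreviation MH where "MH \<equiv> tensor_basis M H"

lemma deg_zero_iff: "h \<in> gens H \<and> deg H h = 0 \<longleftrightarrow> h = e"
proof -
  have "h \<in> {h \<in> gens H. deg H h = 0} \<longleftrightarrow> h \<in> {e}" by (simp only: conn)
  then show ?thesis by simp
qed

lemma e_gens [simp]: "e \<in> gens H" and deg_e [simp]: "deg H e = 0"
  using deg_zero_iff[of e] by simp_all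

lemma deg_pos: "h \<in> gens H \<Longrightarrow> h \<noteq> e \<Longrightarrow> 0 < deg H h"
  using deg_zero_iff[of h] by simp

lemmas nu_fmod = flinD(1)[OF graded_flin[OF nu]]
lemmas mu_fmod = flinD(1)[OF graded_flin[OF mu]]
lemmas psi_fmod = flinD(1)[OF graded_flin[OF psi]]

text \<open>
  The projection onto the coinvariants is forced by \<open>x = \<Sum> P(x\<^sub>0) x\<^sub>1\<close>: solving for the summand
  with \<open>x\<^sub>1 = 1\<close> gives a recursion on the degree. The guard on degrees selects the other summands.
\<close>

function P0 :: "'z \<Rightarrow> ('z \<Rightarrow>\<^sub>0 'r)" where
  "P0 z = bas z - lin (\<lambda>(x, y). if deg M x < deg M z then \<mu> (P0 x \<otimes> bas y) else 0) (\<nu> (bas z))"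
  by auto
termination by (relation "measure (deg M)") auto

declare P0.simps [simp del]

definition P where "P = lin P0"

lemma P_bas [simp]: "P (bas z) = P0 z"
  by (simp add: P_def)

text \<open>Degrees add up and only \<open>e\<close> has degree 0, so the guard in \<open>P0\<close>
  selects exactly the terms with \<open>y \<noteq> e\<close>.\<close>

lemma keys_nu:
  assumes "z \<in> gens M" "(x, y) \<in> keys (\<nu> (bas z))"
  shows "x \<in> gens M" "y \<in> gens H" "deg M x + deg H y = deg M z" "deg M x < deg M z \<longleftrightarrow> y \<noteq> e"
proof -
  have h: "homog MH (int (deg M z)) (\<nu> (bas z))" using graded_bas[OF nu assms(1)] by simp
  show x: "x \<in> gens M" "y \<in> gens H" using fmod_keysD[OF homog_fmod[OF h] assms(2)] by auto
  have *: "int (deg M x + deg H y) = int (deg M z)" using homogD[OF h assms(2)] by simp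
  then show s: "deg M x + deg H y = deg M z" by (simp only: of_nat_eq_iff)
  show "deg M x < deg M z \<longleftrightarrow> y \<noteq> e"
  proof (cases "y = e")
    case False
    then show ?thesis using deg_pos[OF x(2)] s by linarith
  qed (use s in simp)
qed

lemma homog_P0: "z \<in> gens M \<Longrightarrow> homog M (int (deg M z)) (P0 z)"
proof (induction z rule: P0.induct)
  case (1 z)
  have "homog M (int (deg M z)) (lin (\<lambda>(x, y). if deg M x < deg M z then \<mu> (P0 x \<otimes> bas y) else 0) (\<nu> (bas z)))"
  proof (rule homog_lin)
    fix k assume k: "k \<in> keys (\<nu> (bas z))"
    obtain x y where xy: "k = (x, y)" by (cases k)
    note kn = keys_nu[OF 1(2) k[unfolded xy]]
    show "homog M (int (deg M z)) (case k of (x, y) \<Rightarrow> if deg M x < deg M z then \<mu> (P0 x \<otimes> bas y) else 0)"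
    proof (cases "deg M x < deg M z")
      case True
      have "homog M (int (deg M x)) (P0 x)" using 1(1)[OF k xy[symmetric] True kn(1)] .
      then have "homog MH (int (deg M x) + int (deg H y)) (P0 x \<otimes> bas y)"
        using kn by (intro homog_tens) auto
      from graded_homog[OF mu this] show ?thesis using kn(3) True by (simp add: xy flip: of_nat_add)
    qed (simp add: xy)
  qed
  then show ?case using 1(2) by (subst P0.simps) auto
qed

lemma graded_P: "graded_map 0 M M P"
  unfolding P_def by (rule graded_lin) (simp add: homog_P0)

lemmas P_fmod = flinD(1)[OF graded_flin[OF graded_P]]
lemmas P_flin = graded_flin[OF graded_P]

text \<open>The comparison map \<open>x \<mapsto> \<Sum> P(x\<^sub>0) \<otimes> x\<^sub>1\<close> of
  the structure theorem. Its inverse is \<open>\<mu>\<close>, restricted to coinvariants tensor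
  \<open>H\<close>.\<close>

definition \<phi> where "\<phi> p = tmap M 0 P id (\<nu> p)"

lemma graded_phi: "graded_map 0 M MH \<phi>"
  unfolding \<phi>_def by (rule graded_comp0[OF nu graded_tmap[OF graded_P graded_id(2)]]) simp

lemmas phi_flin = graded_flin[OF graded_phi]

lemma split_counit:
  "(t :: 'u \<times> 'h \<Rightarrow>\<^sub>0 'r) = lin (\<lambda>(x, y). if y = e then bas x else 0) t \<otimes> bas e
    + lin (\<lambda>(x, y). if y = e then 0 else bas (x, y)) t"
proof (induction t rule: fmod_UNIV_induct)
  case (add p q)
  then show ?case by (simp add: add_ac)
next
  case (smul a p)
  then show ?case by (simp flip: fm.scale_right_distrib)
qed (auto split: if_splits)

lemma nu_reduced:
  "p \<in> fmod M \<Longrightarrow> \<nu> p - p \<otimes> bas e = lin (\<lambda>(x, y). if y = e then 0 else bas (x, y)) (\<nu> p)"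
  using split_counit[of "\<nu> p"] by (simp add: nu_counit algebra_simps)

text \<open>The reduced coaction \<open>\<nu> z - z \<otimes> e\<close> replaces the degree guard.
  Being linear in \<open>z\<close>, this form extends from basis elements to all of
  \<open>M\<close>.\<close>

lemma P0_eq:
  assumes z: "z \<in> gens M"
  shows "P0 z = bas z - \<mu> (tmap M 0 P id (\<nu> (bas z) - bas z \<otimes> bas e))"
proof -
  have z': "bas z \<in> fmod M" using z by simp
  have "tmap M 0 P id (\<nu> (bas z) - bas z \<otimes> bas e) =
     lin (\<lambda>(x, y). if y = e then 0 else P0 x \<otimes> bas y) (\<nu> (bas z))"
    unfolding nu_reduced[OF z'] tmap_eq lin_lin by (intro lin_cong refl) (auto split: prod.splits)
  also have "\<mu> \<dots> = lin (\<lambda>w. \<mu> ((\<lambda>(x, y). if y = e then 0 else P0 x \<otimes> bas y) w)) (\<nu> (bas z))"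
    by (rule flin_lin_app[OF graded_flin[OF mu] nu_fmod[OF z']])
       (auto intro!: tens_in_fmod homog_fmod[OF homog_P0])
  also have "\<dots> = lin (\<lambda>(x, y). if deg M x < deg M z then \<mu> (P0 x \<otimes> bas y) else 0) (\<nu> (bas z))"
    using keys_nu(4)[OF z] flin_zero[OF graded_flin[OF mu]] by (intro lin_cong refl) auto
  finally show ?thesis by (subst P0.simps) simp
qed

text \<open>This is the recursion for \<open>P0\<close> rearranged: the term with second factor
  \<open>e\<close> contributes \<open>\<mu> (P0 z \<otimes> bas e) = P0 z\<close>.\<close>

lemma mu_phi_bas: "z \<in> gens M \<Longrightarrow> \<mu> (\<phi> (bas z)) = bas z"
proof -
  assume z: "z \<in> gens M"
  have "tmap M 0 P id (\<nu> (bas z) - bas z \<otimes> bas e) = \<phi> (bas z) - P0 z \<otimes> bas e"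
    by (simp add: \<phi>_def tmap_bas)
  moreover have "P0 z \<in> fmod M" using homog_P0[OF z] by (rule homog_fmod)
  moreover have "\<phi> (bas z) \<in> fmod MH" using flinD(1)[OF phi_flin] z by simp
  ultimately have "\<mu> (tmap M 0 P id (\<nu> (bas z) - bas z \<otimes> bas e)) = \<mu> (\<phi> (bas z)) - P0 z"
    by (simp add: flin_diff_app[OF graded_flin[OF mu]] mu_unit)
  with P0_eq[OF z] show ?thesis by simp
qed

lemma mu_phi: "p \<in> fmod M \<Longrightarrow> \<mu> (\<phi> p) = p"
  by (rule flin_eqI[OF flin_comp[OF phi_flin graded_flin[OF mu]] flin_id(1)]) (auto simp: mu_phi_bas)

lemma P_eq:
  assumes p: "p \<in> fmod M"
  shows "P p = p - \<mu> (tmap M 0 P id (\<nu> p - p \<otimes> bas e))"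
proof -
  have "tmap M 0 P id (\<nu> p - p \<otimes> bas e) = \<phi> p - P p \<otimes> bas e"
    using tmap0_tens[OF P_flin flin_id(2) p, of "bas e" H] by (simp add: \<phi>_def)
  then show ?thesis
    using p by (simp add: flin_diff_app[OF graded_flin[OF mu]] mu_unit P_fmod mu_phi flinD(1)[OF phi_flin])
qed

text \<open>Induction on the degree. The reduced coaction involves only \<open>x\<close> of smaller
  degree, whose \<open>P0 x\<close> are coinvariant, so \<open>\<nu>\<close> of the subtracted term
  is a sum of \<open>P0(x) y\<^sub>1 \<otimes> y\<^sub>2\<close>. Coassociativity and
  \<open>mu_phi_bas\<close> evaluate that sum to \<open>\<nu> z - P0 z \<otimes> e\<close>, and the
  difference is as claimed.\<close>

lemma nu_P0: "z \<in> gens M \<Longrightarrow> \<nu> (P0 z) = P0 z \<otimes> bas e"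
proof (induction "deg M z" arbitrary: z rule: less_induct)
  case less
  define t where "t = \<nu> (bas z) - bas z \<otimes> bas e"
  \<comment> \<open>\<open>K\<close> is multiplication of \<open>P0 x\<close> by the first of the
    two coacting factors, the second being kept.\<close>
  define K where "K = lin (\<lambda>(x, y, y' :: 'h). \<mu> (P0 x \<otimes> bas y) \<otimes> bas y')"
  have z: "bas z \<in> fmod M" using less by simp
  have P0z: "P0 z \<in> fmod M" using homog_P0[OF less(2)] by (rule homog_fmod)
  \<comment> \<open>On this smaller basis the induction hypothesis applies to every generator, so
    two linear maps can be compared there.\<close>
  let ?X = "\<lparr>gens = {(x, y) \<in> gens MH. deg M x < deg M z}, deg = deg MH\<rparr>"
  have tX: "t \<in> fmod ?X"
    unfolding t_def nu_reduced[OF z] using keys_nu[OF less(2)]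
    by (auto simp: fmod_def elim!: in_keys_linE split: if_splits)
  have X: "fmod ?X \<subseteq> fmod MH" by (auto simp: fmod_def)
  have 1: "flin ?X MH (\<lambda>t. \<nu> (\<mu> (tmap M 0 P id t)))"
    by (rule flin_comp[OF flin_comp[OF _ graded_flin[OF mu]] graded_flin[OF nu]])
       (use flin_tmap[OF P_flin flin_id(2), where B = H] X in \<open>auto simp: flin_def\<close>)
  have KL: "flin (tensor_basis M (tensor_basis H H)) MH K"
    unfolding K_def by (rule flin_lin) (auto intro!: tens_in_fmod mu_fmod homog_fmod[OF homog_P0])
  have 2: "flin ?X MH (\<lambda>t. K (tmap M 0 id \<psi> t))"
    by (rule flin_comp[OF _ KL])
       (use flin_tmap[OF flin_id(2) graded_flin[OF psi], where A = M] X in \<open>auto simp: flin_def\<close>)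
  have "\<nu> (\<mu> (tmap M 0 P id t)) = K (tmap M 0 id \<psi> t)"
  proof (rule flin_eqI[OF 1 2 _ tX])
    fix w assume "w \<in> gens ?X"
    then obtain x y where w: "w = (x, y)" "x \<in> gens M" "y \<in> gens H" "deg M x < deg M z" by auto
    have "\<nu> (\<mu> (P0 x \<otimes> bas y)) = tmap H 0 (\<lambda>k. \<mu> (P0 x \<otimes> k)) id (\<psi> (bas y))"
      using less(1)[OF w(4,2)] w homog_P0[OF w(2)] by (intro mu_coact) (auto intro: homog_fmod)
    also have "\<dots> = K (bas x \<otimes> \<psi> (bas y))"
      by (simp add: K_def lin_tens tmap_eq case_prod_unfold)
    finally show "\<nu> (\<mu> (tmap M 0 P id (bas w))) = K (tmap M 0 id \<psi> (bas w))"
      by (simp add: w tmap_bas)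
  qed
  \<comment> \<open>The term \<open>z \<otimes> e\<close> missing from \<open>t\<close> would
    contribute \<open>K (z \<otimes> e \<otimes> e) = P0 z \<otimes> e\<close>.\<close>
  also have "\<dots> = K (tmap M 0 id \<psi> (\<nu> (bas z))) - P0 z \<otimes> bas e"
    using P0z by (simp add: t_def tmap_bas psi_e K_def mu_unit)
  also have "K (tmap M 0 id \<psi> (\<nu> (bas z))) = K (assoc (tmap M 0 \<nu> id (\<nu> (bas z))))"
    using nu_coassoc[OF z] by simp
  \<comment> \<open>After coassociativity, \<open>K\<close> consumes the coaction of the first
    factor \<open>x\<close> and so builds \<open>\<mu> (\<phi> x)\<close>.\<close>
  also have "\<dots> = tmap M 0 (\<lambda>p. \<mu> (\<phi> p)) id (\<nu> (bas z))"
  proof (rule flin_eqI[of MH MH _ MH _ "\<nu> (bas z)"])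
    have "flin MH (tensor_basis MH H) (tmap M 0 \<nu> id)"
      by (rule flin_tmap[OF graded_flin[OF nu] flin_id(2)])
    then have "flin MH (tensor_basis M (tensor_basis H H)) (\<lambda>w. assoc (tmap M 0 \<nu> id w))"
      by (rule flin_comp[OF _ graded_flin[OF graded_assoc]])
    then show "flin MH MH (\<lambda>w. K (assoc (tmap M 0 \<nu> id w)))" by (rule flin_comp[OF _ KL])
    show "flin MH MH (tmap M 0 (\<lambda>p. \<mu> (\<phi> p)) id)"
      by (rule flin_tmap[OF flin_comp[OF phi_flin graded_flin[OF mu]] flin_id(2)])
    show "\<nu> (bas z) \<in> fmod MH" using z by (rule nu_fmod)
    fix w assume "w \<in> gens MH"
    then obtain x y where w: "w = (x, y)" "x \<in> gens M" "y \<in> gens H" by auto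
    have x: "\<nu> (bas x) \<in> fmod MH" using w nu_fmod by simp
    have "K (assoc (u \<otimes> bas y)) = \<mu> (tmap M 0 P id u) \<otimes> bas y" if "u \<in> fmod MH" for u
    proof (rule flin_eqI[of MH MH _ MH _ u])
      have "flin MH (tensor_basis MH H) (\<lambda>u. u \<otimes> bas y)" using w by (intro flin_tens_left) simp
      then have "flin MH (tensor_basis M (tensor_basis H H)) (\<lambda>u. assoc (u \<otimes> bas y))"
        by (rule flin_comp[OF _ graded_flin[OF graded_assoc]])
      then show "flin MH MH (\<lambda>u. K (assoc (u \<otimes> bas y)))" by (rule flin_comp[OF _ KL])
      have "flin MH M (\<lambda>u. \<mu> (tmap M 0 P id u))"
        by (rule flin_comp[OF flin_tmap[OF P_flin flin_id(2)] graded_flin[OF mu]])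
      then show "flin MH MH (\<lambda>u. \<mu> (tmap M 0 P id u) \<otimes> bas y)"
        by (rule flin_comp[OF _ flin_tens_left]) (simp add: w)
      fix v assume "v \<in> gens MH"
      then show "K (assoc (bas v \<otimes> bas y)) = \<mu> (tmap M 0 P id (bas v)) \<otimes> bas y"
        by (cases v) (simp add: K_def tmap_bas)
    qed (rule that)
    from this[OF x] show "K (assoc (tmap M 0 \<nu> id (bas w))) = tmap M 0 (\<lambda>p. \<mu> (\<phi> p)) id (bas w)"
      by (simp add: w tmap_bas \<phi>_def)
  qed
  also have "\<dots> = \<nu> (bas z)"
  proof -
    have "tmap M 0 (\<lambda>p. \<mu> (\<phi> p)) id (\<nu> (bas z)) = tmap M 0 (\<lambda>p. p) (\<lambda>p. p) (\<nu> (bas z))"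
      using nu_fmod[OF z] by (intro tmap_cong[where B = H]) (auto simp: mu_phi_bas)
    then show ?thesis using tmap0_id[OF nu_fmod[OF z]] by simp
  qed
  finally have *: "\<nu> (\<mu> (tmap M 0 P id t)) = \<nu> (bas z) - P0 z \<otimes> bas e" .
  have "tmap M 0 P id t \<in> fmod MH"
    using flinD(1)[OF flin_tmap[OF P_flin flin_id(2), where B = H]] tX X by auto
  then have "\<nu> (P0 z) = \<nu> (bas z) - \<nu> (\<mu> (tmap M 0 P id t))"
    using P0_eq[OF less(2)] flin_diff_app[OF graded_flin[OF nu] z mu_fmod] by (simp add: t_def)
  with * show ?case by simp
qed

text \<open>Induction on the degree of \<open>h\<close>. For \<open>h \<noteq> e\<close> write
  \<open>\<psi> h = h \<otimes> e + r\<close>, where the first factors in \<open>r\<close> have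
  smaller degree. By induction only those equal to \<open>e\<close> survive, and the left counit
  gives \<open>\<phi>(b h) = P(b h) \<otimes> e + b \<otimes> h\<close>. Applying
  \<open>\<mu>\<close> leaves \<open>P(b h) = 0\<close>.\<close>

lemma P_mu:
  assumes b: "b \<in> fmod M" "\<nu> b = b \<otimes> bas e"
  shows "h \<in> gens H \<Longrightarrow> P (\<mu> (b \<otimes> bas h)) = (if h = e then b else 0)"
proof (induction "deg H h" arbitrary: h rule: less_induct)
  case less
  have F: "lin (\<lambda>(x, y). (if x = e then b else 0) \<otimes> bas y) t =
      b \<otimes> lin (\<lambda>(x, y). if x = e then bas y else 0) t" for t :: "'h \<times> 'h \<Rightarrow>\<^sub>0 'r"
    by (simp add: tens_lin_right case_prod_unfold) (intro lin_cong refl, simp)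
  show ?case
  proof (cases "h = e")
    case True
    \<comment> \<open>For a coinvariant the reduced coaction vanishes, and with it the correction in
      \<open>P_eq\<close>.\<close>
    have "P b = b" using P_eq[OF b(1)] b flin_zero[OF graded_flin[OF mu]] by simp
    then show ?thesis using True b by (simp add: mu_unit)
  next
    case False
    define m where "m = \<mu> (b \<otimes> bas h)"
    have bh: "b \<otimes> bas h \<in> fmod MH" using b less by simp
    have m: "m \<in> fmod M" unfolding m_def using bh by (rule mu_fmod)
    have ps: "\<psi> (bas h) \<in> fmod (tensor_basis H H)" using psi_fmod less by simp
    have fb: "flin H M (\<lambda>k. \<mu> (b \<otimes> k))"
      by (rule flin_comp[OF flin_tens_right[OF b(1)] graded_flin[OF mu]])
    define r where "r = lin (\<lambda>(x, y). if y = e then 0 else bas (x, y)) (\<psi> (bas h))"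
    \<comment> \<open>The right counit identifies the part of \<open>\<psi> h\<close> with second
      factor \<open>e\<close>.\<close>
    have hr: "\<psi> (bas h) = bas (h, e) + r"
      using split_counit[of "\<psi> (bas h)"] psi_right[OF less(2)] by (simp add: r_def)
    have rk: "x \<in> gens H \<and> deg H x < deg H h" if "(x, y) \<in> keys r" for x y
    proof -
      have "(x, y) \<in> keys (\<psi> (bas h))" "y \<noteq> e"
        using that unfolding r_def by (auto elim!: in_keys_linE split: if_splits)
      moreover have "homog (tensor_basis H H) (int (deg H h)) (\<psi> (bas h))"
        using graded_bas[OF psi less(2)] by simp
      ultimately show ?thesis
        using homogD[of "tensor_basis H H" _ "\<psi> (bas h)" "(x, y)"] fmod_keysD[OF ps] deg_pos[of y] by force
    qed
    have "\<phi> m = tmap M 0 P id (tmap H 0 (\<lambda>k. \<mu> (b \<otimes> k)) id (\<psi> (bas h)))"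
      using mu_coact[OF b less(2)] by (simp add: \<phi>_def m_def)
    also have "\<dots> = tmap H 0 (\<lambda>k. P (\<mu> (b \<otimes> k))) (\<lambda>y. y) (\<psi> (bas h))"
      using tmap0_comp0[OF fb flin_id(2) P_flin flin_id(2) ps] by simp
    also have "\<dots> = P m \<otimes> bas e + tmap H 0 (\<lambda>k. P (\<mu> (b \<otimes> k))) (\<lambda>y. y) r"
      by (simp add: hr tmap_bas m_def)
    also have "tmap H 0 (\<lambda>k. P (\<mu> (b \<otimes> k))) (\<lambda>y. y) r = lin (\<lambda>(x, y). (if x = e then b else 0) \<otimes> bas y) r"
      unfolding tmap_eq by (rule lin_cong) (use less(1) rk in auto)
    also have "\<dots> = b \<otimes> bas h"
    proof -
      have "lin (\<lambda>(x, y). if x = e then bas y else 0) r = bas h"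
        using psi_left[OF less(2)] False by (simp add: hr)
      then show ?thesis by (simp add: F)
    qed
    \<comment> \<open>As \<open>\<mu> (\<phi> m) = m\<close>, this forces
      \<open>P m = 0\<close>.\<close>
    finally have "\<mu> (\<phi> m) = P m + m"
      using m by (simp add: flinD[OF graded_flin[OF mu]] P_fmod mu_unit bh m_def)
    then show ?thesis using False mu_phi[OF m] by (simp add: m_def)
  qed
qed

text \<open>By \<open>P_mu\<close> only the terms \<open>e \<otimes> y\<close> of
  \<open>\<psi> h\<close> survive, and the left counit returns \<open>h\<close>.\<close>

lemma phi_mu:
  assumes b: "b \<in> fmod M" "\<nu> b = b \<otimes> bas e" and h: "h \<in> gens H"
  shows "\<phi> (\<mu> (b \<otimes> bas h)) = b \<otimes> bas h"
proof -
  have ps: "\<psi> (bas h) \<in> fmod (tensor_basis H H)" using psi_fmod h by simp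
  have fb: "flin H M (\<lambda>k. \<mu> (b \<otimes> k))"
    by (rule flin_comp[OF flin_tens_right[OF b(1)] graded_flin[OF mu]])
  have "\<phi> (\<mu> (b \<otimes> bas h)) = tmap H 0 (\<lambda>k. P (\<mu> (b \<otimes> k))) (\<lambda>y. y) (\<psi> (bas h))"
    using tmap0_comp0[OF fb flin_id(2) P_flin flin_id(2) ps] mu_coact[OF b h] by (simp add: \<phi>_def)
  also have "\<dots> = lin (\<lambda>(x, y). b \<otimes> (if x = e then bas y else 0)) (\<psi> (bas h))"
    unfolding tmap_eq by (rule lin_cong) (use fmod_keysD[OF ps] P_mu[OF b] in auto)
  also have "\<dots> = b \<otimes> bas h"
    using psi_left[OF h] by (simp add: tens_lin_right[symmetric] case_prod_unfold)
  finally show ?thesis .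
qed

definition coinv where "coinv = {x \<in> fmod M. \<nu> x = x \<otimes> bas e}"

text \<open>\<open>\<mu>\<close> is a left inverse, so \<open>\<phi>\<close> is injective. Its
  values lie in the span because each \<open>P0 x\<close> is coinvariant, and they exhaust it by
  \<open>phi_mu\<close>.\<close>

lemma bij_phi: "bij_betw \<phi> (fmod M) (sub_tensor coinv H)"
  unfolding bij_betw_def
proof
  show "inj_on \<phi> (fmod M)" using mu_phi by (metis inj_onI)
  show "\<phi> ` fmod M = sub_tensor coinv H"
  proof (intro equalityI subsetI)
    fix s assume "s \<in> \<phi> ` fmod M"
    then obtain p where p: "p \<in> fmod M" "s = \<phi> p" by blast
    have "P0 x \<otimes> bas y \<in> sub_tensor coinv H" if "x \<in> gens M" "y \<in> gens H" for x y
      unfolding sub_tensor_def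
      by (rule fm.span_base) (use that nu_P0 homog_fmod[OF homog_P0] in \<open>force simp: coinv_def\<close>)
    then show "s \<in> sub_tensor coinv H"
      using fmod_keysD[OF nu_fmod[OF p(1)]]
      by (auto simp: p(2) \<phi>_def tmap_eq lin_def[of _ "\<nu> p"] sub_tensor_def intro!: fm.span_sum fm.span_scale)
  next
    fix s assume s: "s \<in> sub_tensor coinv H"
    \<comment> \<open>The fixed points of \<open>\<phi> \<circ> \<mu>\<close> form a subspace, so it
      is enough that they contain the spanning tensors.\<close>
    let ?S = "{s \<in> fmod MH. \<phi> (\<mu> s) = s}"
    have fl: "flin MH MH (\<lambda>s. \<phi> (\<mu> s))" by (rule flin_comp[OF graded_flin[OF mu] phi_flin])
    have "fm.subspace ?S"
      using flinD[OF fl] flin_zero[OF fl] by (auto simp: fm.subspace_def)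
    moreover have "{b \<otimes> h |b h. b \<in> coinv \<and> h \<in> fmod H} \<subseteq> ?S"
    proof safe
      fix b and h :: "'h \<Rightarrow>\<^sub>0 'r" assume b: "b \<in> coinv" and h: "h \<in> fmod H"
      then have b': "b \<in> fmod M" "\<nu> b = b \<otimes> bas e" by (auto simp: coinv_def)
      then show "b \<otimes> h \<in> fmod MH" using h by simp
      show "\<phi> (\<mu> (b \<otimes> h)) = b \<otimes> h"
        by (rule flin_eqI[OF flin_comp[OF flin_tens_right[OF b'(1)] fl] flin_tens_right[OF b'(1)] _ h])
           (rule phi_mu[OF b'])
    qed
    ultimately have "s \<in> ?S" using s fm.span_minimal unfolding sub_tensor_def by blast
    then show "s \<in> \<phi> ` fmod M" using mu_fmod by force
  qed
qed

text \<open>Coassociativity of \<open>\<nu>\<close> with \<open>P\<close> applied to the first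
  factor.\<close>

lemma phi_comodule:
  assumes p: "p \<in> fmod M"
  shows "assoc (tmap M 0 \<phi> id (\<nu> p)) = tmap M 0 id \<psi> (\<phi> p)"
proof -
  note np = nu_fmod[OF p]
  have fl: "flin MH MH (tmap M 0 P id)" by (rule flin_tmap[OF P_flin flin_id(2)])
  have "tmap M 0 \<phi> id (\<nu> p) = tmap MH 0 (tmap M 0 P id) id (tmap M 0 \<nu> id (\<nu> p))"
    using tmap0_comp0[OF graded_flin[OF nu] flin_id(2) fl flin_id(2) np]
    by (simp add: \<phi>_def[abs_def] id_def)
  \<comment> \<open>The identity of \<open>H \<otimes> H\<close> is written as a tensor product of
    identities to fit \<open>assoc_tmap\<close>.\<close>
  also have "assoc \<dots> = tmap M 0 P (tmap H 0 id id) (assoc (tmap M 0 \<nu> id (\<nu> p)))"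
    by (rule assoc_tmap[OF P_flin flin_id(2) flin_id(2)])
       (rule flinD(1)[OF flin_tmap[OF graded_flin[OF nu] flin_id(2)] np])
  also have "\<dots> = tmap M 0 P (tmap H 0 id id) (tmap M 0 id \<psi> (\<nu> p))"
    using nu_coassoc[OF p] by simp
  also have "\<dots> = tmap M 0 P (\<lambda>q. tmap H 0 id id (\<psi> q)) (\<nu> p)"
    using tmap0_comp0[OF flin_id(2) graded_flin[OF psi] P_flin flin_tmap[OF flin_id(2) flin_id(2)] np] by simp
  also have "\<dots> = tmap M 0 P \<psi> (\<nu> p)"
    using np psi_fmod by (intro tmap_cong[where B = H]) (auto simp: id_def tmap0_id[of _ H H])
  also have "\<dots> = tmap M 0 id \<psi> (\<phi> p)"
    using tmap0_comp0[OF P_flin flin_id(2) flin_id(2) graded_flin[OF psi] np] by (simp add: \<phi>_def)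
  finally show ?thesis .
qed

text \<open>Since \<open>e\<close> has degree 0, the degree \<open>n\<close> component of
  \<open>p \<otimes> e\<close> is that of \<open>p\<close> tensor \<open>e\<close>; a
  degree-preserving \<open>\<nu>\<close> therefore respects the defining equation
  componentwise.\<close>

lemma coinv_submodule: "graded_submodule M coinv"
  unfolding graded_submodule_def
proof (intro conjI ballI allI)
  show "coinv \<subseteq> fmod M" by (auto simp: coinv_def)
  show "fm.subspace coinv"
    using flinD[OF graded_flin[OF nu]] flin_zero[OF graded_flin[OF nu]]
    by (auto simp: fm.subspace_def coinv_def)
  fix p n assume p: "p \<in> coinv"
  have "component M n p \<in> fmod M"
    using p unfolding component_def by (intro lin_in_fmod) (auto simp: coinv_def)
  moreover have "component MH n (p \<otimes> bas e) = component M n p \<otimes> bas e"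
    by (simp add: component_def lin_tens tens_lin_left if_distrib[of "\<lambda>q. q \<otimes> _"] cong: if_cong)
  ultimately show "component M n p \<in> coinv"
    using component_graded[OF nu, of p n] p by (simp add: coinv_def)
qed

end

subsection \<open>Tensor algebras with a path-like coaction\<close>

lemma tdif_bas: "tdif A B (bas (x, y)) = dif A (bas x) \<otimes> bas y + ks (int (deg A x)) \<odot> (bas x \<otimes> dif B (bas y))"
  by (simp add: tdif_def tmap_bas)

lemma tdif_linear [simp]:
  "tdif A B (p + q) = tdif A B p + tdif A B q" "tdif A B (a \<odot> p) = a \<odot> tdif A B p"
  "tdif A B 0 = 0" "tdif A B (- p) = - tdif A B p" "tdif A B (p - q) = tdif A B p - tdif A B q"
  by (simp_all add: tdif_def fm.scale_right_distrib)

lemma tdif_tens: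
  assumes "flin A A (dif A)" "flin B B (dif B)" "homog A n p" "q \<in> fmod B"
  shows "tdif A B (p \<otimes> q) = dif A p \<otimes> q + ks n \<odot> (p \<otimes> dif B q)"
  using tmap_tens[OF assms(1) flin_id(2) assms(3,4), of 0] tmap_tens[OF flin_id(2) assms(2-4), of 1]
  by (simp add: tdif_def)

lemma flin_tdif:
  "flin A A (dif A) \<Longrightarrow> flin B B (dif B) \<Longrightarrow> flin (tensor_basis A B) (tensor_basis A B) (tdif A B)"
  unfolding tdif_def[abs_def] by (intro flin_fun_add flin_tmap flin_id)

lemma tdif_tmap:
  assumes dif: "flin A A (dif A)" "flin B B (dif B)" "flin A' A' (dif A')" "flin B' B' (dif B')"
    and f: "graded_map 0 A A' f" and g: "flin B B' g"
    and df: "\<And>p. p \<in> fmod A \<Longrightarrow> f (dif A p) = dif A' (f p)"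
    and dg: "\<And>p. p \<in> fmod B \<Longrightarrow> g (dif B p) = dif B' (g p)"
    and t: "t \<in> fmod (tensor_basis A B)"
  shows "tmap A 0 f g (tdif A B t) = tdif A' B' (tmap A 0 f g t)"
proof -
  note fg = flin_tmap[OF graded_flin[OF f] g]
  show ?thesis
  proof (rule flin_eqI[OF flin_comp[OF flin_tdif[OF dif(1,2)] fg] flin_comp[OF fg flin_tdif[OF dif(3,4)]] _ t])
    fix w assume "w \<in> gens (tensor_basis A B)"
    then obtain x y where w: "w = (x, y)" "x \<in> gens A" "y \<in> gens B" by auto
    have "homog A' (int (deg A x)) (f (bas x))" using graded_bas[OF f w(2)] by simp
    then show "tmap A 0 f g (tdif A B (bas w)) = tdif A' B' (tmap A 0 f g (bas w))"
      using w by (simp add: tdif_bas tmap_bas tmap0_tens[OF graded_flin[OF f] g] flinD[OF dif(1)]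
          flinD[OF dif(2)] flinD[OF g] df dg tdif_tens[OF dif(3,4)])
  qed
qed

text \<open>\<open>f\<close> intertwines the coactions along the coalgebra map
  \<open>\<theta>\<close>, so coassociativity on its image comes from that of
  \<open>\<psi>'\<close>. \<open>f\<close> is merely linear, so this covers \<open>\<kappa>\<close>
  as well as \<open>\<iota>\<close> (with \<open>\<theta>\<close> the identity) and the inclusion of
  \<open>\<Omega>C'\<close>.\<close>

lemma coassoc_transfer:
  assumes f: "flin K M f" and th: "flin K H \<theta>" and ps: "flin H (tensor_basis H H) \<psi>"
    and ps': "flin K (tensor_basis K K) \<psi>'" and nu: "flin M (tensor_basis M H) \<nu>"
    and nuf: "\<And>p. p \<in> fmod K \<Longrightarrow> \<nu> (f p) = tmap K 0 f \<theta> (\<psi>' p)"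
    and ps'_assoc: "\<And>p. p \<in> fmod K \<Longrightarrow> assoc (tmap K 0 \<psi>' id (\<psi>' p)) = tmap K 0 id \<psi>' (\<psi>' p)"
    and th_psi: "\<And>p. p \<in> fmod K \<Longrightarrow> \<psi> (\<theta> p) = tmap K 0 \<theta> \<theta> (\<psi>' p)"
    and p: "p \<in> fmod K"
  shows "assoc (tmap M 0 \<nu> id (\<nu> (f p))) = tmap M 0 id \<psi> (\<nu> (f p))"
proof -
  note t = flinD(1)[OF ps' p]
  note ft = flin_tmap[OF f th]
  have "tmap M 0 \<nu> id (\<nu> (f p)) = tmap K 0 (\<lambda>p. \<nu> (f p)) \<theta> (\<psi>' p)"
    using tmap0_comp0[OF f th nu flin_id(2) t] by (simp add: nuf[OF p])
  also have "\<dots> = tmap K 0 (\<lambda>p. tmap K 0 f \<theta> (\<psi>' p)) (\<lambda>p. \<theta> (id p)) (\<psi>' p)"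
    using t by (intro tmap_cong[where B = K]) (auto simp: nuf)
  also have "\<dots> = tmap (tensor_basis K K) 0 (tmap K 0 f \<theta>) \<theta> (tmap K 0 \<psi>' id (\<psi>' p))"
    using tmap0_comp0[OF ps' flin_id(2) ft th t] by simp
  also have "assoc \<dots> = tmap K 0 f (tmap K 0 \<theta> \<theta>) (assoc (tmap K 0 \<psi>' id (\<psi>' p)))"
    by (rule assoc_tmap[OF f th th flinD(1)[OF flin_tmap[OF ps' flin_id(2)] t]])
  also have "\<dots> = tmap K 0 (\<lambda>p. f (id p)) (\<lambda>p. tmap K 0 \<theta> \<theta> (\<psi>' p)) (\<psi>' p)"
    unfolding ps'_assoc[OF p] by (rule tmap0_comp0[OF flin_id(2) ps' f flin_tmap[OF th th] t])
  also have "\<dots> = tmap K 0 (\<lambda>p. id (f p)) (\<lambda>p. \<psi> (\<theta> p)) (\<psi>' p)"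
    using t by (intro tmap_cong[where B = K]) (auto simp: th_psi)
  also have "\<dots> = tmap M 0 id \<psi> (\<nu> (f p))"
    unfolding nuf[OF p] by (rule tmap0_comp0[OF f th flin_id(2) ps t, symmetric])
  finally show ?thesis .
qed

text \<open>The map \<open>1 \<otimes> \<epsilon>\<close>, where \<open>\<epsilon>\<close> reads off
  the coefficient at \<open>e\<close>; in tensor algebras \<open>e\<close> is the empty
  word.\<close>

definition cut_right :: "'h \<Rightarrow> ('z \<times> 'h \<Rightarrow>\<^sub>0 'r::comm_ring_1) \<Rightarrow> ('z \<Rightarrow>\<^sub>0 'r)"
  where "cut_right e = lin (\<lambda>(x, y). if y = e then bas x else 0)"

definition cut_left :: "'h \<Rightarrow> ('h \<times> 'z \<Rightarrow>\<^sub>0 'r::comm_ring_1) \<Rightarrow> ('z \<Rightarrow>\<^sub>0 'r)"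
  where "cut_left e = lin (\<lambda>(x, y). if x = e then bas y else 0)"

lemma cut_right_linear [simp]:
  "cut_right e (p + q) = cut_right e p + cut_right e q" "cut_right e (a \<odot> p) = a \<odot> cut_right e p"
  "cut_right e 0 = 0" "cut_right e (- p) = - cut_right e p" "cut_right e (p - q) = cut_right e p - cut_right e q"
  by (simp_all add: cut_right_def)

lemma cut_left_linear [simp]:
  "cut_left e (p + q) = cut_left e p + cut_left e q" "cut_left e (a \<odot> p) = a \<odot> cut_left e p"
  "cut_left e 0 = 0" "cut_left e (- p) = - cut_left e p" "cut_left e (p - q) = cut_left e p - cut_left e q"
  by (simp_all add: cut_left_def)

lemma cut_right_bas [simp]:
  "cut_right e (bas (x, y)) = (if y = e then bas x else 0)"
  by (simp add: cut_right_def)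

lemma cut_left_bas [simp]:
  "cut_left e (bas (x, y)) = (if x = e then bas y else 0)"
  by (simp add: cut_left_def)

lemma flin_cut_right: "flin (tensor_basis A B) A (cut_right e)"
  unfolding cut_right_def by (rule flin_lin) auto

lemma flin_cut_left: "flin (tensor_basis A B) B (cut_left e)"
  unfolding cut_left_def by (rule flin_lin) auto

lemma cut_right_tens: "cut_right e (p \<otimes> q) = lookup q e \<odot> p"
proof (induction p rule: fmod_UNIV_induct)
  case (bas x)
  show ?case by (induction q rule: fmod_UNIV_induct) (auto simp: lookup_add lookup_single fm.scale_left_distrib)
qed (auto simp: fm.scale_right_distrib mult.commute)

lemma cut_left_tens: "cut_left e (p \<otimes> q) = lookup p e \<odot> q"
proof (induction q rule: fmod_UNIV_induct)
  case (bas x)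
  show ?case by (induction p rule: fmod_UNIV_induct) (auto simp: lookup_add lookup_single fm.scale_left_distrib)
qed (auto simp: fm.scale_right_distrib mult.commute)

lemma cut_right_tmap:
  assumes f: "flin A A' f" and g: "flin B B' g"
    and ge: "\<And>y. y \<in> gens B \<Longrightarrow> lookup (g (bas y)) e' = (if y = e then 1 else 0)"
    and t: "t \<in> fmod (tensor_basis A B)"
  shows "cut_right e' (tmap A 0 f g t) = f (cut_right e t)"
  by (rule flin_eqI[OF flin_comp[OF flin_tmap[OF f g] flin_cut_right] flin_comp[OF flin_cut_right f] _ t])
     (auto simp: tmap_bas cut_right_tens ge flin_zero[OF f])

lemma cut_left_tmap:
  assumes f: "flin A A' f" and g: "flin B B' g"
    and fe: "\<And>x. x \<in> gens A \<Longrightarrow> lookup (f (bas x)) e' = (if x = e then 1 else 0)"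
    and t: "t \<in> fmod (tensor_basis A B)"
  shows "cut_left e' (tmap A 0 f g t) = g (cut_left e t)"
  by (rule flin_eqI[OF flin_comp[OF flin_tmap[OF f g] flin_cut_left] flin_comp[OF flin_cut_left g] _ t])
     (auto simp: tmap_bas cut_left_tens fe flin_zero[OF g])

text \<open>A concatenation is empty only if both words are, and the empty word has degree 0, so no
  sign arises in the surviving terms.\<close>

lemma alg_hom_cut_right:
  "alg_hom (tensor_alg (tensor_algebra V \<delta>) (tensor_algebra W \<epsilon>)) (tensor_algebra V \<delta>) (cut_right [])"
  (is "alg_hom ?T ?A _")
  unfolding alg_hom_def
proof (intro conjI alg_morI graded_alg_tensor graded_alg_tensor_algebra)
  show "graded_map 0 ?T ?A (cut_right [])"
    unfolding cut_right_def by (rule graded_lin) auto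
  then show "flin ?T ?A (cut_right [])" by (rule graded_flin)
qed (auto simp: mult_tensor_bas)

lemma alg_hom_cut_left:
  "alg_hom (tensor_alg (tensor_algebra V \<delta>) (tensor_algebra W \<epsilon>)) (tensor_algebra W \<epsilon>) (cut_left [])"
  (is "alg_hom ?T ?A _")
  unfolding alg_hom_def
proof (intro conjI alg_morI graded_alg_tensor graded_alg_tensor_algebra)
  show "graded_map 0 ?T ?A (cut_left [])"
    unfolding cut_left_def by (rule graded_lin) auto
  then show "flin ?T ?A (cut_left [])" by (rule graded_flin)
qed (auto simp: mult_tensor_bas)

text \<open>
  \<open>H' = T V'\<close> contains the algebra \<open>H = T V\<close> through \<open>i\<close>; the generators outside the image of \<open>i\<close>
  are the \<open>j x = -\<kappa> x\<close> and further ones, on which the required identities are assumed.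
\<close>

locale path_ext =
  fixes V :: "('x, 'm) graded_basis_scheme" and \<delta> :: "'x \<Rightarrow> ('x list \<Rightarrow>\<^sub>0 'r::comm_ring_1)"
    and \<psi> :: "('x list \<Rightarrow>\<^sub>0 'r) \<Rightarrow> ('x list \<times> 'x list \<Rightarrow>\<^sub>0 'r)"
    and V' :: "('v, 'n) graded_basis_scheme" and \<delta>' :: "'v \<Rightarrow> ('v list \<Rightarrow>\<^sub>0 'r)"
    and \<nu> :: "('v list \<Rightarrow>\<^sub>0 'r) \<Rightarrow> ('v list \<times> 'x list \<Rightarrow>\<^sub>0 'r)"
    and i :: "'x \<Rightarrow> 'v" and j :: "'x \<Rightarrow> 'v"
  fixes H H' \<iota> \<kappa>
  assumes H_def: "H = tensor_algebra V \<delta>" and H'_def: "H' = tensor_algebra V' \<delta>'"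
    and \<iota>_def: "\<iota> = wmap i" and \<kappa>_def: "\<kappa> = der_ext V i (\<lambda>x. - bas [j x])"
    and pos: "x \<in> gens V \<Longrightarrow> 0 < deg V x"
    and psi: "alg_hom H (tensor_alg H H) \<psi>"
    and psi_assoc: "p \<in> fmod H \<Longrightarrow> assoc (tmap H 0 \<psi> id (\<psi> p)) = tmap H 0 id \<psi> (\<psi> p)"
    and psi_right: "p \<in> fmod H \<Longrightarrow> cut_right [] (\<psi> p) = p"
    and psi_left: "p \<in> fmod H \<Longrightarrow> cut_left [] (\<psi> p) = p"
    and dH: "x \<in> gens V \<Longrightarrow> homog H (int (deg V x) - 1) (\<delta> x)"
    and psi_dif: "p \<in> fmod H \<Longrightarrow> \<psi> (dif H p) = tdif H H (\<psi> p)"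
    and nu: "alg_hom H' (tensor_alg H' H) \<nu>"
    and i: "x \<in> gens V \<Longrightarrow> i x \<in> gens V' \<and> deg V' (i x) = deg V x"
    and j: "x \<in> gens V \<Longrightarrow> j x \<in> gens V' \<and> int (deg V' (j x)) = int (deg V x) - 1"
    and dH': "z \<in> gens V' \<Longrightarrow> homog H' (int (deg V' z) - 1) (\<delta>' z)"
    and d_i: "x \<in> gens V \<Longrightarrow> \<delta>' (i x) = \<iota> (\<delta> x) + bas [j x]"
    and d_j: "x \<in> gens V \<Longrightarrow> \<delta>' (j x) = \<kappa> (\<delta> x)"
    and nu_i: "x \<in> gens V \<Longrightarrow> \<nu> (bas [i x]) = tmap H 0 \<iota> id (\<psi> (bas [x]))"
    and nu_j: "x \<in> gens V \<Longrightarrow> \<nu> (bas [j x]) = - tmap H 0 \<kappa> id (\<psi> (bas [x]))"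
    and others: "z \<in> gens V' \<Longrightarrow> z \<notin> i ` gens V \<Longrightarrow> z \<notin> j ` gens V \<Longrightarrow>
        assoc (tmap H' 0 \<nu> id (\<nu> (bas [z]))) = tmap H' 0 id \<psi> (\<nu> (bas [z])) \<and>
        cut_right [] (\<nu> (bas [z])) = bas [z] \<and>
        \<nu> (\<delta>' z) = tdif H' H (\<nu> (bas [z]))"
begin

lemma algs: "graded_alg H" "graded_alg H'" "graded_alg (tensor_alg H H)" "graded_alg (tensor_alg H' H)"
  "graded_alg (tensor_alg H' (tensor_alg H H))" "graded_alg (tensor_alg (tensor_alg H' H) H)"
  unfolding H_def H'_def by (intro graded_alg_tensor graded_alg_tensor_algebra)+

lemma H_simps [simp]:
  "gens H = lists (gens V)" "deg H w = sum_list (map (deg V) w)" "mult H = wmult" "munit H = bas []"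
  "gens H' = lists (gens V')" "deg H' u = sum_list (map (deg V') u)" "mult H' = wmult" "munit H' = bas []"
  by (simp_all add: H_def H'_def)

lemma dif_gen: "dif H (bas [x]) = \<delta> x" "dif H' (bas [z]) = \<delta>' z"
  by (simp_all add: H_def H'_def)

lemma iota_hom: "alg_hom H H' \<iota>"
  unfolding H_def H'_def \<iota>_def by (rule alg_hom_wmap) (rule i)

lemma kappa_deriv: "deriv H H' \<iota> \<kappa>"
  unfolding H_def H'_def \<iota>_def \<kappa>_def by (rule deriv_der_ext[OF i]) (auto simp: j)

lemma dif_deriv: "deriv H H (\<lambda>p. p) (dif H)"
  unfolding H_def by (rule tensor_algebra_dif_deriv) (use dH in \<open>simp add: H_def\<close>)

lemma dif'_deriv: "deriv H' H' (\<lambda>p. p) (dif H')"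
  unfolding H'_def by (rule tensor_algebra_dif_deriv) (use dH' in \<open>simp add: H'_def\<close>)

lemmas H_eqI = alg_mor_eqI[where V = V and \<delta> = \<delta>, folded H_def]
lemmas H'_eqI = alg_mor_eqI[where V = V' and \<delta> = \<delta>', folded H'_def]
lemmas H_deriv_eqI = deriv_eqI[where V = V and \<delta> = \<delta>, folded H_def]
lemmas H'_deriv_eqI = deriv_eqI[where V = V' and \<delta> = \<delta>', folded H'_def]

lemmas psi_flin = alg_homD(2)[OF psi, simplified]
lemmas nu_flin = alg_homD(2)[OF nu, simplified]
lemmas iota_flin = alg_homD(2)[OF iota_hom]
lemmas kappa_flin = deriv_flin[OF kappa_deriv]

lemma iota_gen [simp]: "\<iota> (bas w) = bas (map i w)"
  by (simp add: \<iota>_def)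

lemma kappa_gen [simp]: "\<kappa> (bas [x]) = - bas [j x]"
  by (simp add: \<kappa>_def)

lemma nu_iota:
  assumes "p \<in> fmod H" shows "\<nu> (\<iota> p) = tmap H 0 \<iota> id (\<psi> p)"
proof -
  have "alg_mor H (tensor_alg H' H) (\<lambda>p. \<nu> (\<iota> p))"
    by (rule alg_mor_comp[OF alg_homD(1)[OF iota_hom] alg_homD(1)[OF nu]])
  moreover have "alg_hom (tensor_alg H H) (tensor_alg H' H) (tmap H 0 \<iota> id)"
    using alg_hom_tmap[OF algs(1,2,1,1) iota_hom alg_hom_id] by (simp add: id_def)
  then have "alg_mor H (tensor_alg H' H) (\<lambda>p. tmap H 0 \<iota> id (\<psi> p))"
    by (rule alg_mor_comp[OF alg_homD(1)[OF psi] alg_homD(1)])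
  ultimately show ?thesis
    by (rule H_eqI[OF _ _ _ assms]) (simp add: nu_i)
qed

text \<open>By \<open>nu_iota\<close> both sides are derivations along the same algebra map, and
  \<open>nu_j\<close> is their agreement on letters.\<close>

lemma nu_kappa:
  assumes "p \<in> fmod H" shows "\<nu> (\<kappa> p) = tmap H 0 \<kappa> id (\<psi> p)"
proof -
  have 1: "deriv H (tensor_alg H' H) (\<lambda>p. \<nu> (\<iota> p)) (\<lambda>p. \<nu> (\<kappa> p))"
    by (rule deriv_comp_hom[OF algs(1,2) iota_flin kappa_deriv nu])
  have "deriv (tensor_alg H H) (tensor_alg H' H) (tmap H 0 \<iota> (\<lambda>p. p)) (tmap H 0 \<kappa> (\<lambda>p. p))"
    by (rule deriv_tmap_left[OF algs(1,2,1,1) iota_hom kappa_deriv alg_hom_id])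
  then have 2: "deriv H (tensor_alg H' H) (\<lambda>p. tmap H 0 \<iota> id (\<psi> p)) (\<lambda>p. tmap H 0 \<kappa> id (\<psi> p))"
    unfolding tmap_id_right using flin_tmap[OF iota_flin flin_id(1)]
    by (intro hom_comp_deriv[OF algs(1,3,4) _ _ psi, where f = "tmap H 0 \<iota> (\<lambda>p. p)" and D = "tmap H 0 \<kappa> (\<lambda>p. p)"]) simp_all
  show ?thesis
    by (rule H_deriv_eqI[OF algs(4) 1 2 _ _ assms])
       (use nu_iota flinD[OF nu_flin] flin_uminus_app[OF nu_flin] in \<open>simp_all add: nu_j j\<close>)
qed

text \<open>Presenting \<open>j x\<close> as a value of \<open>\<kappa>\<close> lets the identities
  for \<open>\<iota>\<close> and \<open>\<kappa>\<close> on all of \<open>H\<close> be quoted for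
  letters.\<close>

lemma generator_cases [consumes 1, case_names i j other]:
  assumes "z \<in> gens V'"
  obtains x where "x \<in> gens V" "bas [z] = \<iota> (bas [x])"
  | x where "x \<in> gens V" "bas [z] = \<kappa> (- bas [x])"
  | "z \<notin> i ` gens V" "z \<notin> j ` gens V"
proof (cases "z \<in> i ` gens V \<or> z \<in> j ` gens V")
  case True
  then show ?thesis
  proof
    assume "z \<in> j ` gens V"
    then obtain x where x: "x \<in> gens V" "z = j x" by blast
    then have "\<kappa> (- bas [x]) = bas [z]" using flin_uminus_app[OF kappa_flin, of "bas [x]"] by simp
    then show ?thesis using that(2)[OF x(1)] by simp
  qed (use that(1) in auto)
qed (use that(3) in blast)

text \<open>Both sides are algebra maps. On the letters \<open>i x\<close> and \<open>j x\<close>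
  the claim is transferred from \<open>\<psi>\<close> along \<open>\<iota>\<close> and
  \<open>\<kappa>\<close>.\<close>

lemma nu_coassoc:
  assumes p: "p \<in> fmod H'"
  shows "assoc (tmap H' 0 \<nu> id (\<nu> p)) = tmap H' 0 id \<psi> (\<nu> p)"
proof -
  have "alg_hom (tensor_alg H' H) (tensor_alg (tensor_alg H' H) H) (tmap H' 0 \<nu> id)"
    using alg_hom_tmap[OF algs(2,4,1,1) nu alg_hom_id] by (simp add: id_def)
  then have "alg_hom H' (tensor_alg (tensor_alg H' H) H) (\<lambda>p. tmap H' 0 \<nu> id (\<nu> p))"
    by (rule alg_hom_comp[OF nu])
  then have 1: "alg_hom H' (tensor_alg H' (tensor_alg H H)) (\<lambda>p. assoc (tmap H' 0 \<nu> id (\<nu> p)))"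
    by (rule alg_hom_comp[OF _ alg_hom_assoc[OF algs(2,1,1)]])
  have "alg_hom (tensor_alg H' H) (tensor_alg H' (tensor_alg H H)) (tmap H' 0 id \<psi>)"
    using alg_hom_tmap[OF algs(2,2,1,3) alg_hom_id psi] by (simp add: id_def)
  then have 2: "alg_hom H' (tensor_alg H' (tensor_alg H H)) (\<lambda>p. tmap H' 0 id \<psi> (\<nu> p))"
    by (rule alg_hom_comp[OF nu])
  have th: "\<psi> (id p) = tmap H 0 id id (\<psi> p)" if "p \<in> fmod H" for p
    using tmap0_id[OF flinD(1)[OF psi_flin that]] by (simp add: id_def)
  note tr = coassoc_transfer[OF _ flin_id(2) psi_flin psi_flin nu_flin _ psi_assoc th]
  show ?thesis
  proof (rule H'_eqI[OF alg_homD(1)[OF 1] alg_homD(1)[OF 2] _ p])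
    fix z assume z: "z \<in> gens V'"
    then show "assoc (tmap H' 0 \<nu> id (\<nu> (bas [z]))) = tmap H' 0 id \<psi> (\<nu> (bas [z]))"
    proof (cases rule: generator_cases)
      case (i x)
      then show ?thesis using tr[OF iota_flin nu_iota, of "bas [x]"] by simp
    next
      case (j x)
      then show ?thesis using tr[OF kappa_flin nu_kappa, of "- bas [x]"] by simp
    qed (use others[OF z] in blast)
  qed
qed

lemma sum_deg_zero: "w \<in> lists (gens V) \<Longrightarrow> sum_list (map (deg V) w) = 0 \<longleftrightarrow> w = []"
  using pos by (cases w) force+



lemma nu_counit:
  assumes p: "p \<in> fmod H'"
  shows "cut_right [] (\<nu> p) = p"
proof -
  have 1: "alg_mor H' H' (\<lambda>p. cut_right [] (\<nu> p))"
    using alg_mor_comp[OF alg_homD(1)[OF nu]] alg_homD(1)[OF alg_hom_cut_right]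
    unfolding H_def H'_def by blast
  have l: "lookup (id (bas y)) [] = (if y = [] then 1 else 0)" for y :: "'x list"
    by (simp add: lookup_single)
  show ?thesis
  proof (rule H'_eqI[OF 1 alg_homD(1)[OF alg_hom_id] _ p])
    fix z assume z: "z \<in> gens V'"
    then show "cut_right [] (\<nu> (bas [z])) = bas [z]"
    proof (cases rule: generator_cases)
      case (i x)
      have x: "bas [x] \<in> fmod H" using i by simp
      show ?thesis
        using cut_right_tmap[OF iota_flin flin_id(2) l flinD(1)[OF psi_flin x]] psi_right[OF x] nu_iota[OF x]
        by (simp only: i)
    next
      case (j x)
      have x: "- bas [x] \<in> fmod H" using j by simp
      show ?thesis
        using cut_right_tmap[OF kappa_flin flin_id(2) l flinD(1)[OF psi_flin x]] psi_right[OF x] nu_kappa[OF x]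
        by (simp only: j)
    qed (use others[OF z] in blast)
  qed
qed

lemma dif_iota:
  assumes "p \<in> fmod H" shows "dif H' (\<iota> p) = \<iota> (dif H p) - \<kappa> p"
proof -
  have 1: "deriv H H' \<iota> (\<lambda>p. dif H' (\<iota> p))"
    by (rule hom_comp_deriv[OF algs(1,2,2) flin_id(1) dif'_deriv iota_hom])
  have 2: "deriv H H' \<iota> (\<lambda>p. \<iota> (dif H p) - \<kappa> p)"
    by (intro deriv_diff algs kappa_deriv deriv_comp_hom[OF algs(1,1) flin_id(1) dif_deriv iota_hom])
  show ?thesis
    by (rule H_deriv_eqI[OF algs(2) 1 2 _ _ assms]) (simp_all add: dif_gen d_i)
qed

text \<open>\<open>d\<kappa> + \<kappa>d\<close> has degree -2 and is no \<open>deriv\<close>, so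
  \<open>deriv_eqI\<close> does not apply; instead both Leibniz rules are expanded along the
  word.\<close>

lemma dif_kappa_word: "w \<in> lists (gens V) \<Longrightarrow> dif H' (\<kappa> (bas w)) + \<kappa> (dif H (bas w)) = 0"
proof (induction w)
  case Nil
  show ?case
    using deriv_munit[OF algs(1) kappa_deriv] deriv_munit[OF algs(1) dif_deriv]
      flin_zero[OF kappa_flin] flin_zero[OF deriv_flin[OF dif'_deriv]] by simp
next
  case (Cons x w)
  let ?s = "ks (int (deg V x)) :: 'r"
  have x: "homog H (int (deg V x)) (bas [x])" and w: "bas w \<in> fmod H" using Cons by auto
  note xf = homog_fmod[OF x]
  have hk: "homog H' (int (deg V x) - 1) (\<kappa> (bas [x]))"
    using graded_homog[OF deriv_graded[OF kappa_deriv] x] by simp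
  have hi: "homog H' (int (deg V x)) (\<iota> (bas [x]))"
    using graded_homog[OF alg_homD(3)[OF iota_hom] x] by simp
  have hd: "homog H (int (deg V x) - 1) (dif H (bas [x]))"
    using graded_homog[OF deriv_graded[OF dif_deriv] x] by simp
  have s1: "ks (int (deg V x) - 1) = - ?s" by (simp add: ks_def)
  note kf = flinD[OF kappa_flin] and df = flinD[OF deriv_flin[OF dif_deriv]]
    and df' = flinD[OF deriv_flin[OF dif'_deriv]] and iof = flinD[OF iota_flin]
  note mf = mult_fmod[OF algs(1), simplified] mult_fmod[OF algs(2), simplified]
  note K = deriv_mult[OF algs(1,2) iota_flin kappa_deriv, simplified]
    and D' = deriv_mult[OF algs(2,2) flin_id(1) dif'_deriv, simplified]
    and D = deriv_mult[OF algs(1,1) flin_id(1) dif_deriv, simplified]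
  define kx kw ix iw dx dw where "kx = \<kappa> (bas [x])" "kw = \<kappa> (bas w)" "ix = \<iota> (bas [x])" "iw = \<iota> (bas w)"
    "dx = dif H (bas [x])" "dw = dif H (bas w)"
  note defs = this
  have a: "\<kappa> (bas [x] \<star> bas w) = kx \<star> iw + ?s \<odot> (ix \<star> kw)"
    unfolding defs by (rule K[OF x w])
  have b: "dif H (bas [x] \<star> bas w) = dx \<star> bas w + ?s \<odot> (bas [x] \<star> dw)"
    unfolding defs by (rule D[OF x w])
  have c: "dif H' (kx \<star> iw) = dif H' kx \<star> iw - ?s \<odot> (kx \<star> dif H' iw)"
    unfolding defs using D'[OF hk iof(1)[OF w]] by (simp add: s1)
  have d: "dif H' (ix \<star> kw) = dif H' ix \<star> kw + ?s \<odot> (ix \<star> dif H' kw)"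
    unfolding defs by (rule D'[OF hi kf(1)[OF w]])
  have e: "\<kappa> (dx \<star> bas w) = \<kappa> dx \<star> iw - ?s \<odot> (\<iota> dx \<star> kw)"
    unfolding defs using K[OF hd w] by (simp add: s1)
  have f: "\<kappa> (bas [x] \<star> dw) = kx \<star> \<iota> dw + ?s \<odot> (ix \<star> \<kappa> dw)"
    unfolding defs by (rule K[OF x df(1)[OF w]])
  \<comment> \<open>The correction terms produce \<open>kx \<star> kw\<close> twice, with opposite
    signs.\<close>
  have g: "dif H' iw = \<iota> dw - kw" "dif H' ix = \<iota> dx - kx"
    unfolding defs using dif_iota[OF w] dif_iota[OF xf] by simp_all
  have h: "dif H' kw = - \<kappa> dw" "dif H' kx = - \<kappa> dx"
  proof -
    show "dif H' kw = - \<kappa> dw"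
      using Cons unfolding defs by (simp add: eq_neg_iff_add_eq_0)
    show "dif H' kx = - \<kappa> dx"
      using Cons j[of x] flin_uminus_app[OF deriv_flin[OF dif'_deriv], of "bas [j x]"]
      unfolding defs by (simp add: dif_gen d_j)
  qed
  have fm: "kx \<in> fmod H'" "kw \<in> fmod H'" "ix \<in> fmod H'" "iw \<in> fmod H'" "dx \<in> fmod H" "dw \<in> fmod H"
    unfolding defs by (intro kf(1) iof(1) df(1) w xf)+
  have m1: "dif H' (\<kappa> (bas [x] \<star> bas w)) = dif H' (kx \<star> iw) + ?s \<odot> dif H' (ix \<star> kw)"
    using mf(2)[OF fm(1,4)] mf(2)[OF fm(3,2)] by (simp only: a df' fmod_simps)
  have m2: "\<kappa> (dif H (bas [x] \<star> bas w)) = \<kappa> (dx \<star> bas w) + ?s \<odot> \<kappa> (bas [x] \<star> dw)"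
    using mf(1)[OF fm(5) w] mf(1)[OF xf fm(6)] by (simp only: b kf fmod_simps)
  have "dif H' (\<kappa> (bas [x] \<star> bas w)) + \<kappa> (dif H (bas [x] \<star> bas w)) = 0"
    unfolding m1 m2 by (simp add: c d e f g h fm.scale_right_distrib fm.scale_right_diff_distrib algebra_simps)
  then show ?case by simp
qed

lemma dif_kappa:
  assumes "p \<in> fmod H" shows "dif H' (\<kappa> p) = - \<kappa> (dif H p)"
  by (rule flin_eqI[OF flin_comp[OF kappa_flin deriv_flin[OF dif'_deriv]]
        flin_fun_uminus[OF flin_comp[OF deriv_flin[OF dif_deriv] kappa_flin]] _ assms])
     (use dif_kappa_word in \<open>simp add: eq_neg_iff_add_eq_0\<close>)

text \<open>Both sides are derivations along \<open>\<nu>\<close>. On \<open>i x\<close> the defect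
  \<open>- \<kappa>\<close> of \<open>\<iota>\<close> appears on both sides, since
  \<open>\<nu>\<kappa> = (\<kappa> \<otimes> 1)\<psi>\<close>.\<close>

lemma nu_dif:
  assumes p: "p \<in> fmod H'"
  shows "\<nu> (dif H' p) = tdif H' H (\<nu> p)"
proof -
  have 1: "deriv H' (tensor_alg H' H) (\<lambda>p. \<nu> p) (\<lambda>p. \<nu> (dif H' p))"
    by (rule deriv_comp_hom[OF algs(2,2) flin_id(1) dif'_deriv nu])
  have 2: "deriv H' (tensor_alg H' H) (\<lambda>p. \<nu> p) (\<lambda>p. tdif H' H (\<nu> p))"
    by (rule hom_comp_deriv[OF algs(2,4,4) flin_id(1) deriv_tdif[OF algs(2,1) dif'_deriv dif_deriv] nu])
  note dfl = deriv_flin[OF dif_deriv] and dfl' = deriv_flin[OF dif'_deriv]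
  note tfl = flin_tdif[OF dfl dfl] and tfl' = flin_tdif[OF dfl' dfl]
  note til = flin_tmap[OF iota_flin flin_id(2)] and tkl = flin_tmap[OF kappa_flin flin_id(2)]
  have I: "tmap H 0 \<iota> id (tdif H H t) - tmap H 0 \<kappa> id t = tdif H' H (tmap H 0 \<iota> id t)"
    if "t \<in> fmod (tensor_basis H H)" for t
  proof (rule flin_eqI[OF flin_fun_diff[OF flin_comp[OF tfl til] tkl] flin_comp[OF til tfl'] _ that])
    fix w assume "w \<in> gens (tensor_basis H H)"
    then obtain x y where w: "w = (x, y)" "x \<in> gens H" "y \<in> gens H" by auto
    have h: "homog H' (int (deg H x)) (\<iota> (bas x))"
      using graded_bas[OF alg_homD(3)[OF iota_hom] w(2)] by simp
    show "tmap H 0 \<iota> id (tdif H H (bas w)) - tmap H 0 \<kappa> id (bas w) = tdif H' H (tmap H 0 \<iota> id (bas w))"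
      using w tdif_tens[OF dfl' dfl h, of "bas y"] tmap0_tens[OF iota_flin flin_id(2), of "dif H (bas x)" "bas y" H]
        tmap0_tens[OF iota_flin flin_id(2), of "bas x" "dif H (bas y)" H]
        dif_iota[of "bas x"]
      by (simp add: w tdif_bas tmap_bas flinD[OF dfl] del: iota_gen)
  qed
  \<comment> \<open>The differential of the second factor passes \<open>\<kappa> x\<close>, of
    degree \<open>|x| - 1\<close>; so both summands of \<open>tdif\<close> acquire the minus
    sign.\<close>
  have K: "- tmap H 0 \<kappa> id (tdif H H t) = tdif H' H (tmap H 0 \<kappa> id t)"
    if "t \<in> fmod (tensor_basis H H)" for t
  proof (rule flin_eqI[OF flin_fun_uminus[OF flin_comp[OF tfl tkl]] flin_comp[OF tkl tfl'] _ that])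
    fix w assume "w \<in> gens (tensor_basis H H)"
    then obtain x y where w: "w = (x, y)" "x \<in> gens H" "y \<in> gens H" by auto
    have h: "homog H' (int (deg H x) - 1) (\<kappa> (bas x))"
      using graded_bas[OF deriv_graded[OF kappa_deriv] w(2)] by simp
    have s: "ks (int (deg H x) - 1) = - (ks (int (deg H x)) :: 'r)" by (simp add: ks_def)
    show "- tmap H 0 \<kappa> id (tdif H H (bas w)) = tdif H' H (tmap H 0 \<kappa> id (bas w))"
      using w tdif_tens[OF dfl' dfl h, of "bas y"] tmap0_tens[OF kappa_flin flin_id(2), of "dif H (bas x)" "bas y" H]
        tmap0_tens[OF kappa_flin flin_id(2), of "bas x" "dif H (bas y)" H]
        dif_kappa[of "bas x"] s
      by (simp add: w tdif_bas tmap_bas flinD[OF dfl] del: H_simps(2))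
  qed
  show ?thesis
  proof (rule H'_deriv_eqI[OF algs(4) 1 2 _ _ p])
    fix z assume z: "z \<in> gens V'"
    then show "\<nu> (dif H' (bas [z])) = tdif H' H (\<nu> (bas [z]))"
    proof (cases rule: generator_cases)
      case (i x)
      have x: "bas [x] \<in> fmod H" using i by simp
      note dx = flinD(1)[OF dfl x]
      have "\<nu> (dif H' (\<iota> (bas [x]))) = \<nu> (\<iota> (dif H (bas [x]))) - \<nu> (\<kappa> (bas [x]))"
        unfolding dif_iota[OF x]
        by (rule flin_diff_app[OF nu_flin flinD(1)[OF iota_flin dx] flinD(1)[OF kappa_flin x]])
      then show ?thesis
        using I[OF flinD(1)[OF psi_flin x]]
        by (simp only: i nu_iota[OF x] nu_iota[OF dx] nu_kappa[OF x] psi_dif[OF x])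
    next
      case (j x)
      have x: "- bas [x] \<in> fmod H" using j by simp
      note dx = flinD(1)[OF dfl x]
      have "\<nu> (dif H' (\<kappa> (- bas [x]))) = - \<nu> (\<kappa> (dif H (- bas [x])))"
        unfolding dif_kappa[OF x]
        by (rule flin_uminus_app[OF nu_flin flinD(1)[OF kappa_flin dx]])
      then show ?thesis
        using K[OF flinD(1)[OF psi_flin x]]
        by (simp only: j nu_kappa[OF x] nu_kappa[OF dx] psi_dif[OF x])
    qed (use others[OF z] in \<open>simp add: dif_gen\<close>)
  qed simp
qed

section \<open>The action of \<open>H\<close> through \<open>\<iota>\<close> and the
  coinvariants\<close>

definition act where "act = lin (\<lambda>(u, w). bas u \<star> \<iota> (bas w))"

lemma act_tens: "act (p \<otimes> q) = p \<star> \<iota> q"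
proof -
  have "lin (\<lambda>v. bas (x @ map i v)) q = bas x \<star> \<iota> q" for x
    by (induction q rule: fmod_UNIV_induct) (simp_all add: \<iota>_def)
  then have "act (p \<otimes> q) = lin (\<lambda>u. bas u \<star> \<iota> q) p"
    by (simp add: act_def lin_tens)
  also have "\<dots> = p \<star> \<iota> q"
    by (induction p rule: fmod_UNIV_induct) simp_all
  finally show ?thesis .
qed

lemma graded_act: "graded_map 0 (tensor_basis H' H) H' act"
  unfolding act_def
proof (rule graded_lin)
  fix z assume "z \<in> gens (tensor_basis H' H)"
  then obtain u w where z: "z = (u, w)" and uw: "\<forall>x\<in>set u. x \<in> gens V'" "\<forall>x\<in>set w. x \<in> gens V"
    by (cases z) auto
  then have "map (deg V' \<circ> i) w = map (deg V) w" using i by simp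
  then have "sum_list (map (deg V' \<circ> i) w) = sum_list (map (deg V) w)" by (rule arg_cong)
  with uw show "homog H' (int (deg (tensor_basis H' H) z) + 0) (case z of (u, w) \<Rightarrow> bas u \<star> \<iota> (bas w))"
    using i by (auto simp: z)
qed

lemma mult_coinv:
  assumes b: "b \<in> fmod H'" and t: "t \<in> fmod (tensor_basis H' H)"
  shows "mult (tensor_alg H' H) (b \<otimes> bas []) t = tmap H' 0 (\<lambda>k. b \<star> k) id t"
  using t
proof (induction rule: fmod_induct)
  case (bas w)
  obtain x y where w: "w = (x, y)" "x \<in> gens H'" "y \<in> gens H" using bas by auto
  have "homog H 0 (bas [])" by simp
  from mult_tensor_tens[OF algs(2,1) b this homog_bas'[OF w(2)], of "bas y"] w show ?case
    by (simp add: tmap_bas)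
qed (auto simp: mult_tensor_linear)

definition coinvariants where "coinvariants = {x \<in> fmod H'. \<nu> x = x \<otimes> bas []}"

text \<open>The compatibility on coinvariants is multiplicativity of \<open>\<nu>\<close>:
  \<open>\<nu>(b \<star> \<iota> h)\<close> is \<open>(b \<otimes> 1)\<close> times
  \<open>(\<iota> \<otimes> 1)\<psi>(h)\<close>.\<close>

lemma hopf_module: "hopf_module H' H [] \<nu> \<psi> act"
proof
  show "{h \<in> gens H. deg H h = 0} = {[]}" using sum_deg_zero by auto
  show "graded_map 0 H' (tensor_basis H' H) \<nu>" "graded_map 0 H (tensor_basis H H) \<psi>"
    using alg_homD(3)[OF nu] alg_homD(3)[OF psi] by simp_all
  show "graded_map 0 (tensor_basis H' H) H' act" by (rule graded_act)
  show "\<psi> (bas []) = bas ([], [])" using alg_homD(4)[OF psi] by simp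
  show "lin (\<lambda>(x, y). if y = [] then bas x else 0) (\<nu> p) = p" if "p \<in> fmod H'" for p
    using nu_counit[OF that] by (simp add: cut_right_def)
  show "lin (\<lambda>(x, y). if y = [] then bas x else 0) (\<psi> (bas h)) = bas h" if "h \<in> gens H" for h
    using psi_right[of "bas h"] that by (simp add: cut_right_def)
  show "lin (\<lambda>(x, y). if x = [] then bas y else 0) (\<psi> (bas h)) = bas h" if "h \<in> gens H" for h
    using psi_left[of "bas h"] that by (simp add: cut_left_def)
  show "act (p \<otimes> bas []) = p" for p by (simp add: act_tens)
  fix b h assume b: "b \<in> fmod H'" "\<nu> b = b \<otimes> bas []" and h: "h \<in> gens H"
  have ps: "\<psi> (bas h) \<in> fmod (tensor_basis H H)" using flinD(1)[OF psi_flin] h by simp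
  have ih: "\<iota> (bas h) \<in> fmod H'" using flinD(1)[OF iota_flin, of "bas h"] h by simp
  have fb: "flin H' H' (\<lambda>k. b \<star> k)" using flin_mult_right[OF algs(2) b(1)] by simp
  have "\<nu> (act (b \<otimes> bas h)) = mult (tensor_alg H' H) (\<nu> b) (\<nu> (\<iota> (bas h)))"
    using alg_homD(5)[OF nu b(1) ih] by (simp add: act_tens del: iota_gen)
  also have "\<dots> = tmap H' 0 (\<lambda>k. b \<star> k) id (tmap H 0 \<iota> id (\<psi> (bas h)))"
    using nu_iota[of "bas h"] h mult_coinv[OF b(1) flinD(1)[OF flin_tmap[OF iota_flin flin_id(2)] ps]]
    by (simp add: b(2) del: iota_gen)
  also have "\<dots> = tmap H 0 (\<lambda>k. act (b \<otimes> k)) id (\<psi> (bas h))"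
    using tmap0_comp0[OF iota_flin flin_id(2) fb flin_id(2) ps] by (simp add: act_tens id_def)
  finally show "\<nu> (act (b \<otimes> bas h)) = tmap H 0 (\<lambda>k. act (b \<otimes> k)) id (\<psi> (bas h))" .
qed (fact nu_coassoc)

lemma cofree:
  "graded_submodule H' coinvariants \<and>
   (\<exists>\<phi>. graded_map 0 H' (tensor_basis H' H) \<phi> \<and> bij_betw \<phi> (fmod H') (sub_tensor coinvariants H) \<and>
     (\<forall>x\<in>fmod H'. assoc (tmap H' 0 \<phi> id (\<nu> x)) = tmap H' 0 id \<psi> (\<phi> x)))"
proof -
  interpret hm: hopf_module H' H "[]" \<nu> \<psi> act by (rule hopf_module)
  have "coinvariants = hm.coinv" by (simp add: coinvariants_def hm.coinv_def)
  then show ?thesis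
    using hm.coinv_submodule hm.graded_phi hm.bij_phi hm.phi_comodule by auto
qed

text \<open>\<open>\<nu>\<close> and \<open>x \<mapsto> x \<otimes> 1\<close> both respect products
  and, as \<open>d 1 = 0\<close>, differentials; the coinvariants are where the two agree.\<close>

lemma coinvariants_sub_chain_algebra: "sub_chain_algebra H' coinvariants"
  unfolding sub_chain_algebra_def
proof (intro conjI ballI)
  show "graded_submodule H' coinvariants" using cofree by simp
  show "munit H' \<in> coinvariants" using alg_homD(4)[OF nu] by (simp add: coinvariants_def)
  fix p assume p: "p \<in> coinvariants"
  then have p': "p \<in> fmod H'" "\<nu> p = p \<otimes> bas []" by (auto simp: coinvariants_def)
  have dN: "dif H (bas []) = 0" using deriv_munit[OF algs(1) dif_deriv] by simp
  have "tdif H' H (p \<otimes> bas []) = dif H' p \<otimes> bas []"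
    using p'(1)
  proof (rule flin_eqI[rotated -1])
    show "flin H' (tensor_basis H' H) (\<lambda>p. tdif H' H (p \<otimes> bas []))"
      by (rule flin_comp[OF flin_tens_left flin_tdif[OF deriv_flin[OF dif'_deriv] deriv_flin[OF dif_deriv]]]) simp
    show "flin H' (tensor_basis H' H) (\<lambda>p. dif H' p \<otimes> bas [])"
      by (rule flin_comp[OF deriv_flin[OF dif'_deriv] flin_tens_left]) simp
  qed (simp add: tdif_bas dN)
  then show "dif H' p \<in> coinvariants"
    using nu_dif[OF p'(1)] p' flinD(1)[OF deriv_flin[OF dif'_deriv]] by (simp add: coinvariants_def)
  fix q assume "q \<in> coinvariants"
  then have q': "q \<in> fmod H'" "\<nu> q = q \<otimes> bas []" by (auto simp: coinvariants_def)
  have "mult (tensor_alg H' H) (p \<otimes> bas []) (q \<otimes> bas []) = (p \<star> q) \<otimes> bas []"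
    using mult_coinv[OF p'(1), of "q \<otimes> bas []"] q'
      tmap0_tens[of H' H' "\<lambda>k. p \<star> k" H H id q "bas []"] flin_mult_right[OF algs(2) p'(1)] flin_id(2)[of H]
    by simp
  then show "mult H' p q \<in> coinvariants"
    using alg_homD(5)[OF nu p'(1) q'(1)] p' q' mult_fmod[OF algs(2) p'(1) q'(1)]
    by (simp add: coinvariants_def)
qed

end

subsection \<open>The cobar construction\<close>

text \<open>What makes the cobar differential a graded derivation. It passes to
  \<open>tensor_coalg\<close> by counting degrees.\<close>

definition precoalg :: "('x, 'r::comm_ring_1) coalg \<Rightarrow> bool"
  where "precoalg K \<longleftrightarrow> (\<forall>x. x \<in> gens K \<and> deg K x = 0 \<longleftrightarrow> x = one K) \<and>
    graded_map (-1) K K (dif K) \<and> graded_map 0 K (tensor_basis K K) (comult K)"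

text \<open>The quadratic part of the cobar differential. It can be fed the unreduced
  comultiplication, because \<open>sinv\<close> kills the terms containing
  \<open>one K\<close>.\<close>

definition quad :: "('x, 'r::comm_ring_1) coalg \<Rightarrow> ('x \<times> 'x \<Rightarrow>\<^sub>0 'r) \<Rightarrow> ('x list \<Rightarrow>\<^sub>0 'r)"
  where "quad K = lin (\<lambda>(y, z). ks (int (deg K y)) \<odot> (sinv K (bas y) \<star> sinv K (bas z)))"

lemma desusp_simps [simp]:
  "gens (desusp C) = {x \<in> gens C. deg C x > 0}" "deg (desusp C) x = deg C x - 1"
  by (simp_all add: desusp_def)

lemma sinv_linear [simp]:
  "sinv C (p + q) = sinv C p + sinv C q" "sinv C (a \<odot> p) = a \<odot> sinv C p" "sinv C 0 = 0"
  "sinv C (- p) = - sinv C p" "sinv C (p - q) = sinv C p - sinv C q"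
  by (simp_all add: sinv_def)

lemma sinv_bas: "sinv C (bas x) = (if x = one C then 0 else bas [x])"
  by (simp add: sinv_def)

lemma quad_linear [simp]:
  "quad C (p + q) = quad C p + quad C q" "quad C (a \<odot> p) = a \<odot> quad C p" "quad C 0 = 0"
  "quad C (- p) = - quad C p" "quad C (p - q) = quad C p - quad C q"
  by (simp_all add: quad_def)

lemma quad_bas: "quad C (bas (y, z)) = ks (int (deg C y)) \<odot> (sinv C (bas y) \<star> sinv C (bas z))"
  by (simp add: quad_def)

lemma cobar_eq: "cobar C = tensor_algebra (desusp C) (\<lambda>x. dif (cobar C) (bas [x]))"
  by (simp add: cobar_def)

lemma cobar_simps [simp]:
  "gens (cobar C) = lists {x \<in> gens C. deg C x > 0}"
  "deg (cobar C) w = sum_list (map (\<lambda>x. deg C x - 1) w)"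
  "mult (cobar C) = wmult"
  "munit (cobar C) = bas []"
  by (simp_all add: cobar_def desusp_def)

lemma dif_cobar_gen: "dif (cobar C) (bas [x]) = - sinv C (dif C (bas x)) + quad C (comult C (bas x))"
proof -
  have "lin (\<lambda>(y, z). (- 1) ^ deg C y \<odot> (sinv C (bas y) \<star> sinv C (bas z))) = quad C"
    by (simp add: quad_def minus_one_power_ks)
  moreover have "quad C (bas x \<otimes> bas (one C)) = 0" "quad C (bas (one C) \<otimes> bas x) = 0"
    by (simp_all add: quad_bas sinv_bas)
  ultimately show ?thesis by (simp add: cobar_def red_comult_def)
qed

lemma graded_alg_cobar: "graded_alg (cobar C)"
  unfolding cobar_def by (rule graded_alg_tensor_algebra)

lemmas cobar_eqI = alg_mor_eqI[where V = "desusp C" and \<delta> = "\<lambda>x. dif (cobar C) (bas [x])" for C,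
  folded cobar_eq]
lemmas cobar_deriv_eqI = deriv_eqI[where V = "desusp C" and \<delta> = "\<lambda>x. dif (cobar C) (bas [x])" for C,
  folded cobar_eq]
lemmas alg_mor_cobar = alg_mor_alg_ext[where V = "desusp C" and \<delta> = "\<lambda>x. dif (cobar C) (bas [x])" for C,
  folded cobar_eq]
lemmas alg_hom_cobar = alg_hom_alg_ext[where V = "desusp C" and \<delta> = "\<lambda>x. dif (cobar C) (bas [x])" for C,
  folded cobar_eq]

lemmas cobar_dif_deriv = tensor_algebra_dif_deriv[where V = "desusp C"
    and \<delta> = "\<lambda>x. dif (cobar C) (bas [x])" for C, folded cobar_eq]

context
  fixes K :: "('x, 'r::comm_ring_1) coalg"
  assumes K: "precoalg K"
begin

lemma one_gens: "one K \<in> gens K" and deg_one: "deg K (one K) = 0"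
  using K by (auto simp: precoalg_def)

lemma deg_eq_0: "x \<in> gens K \<Longrightarrow> deg K x = 0 \<longleftrightarrow> x = one K"
  using K by (auto simp: precoalg_def)

lemma deg_gt_0: "x \<in> gens K \<Longrightarrow> 0 < deg K x \<longleftrightarrow> x \<noteq> one K"
  using deg_eq_0[of x] by auto

lemma int_deg_diff: "x \<in> gens K \<Longrightarrow> x \<noteq> one K \<Longrightarrow> int (deg K x - 1) = int (deg K x) - 1"
  using deg_gt_0[of x] by (simp add: of_nat_diff)

lemma dif_graded: "graded_map (-1) K K (dif K)"
  using K by (simp add: precoalg_def)

lemma comult_graded: "graded_map 0 K (tensor_basis K K) (comult K)"
  using K by (simp add: precoalg_def)

lemma graded_sinv: "graded_map (-1) K (cobar K) (sinv K)"
  unfolding sinv_def by (rule graded_lin) (auto simp: deg_gt_0 of_nat_diff dest: deg_eq_0)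

lemma homog_sinv: "x \<in> gens K \<Longrightarrow> homog (cobar K) (int (deg K x) - 1) (sinv K (bas x))"
  using graded_bas[OF graded_sinv] by simp

lemma sinv_fmod: "p \<in> fmod K \<Longrightarrow> sinv K p \<in> fmod (cobar K)"
  by (rule flinD(1)[OF graded_flin[OF graded_sinv]])

lemma graded_quad: "graded_map (-2) (tensor_basis K K) (cobar K) (quad K)"
  unfolding quad_def
proof (rule graded_lin)
  fix w assume "w \<in> gens (tensor_basis K K)"
  then obtain y z where w: "w = (y, z)" "y \<in> gens K" "z \<in> gens K" by auto
  show "homog (cobar K) (int (deg (tensor_basis K K) w) + - 2)
     (case w of (y, z) \<Rightarrow> ks (int (deg K y)) \<odot> sinv K (bas y) \<star> sinv K (bas z))"
    using homog_mult[OF graded_alg_cobar homog_sinv[OF w(2)] homog_sinv[OF w(3)]]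
    by (simp add: w algebra_simps)
qed

lemma homog_dif_cobar_gen:
  assumes "x \<in> gens (desusp K)"
  shows "homog (cobar K) (int (deg (desusp K) x) - 1) (dif (cobar K) (bas [x]))"
proof -
  have x: "x \<in> gens K" "deg K x > 0" using assms by auto
  have "homog (cobar K) (int (deg K x) - 2) (sinv K (dif K (bas x)))"
    using graded_homog[OF graded_sinv graded_bas[OF dif_graded x(1)]] by simp
  moreover have "homog (cobar K) (int (deg K x) - 2) (quad K (comult K (bas x)))"
    using graded_homog[OF graded_quad graded_bas[OF comult_graded x(1)]] by simp
  ultimately show ?thesis using x by (simp add: dif_cobar_gen of_nat_diff)
qed

lemma dif_cobar_deriv: "deriv (cobar K) (cobar K) (\<lambda>p. p) (dif (cobar K))"
  by (rule cobar_dif_deriv) (rule homog_dif_cobar_gen)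

end

lemma tensor_coalg_basis:
  "gens (tensor_coalg A B) = gens (tensor_basis A B)" "deg (tensor_coalg A B) = deg (tensor_basis A B)"
  by (simp_all add: tensor_coalg_def)

lemmas tensor_coalg_basis_cong [simp] = basis_cong[OF tensor_coalg_basis]

lemma tensor_coalg_simps [simp]:
  "gens (tensor_coalg A B) = gens A \<times> gens B"
  "deg (tensor_coalg A B) (x, y) = deg A x + deg B y"
  "dif (tensor_coalg A B) = tdif A B"
  "one (tensor_coalg A B) = (one A, one B)"
  by (simp_all add: tensor_coalg_def)

section \<open>Tensor products of coalgebras and Milgram's map\<close>

lemma comult_tensor_bas:
  "comult (tensor_coalg C D) (bas (x, y)) =
    bilin (\<lambda>(x1, x2) (y1, y2). ks (int (deg C x2) * int (deg D y1)) \<odot> bas ((x1, y1), (x2, y2)))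
      (comult C (bas x)) (comult D (bas y))"
  by (simp add: tensor_coalg_def minus_one_power_ks)

lemma precoalg_tensor:
  assumes C: "precoalg C" and D: "precoalg D"
  shows "precoalg (tensor_coalg C D)"
  unfolding precoalg_def
proof (intro conjI allI)
  let ?K = "tensor_coalg C D"
  fix w show "w \<in> gens ?K \<and> deg ?K w = 0 \<longleftrightarrow> w = one ?K"
    using C D by (cases w) (auto simp: precoalg_def)
next
  let ?K = "tensor_coalg C D"
  show "graded_map (-1) ?K ?K (dif ?K)"
    unfolding tensor_coalg_simps tensor_coalg_basis_cong tdif_def[abs_def]
    by (intro graded_fun_add graded_tmap[OF dif_graded[OF C] graded_id(2)]
        graded_tmap[OF graded_id(2) dif_graded[OF D]]) simp_all
  have "comult ?K = lin (\<lambda>w. comult ?K (bas w))"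
    by (simp add: tensor_coalg_def)
  moreover have "graded_map 0 ?K (tensor_basis ?K ?K) (lin (\<lambda>w. comult ?K (bas w)))"
  proof (rule graded_lin)
    fix w assume "w \<in> gens ?K"
    then obtain x y where w: "w = (x, y)" "x \<in> gens C" "y \<in> gens D" by auto
    have hx: "homog (tensor_basis C C) (int (deg C x)) (comult C (bas x))"
      and hy: "homog (tensor_basis D D) (int (deg D y)) (comult D (bas y))"
      using graded_bas[OF comult_graded[OF C] w(2)] graded_bas[OF comult_graded[OF D] w(3)] by simp_all
    show "homog (tensor_basis ?K ?K) (int (deg ?K w) + 0) (comult ?K (bas w))"
      unfolding w(1) comult_tensor_bas bilin_lin
    proof (intro homog_lin)
      fix s t assume s: "s \<in> keys (comult C (bas x))" and t: "t \<in> keys (comult D (bas y))"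
      obtain x1 x2 y1 y2 where st: "s = (x1, x2)" "t = (y1, y2)" by (metis prod.exhaust)
      show "homog (tensor_basis ?K ?K) (int (deg ?K (x, y)) + 0)
        ((case s of (x1, x2) \<Rightarrow> \<lambda>(y1, y2). ks (int (deg C x2) * int (deg D y1)) \<odot> bas ((x1, y1), (x2, y2))) t)"
        using homogD[OF hx s] homogD[OF hy t] fmod_keysD[OF homog_fmod[OF hx] s] fmod_keysD[OF homog_fmod[OF hy] t]
        unfolding st by (intro homog_simps(4)[of _ _ "bas _", simplified] | simp)+
    qed
  qed
  ultimately show "graded_map 0 ?K (tensor_basis ?K ?K) (comult ?K)" by simp
qed

lemma milgram_hom:
  assumes C: "precoalg C" and D: "precoalg D"
  shows "alg_hom (cobar (tensor_coalg C D)) (tensor_alg (cobar C) (cobar D)) (milgram C D)"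
  unfolding milgram_def
  by (rule alg_hom_cobar[OF graded_alg_tensor[OF graded_alg_cobar graded_alg_cobar]])
     (auto simp: deg_gt_0[OF C] deg_gt_0[OF D] deg_one[OF C] deg_one[OF D] int_deg_diff[OF C] int_deg_diff[OF D])

lemma milgram_gen:
  assumes C: "precoalg C" and D: "precoalg D" and "x \<in> gens C" "y \<in> gens D" "x \<noteq> one C \<or> y \<noteq> one D"
  shows "milgram C D (bas [(x, y)]) =
    (if y = one D then bas ([x], []) else if x = one C then bas ([], [y]) else 0)"
  unfolding milgram_def
  by (subst alg_ext_gen[OF graded_alg_tensor[OF graded_alg_cobar graded_alg_cobar]])
     (use assms in \<open>auto simp: deg_gt_0[OF C] deg_gt_0[OF D]\<close>)

text \<open>Counits merge the three defining cases of \<open>q\<close> into one formula, which also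
  holds at \<open>(one C, one D)\<close>, where both sides vanish.\<close>

lemma milgram_sinv_bas:
  assumes C: "precoalg C" and D: "precoalg D" and "x \<in> gens C" "y \<in> gens D"
  shows "milgram C D (sinv (tensor_coalg C D) (bas (x, y))) =
    counit D (bas y) \<odot> (sinv C (bas x) \<otimes> bas []) + counit C (bas x) \<odot> (bas [] \<otimes> sinv D (bas y))"
proof -
  have "milgram C D 0 = 0" by (simp add: milgram_def)
  then show ?thesis
    using milgram_gen[OF assms] by (auto simp: sinv_bas counit_def lookup_single)
qed

lemma counit_linear [simp]:
  "counit C (p + q) = counit C p + counit C q" "counit C (a \<odot> p) = a * counit C p" "counit C 0 = 0"
  by (simp_all add: counit_def lookup_add)

lemma counit_bas: "counit C (bas x) = (if x = one C then 1 else 0)"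
  by (simp add: counit_def lookup_single)

lemma milgram_linear [simp]:
  "milgram C D (p + q) = milgram C D p + milgram C D q" "milgram C D (a \<odot> p) = a \<odot> milgram C D p"
  "milgram C D 0 = 0" "milgram C D (- p) = - milgram C D p" "milgram C D (p - q) = milgram C D p - milgram C D q"
  by (simp_all add: milgram_def)

lemma milgram_sinv_tens:
  assumes C: "precoalg C" and D: "precoalg D" and p: "p \<in> fmod C" and r: "r \<in> fmod D"
  shows "milgram C D (sinv (tensor_coalg C D) (p \<otimes> r)) =
    counit D r \<odot> (sinv C p \<otimes> bas []) + counit C p \<odot> (bas [] \<otimes> sinv D r)"
  using p
proof (induction rule: fmod_induct)
  case x: (bas x)
  show ?case using r
    by (induction rule: fmod_induct)
       (use x milgram_sinv_bas[OF C D] in \<open>auto simp: algebra_simps\<close>)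
qed (simp_all add: algebra_simps)

locale connected_coalgebra =
  fixes C :: "('x, 'r::comm_ring_1) coalg"
  assumes coalg: "chain_coalgebra C"
begin

lemma pre: "precoalg C"
proof -
  have "x \<in> gens C \<and> deg C x = 0 \<longleftrightarrow> x = one C" for x
  proof -
    have "x \<in> {x \<in> gens C. deg C x = 0} \<longleftrightarrow> x \<in> {one C}"
      using coalg unfolding chain_coalgebra_def by (simp only:)
    then show ?thesis by simp
  qed
  then show ?thesis using coalg unfolding precoalg_def chain_coalgebra_def by blast
qed

lemma counit_left: "c \<in> fmod C \<Longrightarrow> lin (\<lambda>(x, y). counit C (bas x) \<odot> bas y) (comult C c) = c"
  and counit_right: "c \<in> fmod C \<Longrightarrow> lin (\<lambda>(x, y). counit C (bas y) \<odot> bas x) (comult C c) = c"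
  and counit_dif: "c \<in> fmod C \<Longrightarrow> counit C (dif C c) = 0"
  and comult_one: "comult C (bas (one C)) = bas (one C, one C)"
  using coalg unfolding chain_coalgebra_def by simp_all

abbreviation T where "T \<equiv> tensor_alg (cobar C) (cobar C)"
abbreviation q where "q \<equiv> milgram C C"
abbreviation CC where "CC \<equiv> tensor_coalg C C"
abbreviation s where "s x \<equiv> sinv C (bas x)"
abbreviation eps where "eps x \<equiv> counit C (bas x)"

text \<open>Each summand is a factor in \<open>x1\<close>, \<open>x2\<close> tensor a factor in
  \<open>y1\<close>, \<open>y2\<close>, so that the later summation over both comultiplications
  splits.\<close>

lemma milgram_quad_bas:
  assumes g: "x1 \<in> gens C" "x2 \<in> gens C" "y1 \<in> gens C" "y2 \<in> gens C"
  shows "ks (int (deg C x2) * int (deg C y1)) \<odot> q (quad CC (bas ((x1, y1), (x2, y2)))) =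
    (ks (int (deg C x1)) \<odot> (s x1 \<star> s x2)) \<otimes> ((eps y1 * eps y2) \<odot> bas []) +
    ((ks (int (deg C x1)) * eps x2) \<odot> s x1) \<otimes> (eps y1 \<odot> s y2) -
    ((ks (int (deg C x2)) * eps x1) \<odot> s x2) \<otimes> (eps y2 \<odot> s y1) +
    ((eps x1 * eps x2) \<odot> bas []) \<otimes> (ks (int (deg C y1)) \<odot> (s y1 \<star> s y2))"
proof -
  note hs = homog_sinv[OF pre] and G = graded_alg_cobar[of C]
  have h0: "homog (cobar C) 0 (bas [])" by simp
  have e: "bas [] \<in> fmod (cobar C)" by simp
  have sf: "s x \<in> fmod (cobar C)" if "x \<in> gens C" for x using homog_fmod[OF hs[OF that]] .
  have m1: "mult T (s x1 \<otimes> bas []) (s x2 \<otimes> bas []) = (s x1 \<star> s x2) \<otimes> bas []"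
    using mult_tensor_tens[OF G G sf[OF g(1)] h0 hs[OF g(2)] e] by simp
  have m2: "mult T (s x1 \<otimes> bas []) (bas [] \<otimes> s y2) = s x1 \<otimes> s y2"
    using mult_tensor_tens[OF G G sf[OF g(1)] h0 h0 sf[OF g(4)]] by simp
  have m3: "mult T (bas [] \<otimes> s y1) (s x2 \<otimes> bas []) =
      ks ((int (deg C y1) - 1) * (int (deg C x2) - 1)) \<odot> (s x2 \<otimes> s y1)"
    using mult_tensor_tens[OF G G e hs[OF g(3)] hs[OF g(2)] e] by simp
  have m4: "mult T (bas [] \<otimes> s y1) (bas [] \<otimes> s y2) = bas [] \<otimes> (s y1 \<star> s y2)"
    using mult_tensor_tens[OF G G e hs[OF g(3)] h0 sf[OF g(4)]] by simp
  have "q (quad CC (bas ((x1, y1), (x2, y2)))) = ks (int (deg C x1) + int (deg C y1)) \<odot>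
      mult T (q (sinv CC (bas (x1, y1)))) (q (sinv CC (bas (x2, y2))))"
    using alg_homD(5)[OF milgram_hom[OF pre pre], of "sinv CC (bas (x1, y1))" "sinv CC (bas (x2, y2))"]
      sinv_fmod[OF precoalg_tensor[OF pre pre]] g
    by (simp add: quad_bas)
  also have "mult T (q (sinv CC (bas (x1, y1)))) (q (sinv CC (bas (x2, y2)))) =
      (eps y1 * eps y2) \<odot> ((s x1 \<star> s x2) \<otimes> bas []) + (eps y1 * eps x2) \<odot> (s x1 \<otimes> s y2) +
      (eps x1 * eps y2 * ks ((int (deg C y1) - 1) * (int (deg C x2) - 1))) \<odot> (s x2 \<otimes> s y1) +
      (eps x1 * eps x2) \<odot> (bas [] \<otimes> (s y1 \<star> s y2))"
    using g by (simp add: milgram_sinv_bas[OF pre pre] mult_tensor_linear m1 m2 m3 m4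
        fm.scale_right_distrib algebra_simps del: tens_bas)
  finally have *: "ks (int (deg C x2) * int (deg C y1)) \<odot> q (quad CC (bas ((x1, y1), (x2, y2)))) =
     (ks (int (deg C x2) * int (deg C y1)) * ks (int (deg C x1) + int (deg C y1))) \<odot>
     ((eps y1 * eps y2) \<odot> ((s x1 \<star> s x2) \<otimes> bas []) + (eps y1 * eps x2) \<odot> (s x1 \<otimes> s y2) +
      (eps x1 * eps y2 * ks ((int (deg C y1) - 1) * (int (deg C x2) - 1))) \<odot> (s x2 \<otimes> s y1) +
      (eps x1 * eps x2) \<odot> (bas [] \<otimes> (s y1 \<star> s y2)))" by simp
  \<comment> \<open>The last sign is that of moving \<open>s y1\<close> past \<open>s x2\<close>.
    The total leaves the minus sign which makes the mixed terms cancel after summation.\<close>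
  have k: "ks (int (deg C x2) * int (deg C y1)) * ks (int (deg C y1)) *
     ks ((int (deg C y1) - 1) * (int (deg C x2) - 1)) = - (ks (int (deg C x2)) :: 'r)"
    by (simp add: ks_def)
  \<comment> \<open>A component is either \<open>one C\<close>, with \<open>s\<close> zero and
    degree 0, or has counit 0; the sixteen combinations settle all signs.\<close>
  have z: "s (one C) = 0" "deg C (one C) = 0" using deg_one[OF pre] by (simp_all add: sinv_bas)
  show ?thesis unfolding *
    by (cases "x1 = one C"; cases "x2 = one C"; cases "y1 = one C"; cases "y2 = one C")
       (simp_all add: z counit_bas k)
qed

text \<open>The counit laws collapse every sum. Both mixed products become
  \<open>s x \<otimes> s y\<close> with sign exponent \<open>|x|\<close>, one with a minus, and
  cancel.\<close>

lemma milgram_quad: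
  assumes x: "x \<in> gens C" and y: "y \<in> gens C"
  shows "q (quad CC (comult CC (bas (x, y)))) =
    eps y \<odot> (quad C (comult C (bas x)) \<otimes> bas []) + eps x \<odot> (bas [] \<otimes> quad C (comult C (bas y)))"
proof -
  let ?x = "comult C (bas x)" and ?y = "comult C (bas y)"
  have fx: "bas x \<in> fmod C" and fy: "bas y \<in> fmod C" using x y by auto
  have kx: "?x \<in> fmod (tensor_basis C C)" and ky: "?y \<in> fmod (tensor_basis C C)"
    using flinD(1)[OF graded_flin[OF comult_graded[OF pre]]] fx fy by auto
  define F1 where "F1 = (\<lambda>(x1, x2). ks (int (deg C x1)) \<odot> (s x1 \<star> s x2))"
  define G1 where "G1 = (\<lambda>(y1, y2). (eps y1 * eps y2) \<odot> (bas [] :: 'x list \<Rightarrow>\<^sub>0 'r))"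
  define F2 where "F2 = (\<lambda>(x1, x2). (ks (int (deg C x1)) * eps x2) \<odot> s x1)"
  define G2 where "G2 = (\<lambda>(y1, y2). eps y1 \<odot> s y2)"
  define F3 where "F3 = (\<lambda>(x1, x2). (ks (int (deg C x2)) * eps x1) \<odot> s x2)"
  define G3 where "G3 = (\<lambda>(y1, y2). eps y2 \<odot> s y1)"
  define F4 where "F4 = (\<lambda>(x1, x2). (eps x1 * eps x2) \<odot> (bas [] :: 'x list \<Rightarrow>\<^sub>0 'r))"
  define G4 where "G4 = (\<lambda>(y1, y2). ks (int (deg C y1)) \<odot> (s y1 \<star> s y2))"
  note defs = F1_def G1_def F2_def G2_def F3_def G3_def F4_def G4_def
  have "q (quad CC (comult CC (bas (x, y)))) =
    bilin (\<lambda>u v. F1 u \<otimes> G1 v + (F2 u \<otimes> G2 v + ((- F3 u) \<otimes> G3 v + F4 u \<otimes> G4 v))) ?x ?y"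
  proof -
    have "q (quad CC t) = lin (\<lambda>w. q (quad CC (bas w))) t" for t
      by (induction t rule: fmod_UNIV_induct) simp_all
    then have "q (quad CC (comult CC (bas (x, y)))) = lin (\<lambda>w. q (quad CC (bas w))) (comult CC (bas (x, y)))" .
    also have "\<dots> = bilin (\<lambda>u v. lin (\<lambda>w. q (quad CC (bas w))) ((case u of (x1, x2) \<Rightarrow> \<lambda>(y1, y2).
         ks (int (deg C x2) * int (deg C y1)) \<odot> bas ((x1, y1), (x2, y2))) v)) ?x ?y"
      by (simp only: comult_tensor_bas lin_bilin)
    also have "\<dots> = bilin (\<lambda>u v. F1 u \<otimes> G1 v + (F2 u \<otimes> G2 v + ((- F3 u) \<otimes> G3 v + F4 u \<otimes> G4 v))) ?x ?y"
    proof (rule bilin_cong)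
      fix u v assume "u \<in> keys ?x" "v \<in> keys ?y"
      then have "u \<in> gens (tensor_basis C C)" "v \<in> gens (tensor_basis C C)"
        using fmod_keysD[OF kx] fmod_keysD[OF ky] by auto
      then obtain x1 x2 y1 y2 where uv: "u = (x1, x2)" "v = (y1, y2)"
        "x1 \<in> gens C" "x2 \<in> gens C" "y1 \<in> gens C" "y2 \<in> gens C" by auto
      show "lin (\<lambda>w. q (quad CC (bas w))) ((case u of (x1, x2) \<Rightarrow> \<lambda>(y1, y2).
         ks (int (deg C x2) * int (deg C y1)) \<odot> bas ((x1, y1), (x2, y2))) v) =
         F1 u \<otimes> G1 v + (F2 u \<otimes> G2 v + ((- F3 u) \<otimes> G3 v + F4 u \<otimes> G4 v))"
        using milgram_quad_bas[OF uv(3-6)] by (simp add: uv(1,2) defs algebra_simps del: tens_simps(3,4))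
    qed
    finally show ?thesis .
  qed
  also have "\<dots> = lin F1 ?x \<otimes> lin G1 ?y + (lin F2 ?x \<otimes> lin G2 ?y - lin F3 ?x \<otimes> lin G3 ?y + lin F4 ?x \<otimes> lin G4 ?y)"
  proof -
    have "bilin (\<lambda>u v. - (F3 u \<otimes> G3 v)) ?x ?y = - bilin (\<lambda>u v. F3 u \<otimes> G3 v) ?x ?y"
      by (simp add: bilin_lin lin_fun_uminus)
    then show ?thesis by (simp only: bilin_fun_add tens_lin tens_simps) simp
  qed
  also have "lin F2 ?x = ks (int (deg C x)) \<odot> s x"
  proof -
    have "lin F2 ?x = lin (\<lambda>x. ks (int (deg C x)) \<odot> s x) (lin (\<lambda>(x, y). eps y \<odot> bas x) ?x)"
      unfolding lin_lin F2_def by (intro lin_cong refl) (auto simp: mult.commute)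
    then show ?thesis using counit_right[OF fx] by simp
  qed
  also have "lin F3 ?x = ks (int (deg C x)) \<odot> s x"
  proof -
    have "lin F3 ?x = lin (\<lambda>x. ks (int (deg C x)) \<odot> s x) (lin (\<lambda>(x, y). eps x \<odot> bas y) ?x)"
      unfolding lin_lin F3_def by (intro lin_cong refl) (auto simp: mult.commute)
    then show ?thesis using counit_left[OF fx] by simp
  qed
  also have "lin G2 ?y = s y"
  proof -
    have "lin G2 ?y = lin s (lin (\<lambda>(x, y). eps x \<odot> bas y) ?y)"
      unfolding lin_lin G2_def by (intro lin_cong refl) auto
    then show ?thesis using counit_left[OF fy] by simp
  qed
  also have "lin G3 ?y = s y"
  proof -
    have "lin G3 ?y = lin s (lin (\<lambda>(x, y). eps y \<odot> bas x) ?y)"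
      unfolding lin_lin G3_def by (intro lin_cong refl) auto
    then show ?thesis using counit_right[OF fy] by simp
  qed
  also have "lin G1 ?y = eps y \<odot> bas []"
  proof -
    have "lin G1 ?y = lin (\<lambda>y. eps y \<odot> bas []) (lin (\<lambda>(x, y). eps x \<odot> bas y) ?y)"
      unfolding lin_lin G1_def by (intro lin_cong refl) auto
    then show ?thesis using counit_left[OF fy] by simp
  qed
  also have "lin F4 ?x = eps x \<odot> bas []"
  proof -
    have "lin F4 ?x = lin (\<lambda>y. eps y \<odot> bas []) (lin (\<lambda>(x, y). eps x \<odot> bas y) ?x)"
      unfolding lin_lin F4_def by (intro lin_cong refl) auto
    then show ?thesis using counit_left[OF fx] by simp
  qed
  also have "lin F1 ?x = quad C ?x" by (simp add: F1_def quad_def)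
  also have "lin G4 ?y = quad C ?y" by (simp add: G4_def quad_def)
  \<comment> \<open>Here the second and the third product cancel.\<close>
  finally show ?thesis by simp
qed

text \<open>Both sides are derivations along \<open>q\<close>. On letters, the linear part uses that
  the counit vanishes on boundaries, the quadratic part is \<open>milgram_quad\<close>.\<close>

lemma milgram_dif:
  assumes p: "p \<in> fmod (cobar CC)"
  shows "q (dif (cobar CC) p) = tdif (cobar C) (cobar C) (q p)"
proof -
  note P2 = precoalg_tensor[OF pre pre]
  have G: "graded_alg T" by (intro graded_alg_tensor graded_alg_cobar)
  have 1: "deriv (cobar CC) T (\<lambda>p. q p) (\<lambda>p. q (dif (cobar CC) p))"
    by (rule deriv_comp_hom[OF graded_alg_cobar graded_alg_cobar flin_id(1) dif_cobar_deriv[OF P2] milgram_hom[OF pre pre]])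
  have 2: "deriv (cobar CC) T (\<lambda>p. q p) (\<lambda>p. tdif (cobar C) (cobar C) (q p))"
    by (rule hom_comp_deriv[OF graded_alg_cobar G G flin_id(1)
          deriv_tdif[OF graded_alg_cobar graded_alg_cobar dif_cobar_deriv[OF pre] dif_cobar_deriv[OF pre]]
          milgram_hom[OF pre pre]])
  show ?thesis
  proof (rule cobar_deriv_eqI[OF G 1 2 _ _ p])
    fix w assume "w \<in> gens (desusp CC)"
    then obtain x y where w: "w = (x, y)" "x \<in> gens C" "y \<in> gens C" "x \<noteq> one C \<or> y \<noteq> one C"
      by (cases w) (auto simp: deg_gt_0[OF pre])
    have dx: "dif C (bas x) \<in> fmod C" and dy: "dif C (bas y) \<in> fmod C"
      using flinD(1)[OF graded_flin[OF dif_graded[OF pre]]] w by auto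
    have "dif C (bas (one C)) = 0"
      using homog_neg[OF graded_bas[OF dif_graded[OF pre] one_gens[OF pre]]] by (simp add: deg_one[OF pre])
    \<comment> \<open>\<open>[one C]\<close> is not a word of the cobar construction, but its formal
      differential vanishes, so the formula below also covers letters with a trivial
      component.\<close>
    then have d1: "dif (cobar C) (bas [one C]) = 0"
      by (simp add: dif_cobar_gen comult_one quad_bas sinv_bas)
    have dN: "dif (cobar C) (bas []) = 0"
      using deriv_munit[OF graded_alg_cobar dif_cobar_deriv[OF pre]] by simp
    \<comment> \<open>The counit is concentrated in degree 0, where the Koszul sign is
      trivial.\<close>
    have e: "ks (int (deg C x)) * eps x = eps x" by (simp add: counit_bas deg_one[OF pre])

    have qs: "q (sinv CC (dif CC (bas (x, y)))) =
      eps y \<odot> (sinv C (dif C (bas x)) \<otimes> bas []) + eps x \<odot> (bas [] \<otimes> sinv C (dif C (bas y)))"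
      using w dx dy counit_dif[of "bas x"] counit_dif[of "bas y"]
      by (simp add: tdif_bas milgram_sinv_tens[OF pre pre] e)
    have "q (dif (cobar CC) (bas [w])) =
       eps y \<odot> (dif (cobar C) (bas [x]) \<otimes> bas []) + eps x \<odot> (bas [] \<otimes> dif (cobar C) (bas [y]))"
      unfolding dif_cobar_gen w(1) milgram_linear qs milgram_quad[OF w(2,3)]
      by (simp add: fm.scale_right_diff_distrib fm.scale_right_distrib algebra_simps)
    also have "\<dots> = tdif (cobar C) (cobar C) (q (bas [w]))"
      using w(4) milgram_gen[OF pre pre w(2-4)]
      by (cases "x = one C"; cases "y = one C") (simp_all add: w(1) d1 counit_bas tdif_bas dN)
    finally show "q (dif (cobar CC) (bas [w])) = tdif (cobar C) (cobar C) (q (bas [w]))" .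
  qed simp
qed

end

subsection \<open>The counits of an Alexander-Whitney coalgebra\<close>

text \<open>The filtration by word length, for which \<open>s\<^sup>-\<^sup>1\<Delta>\<close> is the
  leading part of \<open>\<Psi>\<close> on letters.\<close>

definition word_ge :: "nat \<Rightarrow> ('x list \<Rightarrow>\<^sub>0 'r::comm_ring_1) \<Rightarrow> bool"
  where "word_ge n p \<longleftrightarrow> (\<forall>w\<in>keys p. n \<le> length w)"

lemma word_ge_simps [simp]:
  "word_ge n 0" "word_ge n p \<Longrightarrow> word_ge n q \<Longrightarrow> word_ge n (p + q)"
  "word_ge n p \<Longrightarrow> word_ge n (a \<odot> p)" "word_ge n (bas w) \<longleftrightarrow> n \<le> length w" "word_ge 0 p"
  using Poly_Mapping.keys_add[of p q] by (auto simp: word_ge_def in_keys_iff)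

lemma word_ge_mono: "word_ge m p \<Longrightarrow> n \<le> m \<Longrightarrow> word_ge n p"
  by (auto simp: word_ge_def)

lemma word_ge_wmult: "word_ge m p \<Longrightarrow> word_ge n q \<Longrightarrow> word_ge (m + n) (p \<star> q)"
  unfolding word_ge_def wmult_def by (auto elim!: in_keys_bilinE intro!: add_mono)

lemma word_ge_lin: "(\<And>x. x \<in> keys p \<Longrightarrow> word_ge n (F x)) \<Longrightarrow> word_ge n (lin F p)"
  unfolding word_ge_def by (meson in_keys_linE)

lemma alg_mor_word_ge:
  assumes f: "alg_mor (tensor_algebra V \<delta>) (tensor_algebra W \<epsilon>) f"
    and gen: "\<And>x. x \<in> gens V \<Longrightarrow> word_ge 1 (f (bas [x]))"
    and p: "p \<in> fmod (tensor_algebra V \<delta>)" "word_ge n p"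
  shows "word_ge n (f p)"
proof -
  have "word_ge (length w) (f (bas w))" if "w \<in> lists (gens V)" for w
    using that
  proof (induction w)
    case (Cons x w)
    then show ?case
      using alg_morD(3)[OF f, of "bas [x]" "bas w"] word_ge_wmult[OF gen, of x "length w" "f (bas w)"]
      by (simp add: plus_1_eq_Suc)
  qed simp
  then have "word_ge n (f (bas w))" if "w \<in> keys p" for w
    using fmod_keysD[OF p(1) that] p(2) that
    by (intro word_ge_mono[of "length w" _ n]) (auto simp: word_ge_def[of n p])
  then have "word_ge n (lin (\<lambda>w. f (bas w)) p)" by (rule word_ge_lin)
  then show ?thesis using flin_eq_lin[OF alg_morD(1)[OF f] p(1)] by simp
qed

text \<open>
  Modulo longer words \<open>f\<close> is the identity, so it is injective; an injective idempotent is the identity.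
\<close>

lemma idempotent_eq_id:
  assumes f: "alg_mor (tensor_algebra V \<delta>) (tensor_algebra V \<delta>) f"
    and gen: "\<And>x. x \<in> gens V \<Longrightarrow> word_ge 2 (f (bas [x]) - bas [x])"
    and idem: "\<And>p. p \<in> fmod (tensor_algebra V \<delta>) \<Longrightarrow> f (f p) = f p"
    and p: "p \<in> fmod (tensor_algebra V \<delta>)"
  shows "f p = p"
proof -
  let ?A = "tensor_algebra V \<delta>"
  note fl = alg_morD(1)[OF f]
  have word: "word_ge (Suc (length w)) (f (bas w) - bas w)" if "w \<in> lists (gens V)" for w
    using that
  proof (induction w)
    case Nil
    then show ?case using alg_morD(2)[OF f] by simp
  next
    case (Cons x w)
    define a b where "a = f (bas [x]) - bas [x]" and "b = f (bas w) - bas w"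
    have "f (bas (x # w)) = (bas [x] + a) \<star> (bas w + b)"
      using alg_morD(3)[OF f, of "bas [x]" "bas w"] Cons by (simp add: a_def b_def)
    then have "f (bas (x # w)) - bas (x # w) = bas [x] \<star> b + (a \<star> bas w + a \<star> b)"
      by simp
    moreover have "word_ge 2 a" "word_ge (Suc (length w)) b"
      unfolding a_def b_def using Cons gen by auto
    then have "word_ge (1 + Suc (length w)) (bas [x] \<star> b)" "word_ge (2 + length w) (a \<star> bas w)"
      "word_ge (2 + Suc (length w)) (a \<star> b)"
      by (intro word_ge_wmult; simp)+
    ultimately show ?case
      using word_ge_mono[of "2 + Suc (length w)" "a \<star> b" "Suc (Suc (length w))"]
      by (simp add: plus_1_eq_Suc)
  qed
  have inj: "q = 0" if q: "q \<in> fmod ?A" "f q = 0" for q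
  proof (rule ccontr)
    assume "q \<noteq> 0"
    then obtain w0 where "w0 \<in> keys q" by (metis all_not_in_conv keys_eq_empty)
    \<comment> \<open>A shortest word of \<open>q\<close> cannot occur in \<open>f q - q\<close>,
      whose words are all longer; but \<open>f q - q\<close> is \<open>- q\<close>.\<close>
    then obtain w where w: "w \<in> keys q" "\<And>u. u \<in> keys q \<Longrightarrow> length w \<le> length u"
      using ex_has_least_nat[of "\<lambda>w. w \<in> keys q" w0 length] by blast
    have "f q - q = lin (\<lambda>u. f (bas u) - bas u) q"
      using flin_eq_lin[OF fl q(1)] by (simp add: lin_fun_diff)
    moreover have "word_ge (Suc (length w)) (lin (\<lambda>u. f (bas u) - bas u) q)"
      using w(2) fmod_keysD[OF q(1)] by (intro word_ge_lin word_ge_mono[OF word]) auto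
    ultimately have "word_ge (Suc (length w)) (- q)" using q by simp
    moreover have "w \<in> keys (- q)" using w(1) by simp
    ultimately show False unfolding word_ge_def by fastforce
  qed
  have fp: "f p \<in> fmod ?A" using flinD(1)[OF fl p] .
  then have "f (f p - p) = 0"
    using idem[OF p] flin_diff_app[OF fl fp p] by simp
  from inj[OF _ this] fp p show ?thesis by simp
qed

lemmas cobar_mor_word_ge = alg_mor_word_ge[where V = "desusp A" and W = "desusp B"
    and \<delta> = "\<lambda>x. dif (cobar A) (bas [x])" and \<epsilon> = "\<lambda>x. dif (cobar B) (bas [x])" for A B, folded cobar_eq]
lemmas cobar_idempotent_eq_id = idempotent_eq_id[where V = "desusp A"
    and \<delta> = "\<lambda>x. dif (cobar A) (bas [x])" for A, folded cobar_eq]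

locale aw_coalgebra =
  fixes C :: "('x, 'r::comm_ring_1) coalg"
    and \<Psi> :: "('x list \<Rightarrow>\<^sub>0 'r) \<Rightarrow> (('x \<times> 'x) list \<Rightarrow>\<^sub>0 'r)"
  assumes AW: "AW_coalgebra C \<Psi>"

sublocale aw_coalgebra \<subseteq> connected_coalgebra C
  by standard (use AW in \<open>simp add: AW_coalgebra_def simply_connected_def\<close>)

context aw_coalgebra
begin

abbreviation \<psi> where "\<psi> \<equiv> loop_comult C \<Psi>"

lemma deg_gt_1: "x \<in> gens C \<Longrightarrow> 0 < deg C x \<Longrightarrow> 1 < deg C x"
  using AW by (force simp: AW_coalgebra_def simply_connected_def)

lemma Psi_hom: "alg_hom (cobar C) (cobar CC) \<Psi>"
  using AW by (intro chain_algebra_map_alg_hom) (simp add: AW_coalgebra_def)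

lemma Psi_dif: "p \<in> fmod (cobar C) \<Longrightarrow> \<Psi> (dif (cobar C) p) = dif (cobar CC) (\<Psi> p)"
  using AW by (simp add: AW_coalgebra_def chain_algebra_map_def)

lemma psi_hom: "alg_hom (cobar C) T \<psi>"
  unfolding loop_comult_def comp_def by (rule alg_hom_comp[OF Psi_hom milgram_hom[OF pre pre]])

lemma psi_dif: "p \<in> fmod (cobar C) \<Longrightarrow> \<psi> (dif (cobar C) p) = tdif (cobar C) (cobar C) (\<psi> p)"
  by (simp add: loop_comult_def Psi_dif milgram_dif flinD(1)[OF alg_homD(2)[OF Psi_hom]])

lemma psi_assoc:
  "p \<in> fmod (cobar C) \<Longrightarrow> assoc (tmap (cobar C) 0 \<psi> id (\<psi> p)) = tmap (cobar C) 0 id \<psi> (\<psi> p)"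
  using AW unfolding AW_coalgebra_def Let_def by blast

lemmas psi_flin = alg_homD(2)[OF psi_hom, simplified]

text \<open>\<open>(\<epsilon> \<otimes> \<epsilon>)\<psi> = \<epsilon>\<close>: as
  \<open>C\<^sub>1 = 0\<close>, nonempty words have positive degree, and \<psi> preserves
  degrees.\<close>

lemma lookup_psi:
  assumes "w \<in> gens (cobar C)" shows "lookup (\<psi> (bas w)) ([], []) = (if w = [] then 1 else 0)"
proof (cases "w = []")
  case True
  then show ?thesis using alg_homD(4)[OF psi_hom] by (simp add: lookup_single)
next
  case False
  then obtain x u where xu: "w = x # u" by (cases w) auto
  then have "0 < deg C x - 1" using deg_gt_1[of x] assms by simp
  then have "0 < deg (cobar C) w" using xu by simp
  moreover have "homog (tensor_basis (cobar C) (cobar C)) (int (deg (cobar C) w)) (\<psi> (bas w))"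
    using graded_bas[OF alg_homD(3)[OF psi_hom] assms] by simp
  moreover have "deg (cobar C) [] = 0" by simp
  ultimately have "([], []) \<notin> keys (\<psi> (bas w))"
    unfolding homog_def by (force simp del: cobar_simps(2))
  then show ?thesis using False by (simp add: in_keys_iff)
qed

text \<open>\<open>c\<close> stands for \<open>1 \<otimes> \<epsilon>\<close> or
  \<open>\<epsilon> \<otimes> 1\<close>. On a letter \<open>x\<close>, the counit of
  \<open>C\<close> turns the linear part of \<open>\<Psi>\<close> into \<open>x\<close>.\<close>

lemma counit_aux:
  assumes c: "alg_hom T (cobar C) c"
    and c1: "\<And>x y. x \<in> gens C \<Longrightarrow> y \<in> gens C \<Longrightarrow> x \<noteq> one C \<or> y \<noteq> one C \<Longrightarrow> word_ge 1 (c (q (bas [(x, y)])))"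
    and c2: "\<And>x. x \<in> gens C \<Longrightarrow> c (q (sinv CC (comult C (bas x)))) = s x"
    and idem: "\<And>p. p \<in> fmod (cobar C) \<Longrightarrow> c (\<psi> (c (\<psi> p))) = c (\<psi> p)"
    and p: "p \<in> fmod (cobar C)"
  shows "c (\<psi> p) = p"
proof -

  have cq: "alg_hom (cobar CC) (cobar C) (\<lambda>t. c (q t))"
    by (rule alg_hom_comp[OF milgram_hom[OF pre pre] c])
  have cpsi: "alg_hom (cobar C) (cobar C) (\<lambda>p. c (\<psi> p))"
    by (rule alg_hom_comp[OF psi_hom c])
  have gen: "word_ge 2 (c (\<psi> (bas [x])) - bas [x])" if x: "x \<in> gens (desusp C)" for x
  proof -
    have x': "x \<in> gens C" "x \<noteq> one C" using x deg_gt_0[OF pre, of x] by auto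
    then have sx: "s x = bas [x]" by (simp add: sinv_bas)
    \<comment> \<open>The nonlinear remainder has words of length at least 2, and
      \<open>c \<circ> q\<close> does not shorten words.\<close>
    define e where "e = \<Psi> (bas [x]) - sinv CC (comult C (bas x))"
    have "has_linear_part C CC \<Psi> (comult C)" using AW by (simp add: AW_coalgebra_def)
    then have e2: "word_ge 2 e"
      using x' unfolding has_linear_part_def word_ge_def e_def by (auto simp flip: sx)
    have P: "\<Psi> (bas [x]) \<in> fmod (cobar CC)"
      using flinD(1)[OF alg_homD(2)[OF Psi_hom], of "bas [x]"] x by simp
    have "comult C (bas x) \<in> fmod CC"
      using flinD(1)[OF graded_flin[OF comult_graded[OF pre]], of "bas x"] x' by simp
    then have S: "sinv CC (comult C (bas x)) \<in> fmod (cobar CC)"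
      by (rule sinv_fmod[OF precoalg_tensor[OF pre pre]])
    have ef: "e \<in> fmod (cobar CC)" using P S by (simp add: e_def)
    have "word_ge 2 (c (q e))"
    proof (rule cobar_mor_word_ge[OF alg_homD(1)[OF cq] _ ef e2])
      fix w assume "w \<in> gens (desusp CC)"
      then show "word_ge 1 (c (q (bas [w])))"
        using c1 by (cases w) (auto simp: deg_gt_0[OF pre])
    qed
    moreover have "c (q (\<Psi> (bas [x]))) = c (q e) + s x"
      using flin_diff_app[OF alg_homD(2)[OF cq] P S] c2[OF x'(1)] by (simp add: e_def)
    ultimately show ?thesis by (simp add: loop_comult_def sx)
  qed
  show ?thesis
    by (rule cobar_idempotent_eq_id[OF alg_homD(1)[OF cpsi] gen idem p])
qed

lemma flin_milgram_sinv: "flin (tensor_basis C C) (tensor_basis (cobar C) (cobar C)) (\<lambda>t. q (sinv CC t))"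
  using flin_comp[OF graded_flin[OF graded_sinv[OF precoalg_tensor[OF pre pre]]] alg_homD(2)[OF milgram_hom[OF pre pre]]]
  by simp

lemma psi_right:
  assumes p: "p \<in> fmod (cobar C)" shows "cut_right [] (\<psi> p) = p"
proof (rule counit_aux[OF _ _ _ _ p])
  show "alg_hom T (cobar C) (cut_right [])"
    unfolding cobar_def by (rule alg_hom_cut_right)
  show "word_ge 1 (cut_right [] (q (bas [(x, y)])))"
    if "x \<in> gens C" "y \<in> gens C" "x \<noteq> one C \<or> y \<noteq> one C" for x y
    by (simp add: milgram_gen[OF pre pre that])
  show "cut_right [] (q (sinv CC (comult C (bas x)))) = s x" if x: "x \<in> gens C" for x
  proof -
    have f2: "flin (tensor_basis C C) C (lin (\<lambda>(x, y). eps y \<odot> bas x))" by (rule flin_lin) auto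
    have "cut_right [] (q (sinv CC (comult C (bas x)))) = sinv C (lin (\<lambda>(x, y). eps y \<odot> bas x) (comult C (bas x)))"
    proof (rule flin_eqI[OF flin_comp[OF flin_milgram_sinv flin_cut_right] flin_comp[OF f2 graded_flin[OF graded_sinv[OF pre]]]])
      show "comult C (bas x) \<in> fmod (tensor_basis C C)"
        using flinD(1)[OF graded_flin[OF comult_graded[OF pre]], of "bas x"] x by simp
      fix w assume "w \<in> gens (tensor_basis C C)"
      then obtain y z where w: "w = (y, z)" "y \<in> gens C" "z \<in> gens C" by auto
      have "lookup (s z) [] = 0" by (simp add: sinv_bas lookup_single)
      then show "cut_right [] (q (sinv CC (bas w))) = sinv C (lin (\<lambda>(x, y). eps y \<odot> bas x) (bas w))"
        unfolding w(1) milgram_sinv_bas[OF pre pre w(2,3)] by (simp add: cut_right_tens lookup_single)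
    qed
    then show ?thesis using counit_right[of "bas x"] x by simp
  qed
  fix p :: "'x list \<Rightarrow>\<^sub>0 'r" assume p: "p \<in> fmod (cobar C)"
  note t = flinD(1)[OF psi_flin p]
  have l: "lookup (id (bas y)) [] = (if y = [] then 1 else 0)" for y :: "'x list"
    by (simp add: lookup_single)
  \<comment> \<open>Idempotence is coassociativity under
    \<open>1 \<otimes> \<epsilon> \<otimes> \<epsilon>\<close>: one side iterates
    \<open>(1 \<otimes> \<epsilon>)\<psi>\<close>, the other reduces by
    \<open>lookup_psi\<close>.\<close>
  have "cut_right ([], []) (assoc u) = cut_right [] (cut_right [] u)" for u :: "('x list \<times> 'x list) \<times> 'x list \<Rightarrow>\<^sub>0 'r"
    by (induction u rule: fmod_UNIV_induct) auto
  then have "cut_right [] (\<psi> (cut_right [] (\<psi> p))) = cut_right ([], []) (assoc (tmap (cobar C) 0 \<psi> id (\<psi> p)))"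
    using cut_right_tmap[where g = id, OF psi_flin flin_id(2) l t] by simp
  also have "\<dots> = cut_right [] (\<psi> p)"
    unfolding psi_assoc[OF p] using cut_right_tmap[where f = id, OF flin_id(2) psi_flin lookup_psi t] by simp
  finally show "cut_right [] (\<psi> (cut_right [] (\<psi> p))) = cut_right [] (\<psi> p)" .
qed

lemma psi_left:
  assumes p: "p \<in> fmod (cobar C)" shows "cut_left [] (\<psi> p) = p"
proof (rule counit_aux[OF _ _ _ _ p])
  show "alg_hom T (cobar C) (cut_left [])"
    unfolding cobar_def by (rule alg_hom_cut_left)
  show "word_ge 1 (cut_left [] (q (bas [(x, y)])))"
    if "x \<in> gens C" "y \<in> gens C" "x \<noteq> one C \<or> y \<noteq> one C" for x y
    by (simp add: milgram_gen[OF pre pre that])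
  show "cut_left [] (q (sinv CC (comult C (bas x)))) = s x" if x: "x \<in> gens C" for x
  proof -
    have f2: "flin (tensor_basis C C) C (lin (\<lambda>(x, y). eps x \<odot> bas y))" by (rule flin_lin) auto
    have "cut_left [] (q (sinv CC (comult C (bas x)))) = sinv C (lin (\<lambda>(x, y). eps x \<odot> bas y) (comult C (bas x)))"
    proof (rule flin_eqI[OF flin_comp[OF flin_milgram_sinv flin_cut_left] flin_comp[OF f2 graded_flin[OF graded_sinv[OF pre]]]])
      show "comult C (bas x) \<in> fmod (tensor_basis C C)"
        using flinD(1)[OF graded_flin[OF comult_graded[OF pre]], of "bas x"] x by simp
      fix w assume "w \<in> gens (tensor_basis C C)"
      then obtain y z where w: "w = (y, z)" "y \<in> gens C" "z \<in> gens C" by auto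
      have "lookup (s y) [] = 0" by (simp add: sinv_bas lookup_single)
      then show "cut_left [] (q (sinv CC (bas w))) = sinv C (lin (\<lambda>(x, y). eps x \<odot> bas y) (bas w))"
        unfolding w(1) milgram_sinv_bas[OF pre pre w(2,3)] by (simp add: cut_left_tens lookup_single)
    qed
    then show ?thesis using counit_left[of "bas x"] x by simp
  qed
  fix p :: "'x list \<Rightarrow>\<^sub>0 'r" assume p: "p \<in> fmod (cobar C)"
  note t = flinD(1)[OF psi_flin p]
  have l: "lookup (id (bas y)) [] = (if y = [] then 1 else 0)" for y :: "'x list"
    by (simp add: lookup_single)
  \<comment> \<open>The mirror image, with
    \<open>\<epsilon> \<otimes> \<epsilon> \<otimes> 1\<close> applied to coassociativity.\<close>
  have "cut_left [] (cut_left [] (assoc u)) = cut_left ([], []) u" for u :: "('x list \<times> 'x list) \<times> 'x list \<Rightarrow>\<^sub>0 'r"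
    by (induction u rule: fmod_UNIV_induct) auto
  then have "cut_left [] (cut_left [] (tmap (cobar C) 0 id \<psi> (\<psi> p))) = cut_left [] (\<psi> p)"
    unfolding psi_assoc[OF p, symmetric] using cut_left_tmap[where g = id, OF psi_flin flin_id(2) lookup_psi t] by simp
  moreover have "cut_left [] (tmap (cobar C) 0 id \<psi> (\<psi> p)) = \<psi> (cut_left [] (\<psi> p))"
    using cut_left_tmap[where f = id, OF flin_id(2) psi_flin l t] by simp
  ultimately show "cut_left [] (\<psi> (cut_left [] (\<psi> p))) = cut_left [] (\<psi> p)" by simp
qed

end

subsection \<open>Morphisms of Alexander-Whitney coalgebras\<close>

lemma alg_mor_word_zero:
  assumes B: "graded_alg B" and f: "alg_mor (tensor_algebra V \<delta>) B f"
    and "w \<in> lists (gens V)" "x \<in> set w" "f (bas [x]) = 0"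
  shows "f (bas w) = 0"
  using assms(3,4)
proof (induction w)
  case (Cons y w)
  then show ?case
    using alg_morD(3)[OF f, of "bas [y]" "bas w"] assms(5)
    by (auto simp: mult_linear[OF B])
qed simp

lemma alg_mor_tens_unit:
  assumes A: "graded_alg A" and B: "graded_alg B"
  shows "alg_mor A (tensor_alg A B) (\<lambda>p. p \<otimes> munit B)" "alg_mor B (tensor_alg A B) (\<lambda>q. munit A \<otimes> q)"
proof -
  note u = munit_fmod[OF A] munit_fmod[OF B] and h = homog_munit[OF A] homog_munit[OF B]
  have "mult (tensor_alg A B) (bas x \<otimes> munit B) (bas y \<otimes> munit B) = mult A (bas x) (bas y) \<otimes> munit B"
    if "x \<in> gens A" "y \<in> gens A" for x y
    using mult_tensor_tens[OF A B _ h(2) homog_bas'[OF that(2)] u(2), of "bas x"] that u(2) mult_unit[OF B u(2)]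
    by simp
  then show "alg_mor A (tensor_alg A B) (\<lambda>p. p \<otimes> munit B)"
    using u by (intro alg_morI graded_alg_tensor A B) (simp_all add: flin_tens_left)
  have "mult (tensor_alg A B) (munit A \<otimes> bas x) (munit A \<otimes> bas y) = munit A \<otimes> mult B (bas x) (bas y)"
    if "x \<in> gens B" "y \<in> gens B" for x y
    using mult_tensor_tens[OF A B u(1) homog_bas'[OF that(1)] h(1), of "bas y"] that u(1) mult_unit[OF A u(1)]
    by simp
  then show "alg_mor B (tensor_alg A B) (\<lambda>q. munit A \<otimes> q)"
    using u by (intro alg_morI graded_alg_tensor A B) (simp_all add: flin_tens_right)
qed

lemmas cobar_mor_word_zero = alg_mor_word_zero[where V = "desusp A"
    and \<delta> = "\<lambda>x. dif (cobar A) (bas [x])" for A, folded cobar_eq]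

section \<open>Iterated comultiplications and letters with two nontrivial components\<close>

lemma iter_comult_one:
  assumes "comult D (bas (one D)) = bas (one D, one D)"
  shows "iter_comult D k (one D) = bas (replicate k (one D))"
  by (induction k) (simp_all add: assms counit_bas)

text \<open>Degrees add up, so an element of positive degree cannot split into trivial factors only.
  For \<open>k = 0\<close> there are no terms, since the counit of \<open>y\<close> is 0.\<close>

lemma keys_iter_comult:
  assumes D: "precoalg D"
  shows "y \<in> gens D \<Longrightarrow> v \<in> keys (iter_comult D k y) \<Longrightarrow>
    v \<in> lists (gens D) \<and> length v = k \<and> (y \<noteq> one D \<longrightarrow> (\<exists>x\<in>set v. x \<noteq> one D))"
proof (induction k arbitrary: y v)
  case 0
  then show ?case by (cases "y = one D") (auto simp: counit_bas)
next
  case (Suc k)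
  have h: "homog (tensor_basis D D) (int (deg D y)) (comult D (bas y))"
    using graded_bas[OF comult_graded[OF D] Suc(2)] by simp
  obtain y1 z where yz: "(y1, z) \<in> keys (comult D (bas y))" "v \<in> keys (bas [y1] \<star> iter_comult D k z)"
    using Suc(3) by (auto elim: in_keys_linE)
  obtain v' where v: "v = y1 # v'" "v' \<in> keys (iter_comult D k z)"
    using yz(2) unfolding wmult_def by (auto elim!: in_keys_bilinE)
  have g: "y1 \<in> gens D" "z \<in> gens D" using fmod_keysD[OF homog_fmod[OF h] yz(1)] by auto
  have "int (deg D y1 + deg D z) = int (deg D y)" using homogD[OF h yz(1)] by simp
  then have "deg D y1 + deg D z = deg D y" by (simp only: of_nat_eq_iff)
  then have "y \<noteq> one D \<Longrightarrow> y1 \<noteq> one D \<or> z \<noteq> one D"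
    using deg_eq_0[OF D Suc(2)] deg_one[OF D] by auto
  with Suc(1)[OF g(2) v(2)] g v(1) show ?case by auto
qed

lemma in_keys_interleaveE:
  fixes p :: "'x list \<Rightarrow>\<^sub>0 'r::comm_ring_1"
  assumes "w \<in> keys (interleave A B p q)"
  obtains u v where "u \<in> keys p" "v \<in> keys q" "w = zip u v"
proof -
  obtain u v where uv: "u \<in> keys p" "v \<in> keys q"
    "w \<in> keys ((-1) ^ (\<Sum>j<length u. \<Sum>i<j. deg B (v ! i) * deg A (u ! j)) \<odot> (bas (zip u v) :: _ \<Rightarrow>\<^sub>0 'r))"
    using assms unfolding interleave_def by (rule in_keys_bilinE) blast
  then have "w = zip u v" by (auto simp: in_keys_iff lookup_single when_def split: if_splits)
  with that uv show ?thesis by blast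
qed

lemma zip_in_lists: "u \<in> lists A \<Longrightarrow> v \<in> lists B \<Longrightarrow> zip u v \<in> lists (A \<times> B)"
  by (auto dest: set_zip_leftD set_zip_rightD)

lemma milgram_word_zero:
  "(x, y) \<in> set w \<Longrightarrow> x \<noteq> one C \<Longrightarrow> y \<noteq> one D \<Longrightarrow> milgram C D (bas w) = 0"
  by (induction w) (auto simp: milgram_def alg_ext_Cons mult_tensor_linear)

locale sh_morphism = dom: connected_coalgebra C' + cod: connected_coalgebra C
  for C' :: "('y, 'r::comm_ring_1) coalg" and C :: "('x, 'r) coalg" +
  fixes \<theta> :: "('y list \<Rightarrow>\<^sub>0 'r) \<Rightarrow> ('x list \<Rightarrow>\<^sub>0 'r)"
  assumes theta: "alg_hom (cobar C') (cobar C) \<theta>"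
begin

abbreviation left where "left \<equiv> sh_left C' C \<theta> C'"
abbreviation right where "right \<equiv> sh_right C C' C \<theta>"

lemma theta_keys:
  assumes "c \<in> gens C'" "c \<noteq> one C'" "w \<in> keys (\<theta> (bas [c]))"
  shows "w \<in> lists {x \<in> gens C. x \<noteq> one C}"
proof -
  have "\<theta> (bas [c]) \<in> fmod (cobar C)"
    using flinD(1)[OF alg_homD(2)[OF theta], of "bas [c]"] assms deg_gt_0[OF dom.pre] by simp
  from fmod_keysD[OF this assms(3)] show ?thesis by (auto simp: deg_gt_0[OF cod.pre])
qed

text \<open>Words of \<open>\<theta>\<close> have no trivial letters, and for
  \<open>d \<noteq> one C'\<close> each term of the iterated comultiplication keeps a nontrivial
  factor; so some letter is nontrivial in both components.\<close>

lemma left_keys: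
  assumes c: "c \<in> gens C'" "c \<noteq> one C'" and d: "d \<in> gens C'"
    and w: "w \<in> keys (lin (\<lambda>w. interleave (desusp C) C' (bas w) (iter_comult C' (length w) d)) (\<theta> (bas [c])))"
  shows "w \<in> lists ({x \<in> gens C. x \<noteq> one C} \<times> gens C')"
    and "d \<noteq> one C' \<Longrightarrow> \<exists>(a, b)\<in>set w. b \<noteq> one C'"
proof -
  obtain u v where uv: "u \<in> keys (\<theta> (bas [c]))" "v \<in> keys (iter_comult C' (length u) d)" "w = zip u v"
    using w by (auto elim!: in_keys_linE in_keys_interleaveE)
  note k = keys_iter_comult[OF dom.pre d uv(2)]
  show "w \<in> lists ({x \<in> gens C. x \<noteq> one C} \<times> gens C')"
    unfolding uv(3) using theta_keys[OF c uv(1)] k by (intro zip_in_lists) auto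
  assume "d \<noteq> one C'"
  then obtain b where "b \<in> set v" "b \<noteq> one C'" using k by blast
  then show "\<exists>(a, b)\<in>set w. b \<noteq> one C'"
    using k uv(3) by (force simp: in_set_conv_nth)
qed

lemma right_keys:
  assumes c: "c \<in> gens C'" "c \<noteq> one C'" and d: "d \<in> gens C"
    and w: "w \<in> keys (lin (\<lambda>w. interleave C (desusp C) (iter_comult C (length w) d) (bas w)) (\<theta> (bas [c])))"
  shows "w \<in> lists (gens C \<times> {x \<in> gens C. x \<noteq> one C})"
    and "d \<noteq> one C \<Longrightarrow> \<exists>(a, b)\<in>set w. a \<noteq> one C \<and> b \<noteq> one C"
proof -
  obtain u v where uv: "u \<in> keys (\<theta> (bas [c]))" "v \<in> keys (iter_comult C (length u) d)" "w = zip v u"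
    using w by (auto elim!: in_keys_linE in_keys_interleaveE)
  note k = keys_iter_comult[OF cod.pre d uv(2)]
  show l: "w \<in> lists (gens C \<times> {x \<in> gens C. x \<noteq> one C})"
    unfolding uv(3) using theta_keys[OF c uv(1)] k by (intro zip_in_lists) auto
  assume "d \<noteq> one C"
  then obtain a where "a \<in> set v" "a \<noteq> one C" using k by blast
  then have "\<exists>(a, b)\<in>set w. a \<noteq> one C"
    using k uv(3) by (force simp: in_set_conv_nth)
  with l show "\<exists>(a, b)\<in>set w. a \<noteq> one C \<and> b \<noteq> one C" by fastforce
qed

definition left_fun where "left_fun = (\<lambda>(c, d). if c = one C' then bas [(one C, d)]
    else lin (\<lambda>w. interleave (desusp C) C' (bas w) (iter_comult C' (length w) d)) (\<theta> (bas [c])))"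

definition right_fun where "right_fun = (\<lambda>(d, c). if c = one C' then bas [(d, one C)]
    else lin (\<lambda>w. interleave C (desusp C) (iter_comult C (length w) d) (bas w)) (\<theta> (bas [c])))"

lemma left_eq: "left = alg_ext (cobar (tensor_coalg C C')) left_fun"
  and right_eq: "right = alg_ext (cobar (tensor_coalg C C)) right_fun"
  by (simp_all add: sh_left_def sh_right_def left_fun_def right_fun_def)

lemma left_gen_fmod:
  assumes "z \<in> gens (desusp (tensor_coalg C' C'))"
  shows "left_fun z \<in> fmod (cobar (tensor_coalg C C'))"
proof -
  obtain c d where z: "z = (c, d)" "c \<in> gens C'" "d \<in> gens C'" "c \<noteq> one C' \<or> d \<noteq> one C'"
    using assms by (cases z) (auto simp: deg_gt_0[OF dom.pre])
  show ?thesis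
  proof (cases "c = one C'")
    case True
    then show ?thesis using z by (simp add: left_fun_def one_gens[OF cod.pre] deg_gt_0[OF dom.pre])
  next
    case False
    have "lin (\<lambda>w. interleave (desusp C) C' (bas w) (iter_comult C' (length w) d)) (\<theta> (bas [c])) \<in> fmod (cobar (tensor_coalg C C'))"
      unfolding fmod_def using left_keys(1)[OF z(2) False z(3)] by (fastforce simp: deg_gt_0[OF cod.pre])
    then show ?thesis using False z by (simp add: left_fun_def)
  qed
qed

lemma right_gen_fmod:
  assumes "z \<in> gens (desusp (tensor_coalg C C'))"
  shows "right_fun z \<in> fmod (cobar (tensor_coalg C C))"
proof -
  obtain d c where z: "z = (d, c)" "d \<in> gens C" "c \<in> gens C'" "d \<noteq> one C \<or> c \<noteq> one C'"
    using assms by (cases z) (auto simp: deg_gt_0[OF dom.pre] deg_gt_0[OF cod.pre])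
  show ?thesis
  proof (cases "c = one C'")
    case True
    then show ?thesis using z by (simp add: right_fun_def one_gens[OF cod.pre] deg_gt_0[OF cod.pre])
  next
    case False
    have "lin (\<lambda>w. interleave C (desusp C) (iter_comult C (length w) d) (bas w)) (\<theta> (bas [c])) \<in> fmod (cobar (tensor_coalg C C))"
      unfolding fmod_def using right_keys(1)[OF z(3) False z(2)] by (fastforce simp: deg_gt_0[OF cod.pre])
    then show ?thesis using False z by (simp add: right_fun_def)
  qed
qed

lemma left_mor: "alg_mor (cobar (tensor_coalg C' C')) (cobar (tensor_coalg C C')) left"
  unfolding left_eq by (rule alg_mor_cobar[OF graded_alg_cobar left_gen_fmod])

lemma right_mor: "alg_mor (cobar (tensor_coalg C C')) (cobar (tensor_coalg C C)) right"
  unfolding right_eq by (rule alg_mor_cobar[OF graded_alg_cobar right_gen_fmod])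

lemma left_gen:
  assumes "c \<in> gens C'" "d \<in> gens C'" "c \<noteq> one C' \<or> d \<noteq> one C'"
  shows "left (bas [(c, d)]) = (if c = one C' then bas [(one C, d)]
    else lin (\<lambda>w. interleave (desusp C) C' (bas w) (iter_comult C' (length w) d)) (\<theta> (bas [c])))"
proof -
  have "(c, d) \<in> gens (desusp (tensor_coalg C' C'))" using assms by (auto simp: deg_gt_0[OF dom.pre])
  from alg_ext_gen[where F = left_fun, OF graded_alg_cobar left_gen_fmod[OF this]]
  show ?thesis unfolding left_eq by (simp add: left_fun_def)
qed

lemma right_gen:
  assumes "d \<in> gens C" "c \<in> gens C'" "d \<noteq> one C \<or> c \<noteq> one C'"
  shows "right (bas [(d, c)]) = (if c = one C' then bas [(d, one C)]
    else lin (\<lambda>w. interleave C (desusp C) (iter_comult C (length w) d) (bas w)) (\<theta> (bas [c])))"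
proof -
  have "(d, c) \<in> gens (desusp (tensor_coalg C C'))"
    using assms by (auto simp: deg_gt_0[OF dom.pre] deg_gt_0[OF cod.pre])
  from alg_ext_gen[where F = right_fun, OF graded_alg_cobar right_gen_fmod[OF this]]
  show ?thesis unfolding right_eq by (simp add: right_fun_def)
qed

lemma right_mixed:
  assumes "d \<in> gens C" "c \<in> gens C'" "d \<noteq> one C" "c \<noteq> one C'"
  shows "milgram C C (right (bas [(d, c)])) = 0"
proof -
  have "(d, c) \<in> gens (desusp (tensor_coalg C C'))"
    using assms by (auto simp: deg_gt_0[OF dom.pre] deg_gt_0[OF cod.pre])
  then have "right (bas [(d, c)]) \<in> fmod (cobar (tensor_coalg C C))"
    by (intro flinD(1)[OF alg_morD(1)[OF right_mor]]) simp
  from flin_eq_lin[OF alg_homD(2)[OF milgram_hom[OF cod.pre cod.pre]] this]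
  have "milgram C C (right (bas [(d, c)])) = lin (\<lambda>w. milgram C C (bas w)) (right (bas [(d, c)]))" .
  also have "\<dots> = lin (\<lambda>w. 0) (right (bas [(d, c)]))"
  proof (rule lin_cong[OF refl])
    fix w assume "w \<in> keys (right (bas [(d, c)]))"
    then obtain a b where "(a, b) \<in> set w" "a \<noteq> one C" "b \<noteq> one C"
      using right_keys(2)[OF assms(2,4,1) _ assms(3), of w] right_gen[of d c] assms by auto
    then show "milgram C C (bas w) = 0" by (rule milgram_word_zero)
  qed
  finally show ?thesis by simp
qed

lemma milgram_right_zero:
  assumes w: "w \<in> gens (cobar (tensor_coalg C C'))" "(d, c) \<in> set w" "d \<noteq> one C" "c \<noteq> one C'"
  shows "milgram C C (right (bas w)) = 0"
proof -
  let ?K = "tensor_coalg C C'"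
  have f: "alg_mor (cobar ?K) (tensor_alg (cobar C) (cobar C)) (\<lambda>p. milgram C C (right p))"
    by (rule alg_mor_comp[OF right_mor alg_homD(1)[OF milgram_hom[OF cod.pre cod.pre]]])
  have dc: "d \<in> gens C" "c \<in> gens C'" using w by auto
  show ?thesis
    by (rule cobar_mor_word_zero[OF graded_alg_tensor[OF graded_alg_cobar graded_alg_cobar] f _ w(2)])
       (use w right_mixed[OF dc w(3,4)] in auto)
qed

text \<open>This is how the condition on \<open>\<Psi>\<close> in a morphism becomes one on \<psi>.
  Both sides are algebra maps; on a letter \<open>(x, y)\<close> both give
  \<open>\<theta> x \<otimes> 1\<close>, \<open>1 \<otimes> \<theta> y\<close> or 0.\<close>

lemma milgram_sh_tensor:
  assumes t: "t \<in> fmod (cobar (tensor_coalg C' C'))"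
  shows "milgram C C (sh_tensor C' C \<theta> C' C \<theta> t) = tmap (cobar C') 0 \<theta> \<theta> (milgram C' C' t)"
proof -
  let ?T = "tensor_alg (cobar C) (cobar C)"
  have G: "graded_alg ?T" by (intro graded_alg_tensor graded_alg_cobar)
  have f: "alg_mor (cobar (tensor_coalg C C')) ?T (\<lambda>p. milgram C C (right p))"
    by (rule alg_mor_comp[OF right_mor alg_homD(1)[OF milgram_hom[OF cod.pre cod.pre]]])
  have 1: "alg_mor (cobar (tensor_coalg C' C')) ?T (\<lambda>p. milgram C C (right (left p)))"
    by (rule alg_mor_comp[OF left_mor f])
  have 2: "alg_mor (cobar (tensor_coalg C' C')) ?T (\<lambda>p. tmap (cobar C') 0 \<theta> \<theta> (milgram C' C' p))"
    by (rule alg_mor_comp[OF alg_homD(1)[OF milgram_hom[OF dom.pre dom.pre]] alg_homD(1)[OF alg_hom_tmap[OF graded_alg_cobar graded_alg_cobar graded_alg_cobar graded_alg_cobar theta theta]]])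
  have thN: "\<theta> (bas []) = bas []" using alg_homD(4)[OF theta] by simp
  have "milgram C C (right (left t)) = tmap (cobar C') 0 \<theta> \<theta> (milgram C' C' t)"
  proof (rule cobar_eqI[OF 1 2 _ t])
    fix z assume "z \<in> gens (desusp (tensor_coalg C' C'))"
    then obtain x y where z: "z = (x, y)" "x \<in> gens C'" "y \<in> gens C'" "x \<noteq> one C' \<or> y \<noteq> one C'"
      by (cases z) (auto simp: deg_gt_0[OF dom.pre])
    note lg = left_gen[OF z(2-4)] and mg = milgram_gen[OF dom.pre dom.pre z(2-4)]
    consider "y = one C'" "x \<noteq> one C'" | "x = one C'" "y \<noteq> one C'" | "x \<noteq> one C'" "y \<noteq> one C'"
      using z(4) by blast
    then show "milgram C C (right (left (bas [z]))) = tmap (cobar C') 0 \<theta> \<theta> (milgram C' C' (bas [z]))"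
    proof cases
      case 1
      have tx: "\<theta> (bas [x]) \<in> fmod (cobar C)"
        using flinD(1)[OF alg_homD(2)[OF theta], of "bas [x]"] 1 z deg_gt_0[OF dom.pre] by simp
      \<comment> \<open>The iterated comultiplication of 1 is a tensor power of 1, of degree 0;
        interleaving only pairs each letter with 1, without sign.\<close>
      have "left (bas [z]) = lin (\<lambda>w. interleave (desusp C) C' (bas w) (bas (replicate (length w) (one C')))) (\<theta> (bas [x]))"
        using lg 1 by (simp add: z(1) iter_comult_one[OF dom.comult_one])
      also have "\<dots> = wmap (\<lambda>c. (c, one C')) (\<theta> (bas [x]))"
        unfolding wmap_def by (intro lin_cong refl) (simp add: interleave_def deg_one[OF dom.pre] zip_replicate2)
      finally have l: "left (bas [z]) = wmap (\<lambda>c. (c, one C')) (\<theta> (bas [x]))" .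
      have w: "alg_mor (cobar C) (cobar (tensor_coalg C C')) (wmap (\<lambda>c. (c, one C')))"
        unfolding cobar_def by (rule alg_mor_wmap) (auto simp: one_gens[OF dom.pre] deg_gt_0[OF cod.pre])
      have g: "milgram C C (right (bas [(x, one C')])) = bas ([x], [])" if "x \<in> gens C" "x \<noteq> one C" for x
        using that by (simp add: right_gen milgram_gen[OF cod.pre cod.pre] one_gens[OF dom.pre] one_gens[OF cod.pre])
      \<comment> \<open>Both sides are algebra maps in \<open>p\<close>, so letters suffice.\<close>
      have "milgram C C (right (wmap (\<lambda>c. (c, one C')) p)) = p \<otimes> bas []" if p: "p \<in> fmod (cobar C)" for p
        using cobar_eqI[OF alg_mor_comp[OF w f] alg_mor_tens_unit(1)[OF graded_alg_cobar graded_alg_cobar] _ p]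
          g deg_gt_0[OF cod.pre] by auto
      then have "milgram C C (right (left (bas [z]))) = \<theta> (bas [x]) \<otimes> bas []"
        unfolding l using tx .
      then show ?thesis using 1 mg by (simp add: z(1) tmap_bas thN)
    next
      case 2
      have ty: "\<theta> (bas [y]) \<in> fmod (cobar C)"
        using flinD(1)[OF alg_homD(2)[OF theta], of "bas [y]"] 2 z deg_gt_0[OF dom.pre] by simp
      have "right (left (bas [z])) = lin (\<lambda>w. interleave C (desusp C) (bas (replicate (length w) (one C))) (bas w)) (\<theta> (bas [y]))"
        using lg 2 z right_gen[of "one C" y] by (simp add: iter_comult_one[OF cod.comult_one] one_gens[OF cod.pre])
      also have "\<dots> = wmap (\<lambda>c. (one C, c)) (\<theta> (bas [y]))"
        unfolding wmap_def by (intro lin_cong refl) (simp add: interleave_def deg_one[OF cod.pre] zip_replicate1)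
      finally have l: "right (left (bas [z])) = wmap (\<lambda>c. (one C, c)) (\<theta> (bas [y]))" .
      have w: "alg_mor (cobar C) (cobar (tensor_coalg C C)) (wmap (\<lambda>c. (one C, c)))"
        unfolding cobar_def by (rule alg_mor_wmap) (auto simp: one_gens[OF cod.pre] deg_gt_0[OF cod.pre])
      have g: "milgram C C (bas [(one C, x)]) = bas ([], [x])" if "x \<in> gens C" "x \<noteq> one C" for x
        using that by (simp add: milgram_gen[OF cod.pre cod.pre] one_gens[OF cod.pre])
      have "milgram C C (wmap (\<lambda>c. (one C, c)) p) = bas [] \<otimes> p" if p: "p \<in> fmod (cobar C)" for p
        using cobar_eqI[OF alg_mor_comp[OF w alg_homD(1)[OF milgram_hom[OF cod.pre cod.pre]]] alg_mor_tens_unit(2)[OF graded_alg_cobar graded_alg_cobar] _ p]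
          g deg_gt_0[OF cod.pre] by auto
      then have "milgram C C (right (left (bas [z]))) = bas [] \<otimes> \<theta> (bas [y])"
        unfolding l using ty .
      then show ?thesis using 2 mg by (simp add: z(1) tmap_bas thN)
    next
      case 3
      have "z \<in> gens (desusp (tensor_coalg C' C'))"
        using z by (auto simp: deg_gt_0[OF dom.pre])
      then have lf: "left (bas [z]) \<in> fmod (cobar (tensor_coalg C C'))"
        by (intro flinD(1)[OF alg_morD(1)[OF left_mor]]) simp
      have "milgram C C (right (left (bas [z]))) = lin (\<lambda>w. milgram C C (right (bas w))) (left (bas [z]))"
        using flin_eq_lin[OF alg_morD(1)[OF f] lf] .
      \<comment> \<open>Each word has a letter with two nontrivial components. \<open>right\<close>
        sends this letter to words that again contain such a letter, and \<open>q\<close> kills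
        them.\<close>
      also have "\<dots> = lin (\<lambda>w. 0) (left (bas [z]))"
      proof (rule lin_cong[OF refl])
        fix w assume w: "w \<in> keys (left (bas [z]))"
        then have w': "w \<in> keys (lin (\<lambda>w. interleave (desusp C) C' (bas w) (iter_comult C' (length w) y)) (\<theta> (bas [x])))"
          using lg 3 z(1) by simp
        note lk = left_keys[OF z(2) 3(1) z(3) w']
        obtain a b where ab: "(a, b) \<in> set w" "b \<noteq> one C'" using lk(2)[OF 3(2)] by auto
        moreover have "a \<noteq> one C" using lk(1) ab(1) by auto
        ultimately show "milgram C C (right (bas w)) = 0"
          by (intro milgram_right_zero[OF fmod_keysD[OF lf w]])
      qed
      finally show ?thesis using 3 mg by (simp add: z(1))
    qed
  qed
  then show ?thesis by (simp add: sh_tensor_def)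
qed

end

lemma psi_morphism:
  assumes "AW_coalgebra C' \<Psi>'" "AW_coalgebra C \<Psi>" "AW_morphism C' \<Psi>' C \<Psi> \<theta>"
    and p: "p \<in> fmod (cobar C')"
  shows "loop_comult C \<Psi> (\<theta> p) = tmap (cobar C') 0 \<theta> \<theta> (loop_comult C' \<Psi>' p)"
proof -
  interpret A': aw_coalgebra C' \<Psi>' by standard fact
  interpret A: aw_coalgebra C \<Psi> by standard fact
  interpret sh_morphism C' C \<theta>
    by standard (use assms in \<open>auto simp: AW_morphism_def intro: chain_algebra_map_alg_hom\<close>)
  show ?thesis
    using assms(3) p milgram_sh_tensor[OF flinD(1)[OF alg_homD(2)[OF A'.Psi_hom] p]]
    by (simp add: AW_morphism_def loop_comult_def)
qed

subsection \<open>Path-loop constructions\<close>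

lemma with_comult_simps [simp]:
  "gens (with_comult A d) = gens A" "deg (with_comult A d) = deg A" "dif (with_comult A d) = dif A"
  "mult (with_comult A d) = mult A" "munit (with_comult A d) = munit A" "hcomult (with_comult A d) = d"
  by (simp_all add: with_comult_def)

lemmas with_comult_basis_cong [simp] = basis_cong[OF with_comult_simps(1,2)]

lemma sub_chain_algebra_with_comult [simp]:
  "sub_chain_algebra (with_comult A d) B = sub_chain_algebra A B"
  by (simp add: sub_chain_algebra_def)

lemma cofree_with_comult:
  "cofree_comodule (with_comult A d) \<nu> (with_comult H \<psi>) (with_comult A d) B \<longleftrightarrow>
    graded_submodule A B \<and>
    (\<exists>\<phi>. graded_map 0 A (tensor_basis A H) \<phi> \<and> bij_betw \<phi> (fmod A) (sub_tensor B H) \<and>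
      (\<forall>x\<in>fmod A. assoc (tmap A 0 \<phi> id (\<nu> x)) = tmap A 0 id \<psi> (\<phi> x)))"
  by (simp add: cofree_comodule_def)

lemma wmap_der_ext:
  fixes F :: "'x \<Rightarrow> ('y list \<Rightarrow>\<^sub>0 'r::comm_ring_1)"
  shows "wmap f (der_ext V i F p) = der_ext V (\<lambda>x. f (i x)) (\<lambda>x. wmap f (F x)) p"
proof -
  have "wmap f (der_word V i F w) = der_word V (\<lambda>x. f (i x)) (\<lambda>x. wmap f (F x)) w" for w
    by (induction w) (simp_all add: wmap_wmult comp_def)
  then show ?thesis
    by (induction p rule: fmod_UNIV_induct) (simp_all add: der_ext_def)
qed

section \<open>The cobar construction on the based path coalgebra\<close>

locale path_aw = aw_coalgebra C \<Psi> for C :: "('x, 'r::comm_ring_1) coalg" and \<Psi> +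
  assumes deg_ne: "x \<in> gens C \<Longrightarrow> deg C x \<noteq> 1 \<and> deg C x \<noteq> 2"
begin

abbreviation PC where "PC \<equiv> path_coalg C"
abbreviation \<kappa> where "\<kappa> \<equiv> path_kappa C"
abbreviation pr where "pr \<equiv> cobar_path_proj C"
abbreviation inc :: "('x list \<Rightarrow>\<^sub>0 'r) \<Rightarrow> ('x path list \<Rightarrow>\<^sub>0 'r)" where "inc \<equiv> wmap Base"

lemma deg_ge_3: "x \<in> gens C \<Longrightarrow> 0 < deg C x \<Longrightarrow> 3 \<le> deg C x"
  using deg_ne[of x] by linarith

text \<open>Generators of positive degree have degree at least 3, so \<open>Bar x\<close> stays in
  positive degree and yields a letter of the cobar construction.\<close>

lemma desusp_path:
  "deg (desusp PC) (Base x) = deg C x - 1" "deg (desusp PC) (Bar x) = deg C x - 1 - 1"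
  "Base x \<in> gens (desusp PC) \<longleftrightarrow> x \<in> gens (desusp C)"
  "Bar x \<in> gens (desusp PC) \<longleftrightarrow> x \<in> gens (desusp C)"
proof -
  show "Bar x \<in> gens (desusp PC) \<longleftrightarrow> x \<in> gens (desusp C)"
    using deg_ge_3[of x] by (auto simp: path_coalg_def)
qed (auto simp: path_coalg_def)

lemma int_deg_bar: "x \<in> gens (desusp C) \<Longrightarrow> int (deg C x - 1 - 1) = int (deg C x - 1) - 1"
  using deg_ge_3[of x] by simp

lemma one_path [simp]: "one PC = Base (one C)"
  by (simp add: path_coalg_def)

lemma sinv_path_incl: "sinv PC (path_incl p) = inc (sinv C p)"
  by (induction p rule: fmod_UNIV_induct) (simp_all add: path_incl_def sinv_bas)

lemma kappa_linear [simp]: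
  "\<kappa> (p + p') = \<kappa> p + \<kappa> p'" "\<kappa> (a \<odot> p) = a \<odot> \<kappa> p" "\<kappa> 0 = 0" "\<kappa> (- p) = - \<kappa> p" "\<kappa> (p - p') = \<kappa> p - \<kappa> p'"
  by (simp_all add: path_kappa_def der_ext_def)

lemma kappa_bas [simp]: "\<kappa> (bas [x]) = - bas [Bar x]"
  by (simp add: path_kappa_def)

text \<open>The sign is built into \<open>\<kappa>\<close>, which sends the letter \<open>x\<close>
  to minus the letter \<open>Bar x\<close>.\<close>

lemma sinv_path_bar: "sinv PC (path_bar C p) = - \<kappa> (sinv C p)"
  by (induction p rule: fmod_UNIV_induct) (simp_all add: path_bar_def sinv_bas)

lemma path_dif:
  "dif PC (bas (Base x)) = path_incl (dif C (bas x)) - path_bar C (bas x)"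
  "dif PC (bas (Bar x)) = - path_bar C (dif C (bas x))"
  by (simp_all add: path_coalg_def)

lemma path_comult:
  "comult PC (bas (Base x)) = tmap C 0 path_incl path_incl (comult C (bas x))"
  "comult PC (bas (Bar x)) = tmap C 0 (path_bar C) path_incl (comult C (bas x)) +
      tmap C 1 path_incl (path_bar C) (comult C (bas x))"
  by (simp_all add: path_coalg_def)

lemma path_deg [simp]: "deg PC (Base x) = deg C x" "deg PC (Bar x) = deg C x - 1"
  by (simp_all add: path_coalg_def)

lemma quad_path_incl: "quad PC (tmap C 0 path_incl path_incl t) = inc (quad C t)"
proof (induction t rule: fmod_UNIV_induct)
  case (bas w)
  show ?case
    by (cases w) (simp add: tmap_bas path_incl_def quad_bas sinv_bas path_deg)
qed simp_all

text \<open>The Leibniz rule for \<open>\<kappa>\<close> on words of two letters. As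
  \<open>|Bar y| = |y| - 1\<close>, the sign in \<open>quad\<close> flips, which matches the sign in
  \<open>\<kappa>\<close>.\<close>

lemma quad_path_bar:
  assumes "t \<in> fmod (tensor_basis C C)"
  shows "quad PC (tmap C 0 (path_bar C) path_incl t + tmap C 1 path_incl (path_bar C) t) = \<kappa> (quad C t)"
  using assms
proof (induction rule: fmod_induct)
  case (bas w)
  then obtain y z where w: "w = (y, z)" "y \<in> gens C" "z \<in> gens C" by auto
  have y: "int (deg C y - 1) = int (deg C y) - 1" if "y \<noteq> one C"
    using int_deg_diff[OF pre w(2) that] .
  have k: "ks (int (deg C y) - 1) = - (ks (int (deg C y)) :: 'r)" by (simp add: ks_def)
  show ?case
    using y deg_one[OF pre] unfolding w(1)
    by (auto simp: tmap_bas path_incl_def path_bar_def quad_bas sinv_bas path_deg path_kappa_def der_ext_def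
        minus_one_power_ks k fm.scale_right_diff_distrib)
next
  case (add p q)
  let ?L = "\<lambda>t. quad PC (tmap C 0 (path_bar C) path_incl t + tmap C 1 path_incl (path_bar C) t)"
  have "?L (p + q) = ?L p + ?L q" by (simp add: algebra_simps)
  then show ?case unfolding add(3,4) by simp
next
  case (smul a p)
  let ?L = "\<lambda>t. quad PC (tmap C 0 (path_bar C) path_incl t + tmap C 1 path_incl (path_bar C) t)"
  have "?L (a \<odot> p) = a \<odot> ?L p" by (simp add: fm.scale_right_distrib)
  then show ?case unfolding smul(2) by simp
qed simp

text \<open>The minus sign in the linear part of the cobar differential turns
  \<open>- path_bar C (bas x)\<close> into \<open>+ bas [Bar x]\<close>.\<close>

lemma dif_cobar_path_base:
  "x \<in> gens (desusp C) \<Longrightarrow> dif (cobar PC) (bas [Base x]) = inc (dif (cobar C) (bas [x])) + bas [Bar x]"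
  using deg_one[OF pre]
  by (auto simp: dif_cobar_gen path_dif path_comult quad_path_incl sinv_path_incl sinv_path_bar sinv_bas)

lemma dif_cobar_path_bar:
  assumes "x \<in> gens (desusp C)" shows "dif (cobar PC) (bas [Bar x]) = \<kappa> (dif (cobar C) (bas [x]))"
proof -
  have "comult C (bas x) \<in> fmod (tensor_basis C C)"
    using flinD(1)[OF graded_flin[OF comult_graded[OF pre]], of "bas x"] assms by simp
  from quad_path_bar[OF this] show ?thesis
    unfolding dif_cobar_gen path_dif path_comult by (simp add: sinv_path_bar)
qed

lemma inc_hom: "alg_hom (cobar C) (cobar PC) inc"
  unfolding cobar_def by (rule alg_hom_wmap) (simp add: desusp_path del: desusp_simps, simp)

lemma kappa_deriv: "deriv (cobar C) (cobar PC) inc \<kappa>"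
  unfolding cobar_def path_kappa_def
proof (rule deriv_der_ext)
  fix x assume x: "x \<in> gens (desusp C)"
  then show "Base x \<in> gens (desusp PC) \<and> deg (desusp PC) (Base x) = deg (desusp C) x"
    by (simp add: desusp_path(1,3) del: desusp_simps) simp
  have "homog (tensor_algebra (desusp PC) \<delta>) (int (deg (desusp C) x) - 1) (bas [Bar x] :: 'x path list \<Rightarrow>\<^sub>0 'r)" for \<delta>
    using x int_deg_bar[OF x] desusp_path(2,4)[of x] by simp
  then show "homog (tensor_algebra (desusp PC) \<delta>) (int (deg (desusp C) x) - 1) (- bas [Bar x] :: 'x path list \<Rightarrow>\<^sub>0 'r)" for \<delta>
    by (rule homog_simps(5))
qed

lemma desusp_path_cases:
  assumes "z \<in> gens (desusp PC)"
  obtains x where "x \<in> gens (desusp C)" "z = Base x" | x where "x \<in> gens (desusp C)" "z = Bar x"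
  using assms desusp_path(3,4) by (cases z) blast+

lemma homog_dif_cobar_path:
  assumes "z \<in> gens (desusp PC)"
  shows "homog (cobar PC) (int (deg (desusp PC) z) - 1) (dif (cobar PC) (bas [z]))"
  using assms
proof (cases rule: desusp_path_cases)
  case (1 x)
  note h = homog_dif_cobar_gen[OF pre 1(1)]
  have "homog (cobar PC) (int (deg C x - 1) - 1) (bas [Bar x])"
    using 1(1) int_deg_bar[OF 1(1)] desusp_path(2,4)[of x] by simp
  then show ?thesis
    using graded_homog[OF alg_homD(3)[OF inc_hom] h]
    unfolding 1(2) dif_cobar_path_base[OF 1(1)] desusp_path(1) by simp
next
  case (2 x)
  show ?thesis
    using graded_homog[OF deriv_graded[OF kappa_deriv] homog_dif_cobar_gen[OF pre 2(1)]] int_deg_bar[OF 2(1)]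
    unfolding 2(2) dif_cobar_path_bar[OF 2(1)] desusp_path(2) by simp
qed

lemma pr_hom: "alg_hom (cobar PC) (cobar C) pr"
  unfolding cobar_path_proj_def
proof (rule alg_hom_cobar[OF graded_alg_cobar])
  fix z assume "z \<in> gens (desusp PC)"
  then show "homog (cobar C) (int (deg (desusp PC) z)) (sinv C (path_proj (bas z)))"
    by (cases rule: desusp_path_cases)
       (simp_all add: path_proj_def desusp_path(1,2) sinv_bas)
qed

lemma pr_gen:
  assumes "x \<in> gens (desusp C)"
  shows "pr (bas [Base x]) = bas [x]" "pr (bas [Bar x]) = 0"
  using assms deg_one[OF pre] unfolding cobar_path_proj_def
  by (auto simp: alg_ext_Cons path_proj_def sinv_bas)

lemma pr_inc:
  assumes "p \<in> fmod (cobar C)" shows "pr (inc p) = p"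
  by (rule cobar_eqI[OF alg_mor_comp[OF alg_homD(1)[OF inc_hom] alg_homD(1)[OF pr_hom]]
        alg_homD(1)[OF alg_hom_id] _ assms]) (use pr_gen in simp)

text \<open>\<open>pr \<circ> \<kappa>\<close> is a derivation along \<open>pr \<circ> inc\<close>,
  which is the identity, and vanishes on letters; it is compared with the zero derivation.\<close>

lemma pr_kappa:
  assumes "p \<in> fmod (cobar C)" shows "pr (\<kappa> p) = 0"
proof -
  note G = graded_alg_cobar
  have 1: "deriv (cobar C) (cobar C) (\<lambda>p. pr (inc p)) (\<lambda>p. pr (\<kappa> p))"
    by (rule deriv_comp_hom[OF G G alg_homD(2)[OF inc_hom] kappa_deriv pr_hom])
  have 2: "deriv (cobar C) (cobar C) (\<lambda>p. p) (\<lambda>p. 0)"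
    by (simp add: deriv_def graded_map_def)
  show ?thesis
  proof (rule cobar_deriv_eqI[OF G 1 2 pr_inc _ assms])
    fix x assume x: "x \<in> gens (desusp C)"
    then have "bas [Bar x] \<in> fmod (cobar PC)" using desusp_path(4)[of x] by simp
    then show "pr (\<kappa> (bas [x])) = 0"
      using pr_gen(2)[OF x] by (simp add: flin_uminus_app[OF alg_homD(2)[OF pr_hom]])
  qed
qed

section \<open>Comultiplication and coaction on the letters \<open>Base x\<close> and
  \<open>Bar x\<close>\<close>

abbreviation path_comult_map where "path_comult_map \<equiv> path_loop_comult C \<Psi>"

lemma graded_alg_PC2: "graded_alg (tensor_alg (cobar PC) (cobar PC))"
  by (intro graded_alg_tensor graded_alg_cobar)

lemmas inc_graded = alg_homD(3)[OF inc_hom]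
lemmas kappa_graded = deriv_graded[OF kappa_deriv]

lemma path_comult_hom: "alg_hom (cobar PC) (tensor_alg (cobar PC) (cobar PC)) path_comult_map"
  and path_comult_base: "x \<in> gens (desusp C) \<Longrightarrow>
    path_comult_map (bas [Base x]) = tmap (cobar C) 0 inc inc (\<psi> (bas [x]))"
  and path_comult_bar: "x \<in> gens (desusp C) \<Longrightarrow> path_comult_map (bas [Bar x]) =
    - (tmap (cobar C) 0 \<kappa> inc (\<psi> (bas [x])) + tmap (cobar C) 1 inc \<kappa> (\<psi> (bas [x])))"
proof -
  define F where "F = case_path
       (\<lambda>x. tmap (cobar C) 0 inc inc (\<psi> (bas [x])))
       (\<lambda>x. - (tmap (cobar C) 0 \<kappa> inc (\<psi> (bas [x])) + tmap (cobar C) 1 inc \<kappa> (\<psi> (bas [x]))))"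
  have eq: "path_comult_map = alg_ext (tensor_alg (cobar PC) (cobar PC)) F"
    by (simp add: path_loop_comult_def F_def Let_def)
  have hF: "homog (tensor_alg (cobar PC) (cobar PC)) (int (deg (desusp PC) z)) (F z)"
    if "z \<in> gens (desusp PC)" for z
    using that
  proof (cases rule: desusp_path_cases)
    case (1 x)
    have "homog (tensor_basis (cobar C) (cobar C)) (int (deg C x - 1)) (\<psi> (bas [x]))"
      using graded_bas[OF alg_homD(3)[OF psi_hom], of "[x]"] 1(1) by simp
    from graded_homog[OF graded_tmap[OF inc_graded inc_graded refl] this] show ?thesis
      by (simp add: 1(2) F_def desusp_path(1))
  next
    case (2 x)
    have h: "homog (tensor_basis (cobar C) (cobar C)) (int (deg C x - 1)) (\<psi> (bas [x]))"
      using graded_bas[OF alg_homD(3)[OF psi_hom], of "[x]"] 2(1) by simp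
    from graded_homog[OF graded_tmap[OF kappa_graded inc_graded refl] h]
      graded_homog[OF graded_tmap[OF inc_graded kappa_graded refl] h] show ?thesis
      unfolding 2(2) desusp_path(2) int_deg_bar[OF 2(1)] by (simp add: F_def)
  qed
  show "alg_hom (cobar PC) (tensor_alg (cobar PC) (cobar PC)) path_comult_map"
    unfolding eq by (rule alg_hom_cobar[OF graded_alg_PC2 hF])
  have gen: "path_comult_map (bas [z]) = F z" if "z \<in> gens (desusp PC)" for z
    unfolding eq by (rule alg_ext_gen[where F = F, OF graded_alg_PC2 homog_fmod[OF hF[OF that]]])
  show "path_comult_map (bas [Base x]) = tmap (cobar C) 0 inc inc (\<psi> (bas [x]))" if "x \<in> gens (desusp C)"
    using gen[of "Base x"] that desusp_path(3)[of x] by (simp add: F_def)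
  show "path_comult_map (bas [Bar x]) =
    - (tmap (cobar C) 0 \<kappa> inc (\<psi> (bas [x])) + tmap (cobar C) 1 inc \<kappa> (\<psi> (bas [x])))"
    if "x \<in> gens (desusp C)"
    using gen[of "Bar x"] that desusp_path(4)[of x] by (simp add: F_def)
qed

definition nuP where "nuP p = tmap (cobar PC) 0 id pr (path_comult_map p)"

lemma nuP_hom: "alg_hom (cobar PC) (tensor_alg (cobar PC) (cobar C)) nuP"
  unfolding nuP_def tmap_id_left
  by (rule alg_hom_comp[OF path_comult_hom alg_hom_tmap[OF graded_alg_cobar graded_alg_cobar graded_alg_cobar graded_alg_cobar alg_hom_id pr_hom]])

lemma tmap_pr:
  assumes f: "flin (cobar C) (cobar PC) f" and g: "flin (cobar C) (cobar PC) g"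
    and t: "t \<in> fmod (tensor_basis (cobar C) (cobar C))"
  shows "tmap (cobar PC) 0 id pr (tmap (cobar C) k f g t) = tmap (cobar C) k f (\<lambda>q. pr (g q)) t"
  using tmap0_tmap[OF f g flin_id(2) alg_homD(2)[OF pr_hom] t, of k] by simp

text \<open>In the comultiplication of \<open>Bar x\<close> the projection kills the summand with
  \<open>\<kappa>\<close> in the second factor and turns the second factor \<open>inc\<close> into
  the identity.\<close>

lemma nuP_gen:
  assumes x: "x \<in> gens (desusp C)"
  shows "nuP (bas [Base x]) = tmap (cobar C) 0 inc id (\<psi> (bas [x]))"
    and "nuP (bas [Bar x]) = - tmap (cobar C) 0 \<kappa> id (\<psi> (bas [x]))"
proof -
  have t: "\<psi> (bas [x]) \<in> fmod (tensor_basis (cobar C) (cobar C))"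
    using flinD(1)[OF psi_flin, of "bas [x]"] x by simp
  note il = alg_homD(2)[OF inc_hom] and kl = deriv_flin[OF kappa_deriv]
  have a: "tmap (cobar C) 0 f (\<lambda>q. pr (inc q)) (\<psi> (bas [x])) = tmap (cobar C) 0 f id (\<psi> (bas [x]))"
    for f :: "('x list \<Rightarrow>\<^sub>0 'r) \<Rightarrow> ('x path list \<Rightarrow>\<^sub>0 'r)"
    by (rule tmap_cong[OF _ _ t]) (simp_all add: pr_inc del: wmap_bas)
  have b: "tmap (cobar C) 1 inc (\<lambda>q. pr (\<kappa> q)) (\<psi> (bas [x])) = tmap (cobar C) 1 inc (\<lambda>q. 0) (\<psi> (bas [x]))"
    by (rule tmap_cong[OF _ _ t]) (simp_all add: pr_kappa)
  have c: "tmap (cobar C) 1 inc (\<lambda>q. 0) (\<psi> (bas [x])) = 0"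
    by (simp add: tmap_eq case_prod_unfold)
  show "nuP (bas [Base x]) = tmap (cobar C) 0 inc id (\<psi> (bas [x]))"
    by (simp add: nuP_def path_comult_base[OF x] tmap_pr[OF il il t] a)
  show "nuP (bas [Bar x]) = - tmap (cobar C) 0 \<kappa> id (\<psi> (bas [x]))"
    unfolding nuP_def path_comult_bar[OF x] tmap_linear tmap_pr[OF kl il t] tmap_pr[OF il kl t] a b c by simp
qed

lemma path_ext_path_loop:
  "path_ext (desusp C) (\<lambda>x. dif (cobar C) (bas [x])) \<psi> (desusp PC) (\<lambda>z. dif (cobar PC) (bas [z]))
     nuP Base Bar (cobar C) (cobar PC) inc \<kappa>"
proof
  show "cobar C = tensor_algebra (desusp C) (\<lambda>x. dif (cobar C) (bas [x]))"
    "cobar PC = tensor_algebra (desusp PC) (\<lambda>z. dif (cobar PC) (bas [z]))"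
    by (rule cobar_eq)+
  show "\<kappa> = der_ext (desusp C) Base (\<lambda>x. - bas [Bar x])"
    by (simp add: path_kappa_def)
  show "0 < deg (desusp C) x" if "x \<in> gens (desusp C)" for x using that deg_gt_1[of x] by simp
  show "Base x \<in> gens (desusp PC) \<and> deg (desusp PC) (Base x) = deg (desusp C) x" if "x \<in> gens (desusp C)" for x
    using that desusp_path(3)[of x] by (simp add: desusp_path(1))
  show "Bar x \<in> gens (desusp PC) \<and> int (deg (desusp PC) (Bar x)) = int (deg (desusp C) x) - 1" if "x \<in> gens (desusp C)" for x
    using that desusp_path(4)[of x] int_deg_bar[OF that] by (simp add: desusp_path(2))
  \<comment> \<open>Each letter is a \<open>Base\<close> or a \<open>Bar\<close>, so the case of
    further letters is void.\<close>
  show "assoc (tmap (cobar PC) 0 nuP id (nuP (bas [z]))) = tmap (cobar PC) 0 id \<psi> (nuP (bas [z])) \<and>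
      cut_right [] (nuP (bas [z])) = bas [z] \<and> nuP (dif (cobar PC) (bas [z])) = tdif (cobar PC) (cobar C) (nuP (bas [z]))"
    if "z \<in> gens (desusp PC)" "z \<notin> Base ` gens (desusp C)" "z \<notin> Bar ` gens (desusp C)" for z
    using that by (elim desusp_path_cases) auto
qed (simp_all add: psi_hom psi_assoc psi_right psi_left psi_dif nuP_hom homog_dif_cobar_gen[OF pre]
      homog_dif_cobar_path dif_cobar_path_base dif_cobar_path_bar nuP_gen del: desusp_simps)

lemma path_loop_result:
  "cofree_comodule (path_loop C \<Psi>) (coaction (path_loop C \<Psi>) pr) (AW_cobar C \<Psi>) (path_loop C \<Psi>)
      (cotensor (path_loop C \<Psi>) (coaction (path_loop C \<Psi>) pr) (AW_cobar C \<Psi>))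
    \<and> sub_chain_algebra (path_loop C \<Psi>) (cotensor (path_loop C \<Psi>) (coaction (path_loop C \<Psi>) pr) (AW_cobar C \<Psi>))"
proof -
  interpret pe: path_ext "desusp C" "\<lambda>x. dif (cobar C) (bas [x])" \<psi> "desusp PC" "\<lambda>z. dif (cobar PC) (bas [z])"
     nuP Base Bar "cobar C" "cobar PC" inc \<kappa>
    by (rule path_ext_path_loop)
  have nu: "coaction (path_loop C \<Psi>) pr = nuP"
    by (intro ext) (simp add: coaction_def path_loop_def nuP_def)
  have cot: "cotensor (path_loop C \<Psi>) nuP (AW_cobar C \<Psi>) = pe.coinvariants"
    by (simp add: cotensor_def pe.coinvariants_def path_loop_def AW_cobar_def)
  show ?thesis
    unfolding nu cot using pe.cofree pe.coinvariants_sub_chain_algebra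
    by (simp add: path_loop_def AW_cobar_def cofree_with_comult)
qed

end

lemma Inl_Inr_in_Plus [simp]: "Inl x \<in> P <+> Q \<longleftrightarrow> x \<in> P" "Inr y \<in> P <+> Q \<longleftrightarrow> y \<in> Q"
  by auto

section \<open>The coproduct of \<open>\<Omega>C'\<close> with the path-loop algebra\<close>

locale coprod_path_aw = path_aw C \<Psi> + dom: aw_coalgebra C' \<Psi>'
  for C :: "('x, 'r::comm_ring_1) coalg" and \<Psi> and C' :: "('y, 'r) coalg" and \<Psi>' +
  fixes \<theta> :: "('y list \<Rightarrow>\<^sub>0 'r) \<Rightarrow> ('x list \<Rightarrow>\<^sub>0 'r)"
  assumes morphism: "AW_morphism C' \<Psi>' C \<Psi> \<theta>"
begin

abbreviation A where "A \<equiv> cobar_coprod C' PC"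
abbreviation W where "W \<equiv> sum_basis (desusp C') (desusp PC)"
abbreviation \<delta>A where "\<delta>A \<equiv> case_sum
    (\<lambda>x. wmap Inl (dif (cobar C') (bas [x]))) (\<lambda>y. wmap Inr (dif (cobar PC) (bas [y])))"
abbreviation inl :: "('y list \<Rightarrow>\<^sub>0 'r) \<Rightarrow> (('y + 'x path) list \<Rightarrow>\<^sub>0 'r)" where "inl \<equiv> wmap Inl"
abbreviation inr :: "('x path list \<Rightarrow>\<^sub>0 'r) \<Rightarrow> (('y + 'x path) list \<Rightarrow>\<^sub>0 'r)" where "inr \<equiv> wmap Inr"
abbreviation prA where "prA \<equiv> coprod_path_map C \<theta>"

lemma A_eq: "A = tensor_algebra W \<delta>A"
  by (simp add: cobar_coprod_def)

lemma W_simps [simp]: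
  "gens W = gens (desusp C') <+> gens (desusp PC)"
  "deg W (Inl x) = deg (desusp C') x" "deg W (Inr y) = deg (desusp PC) y"
  by (simp_all add: sum_basis_def)

lemma A_alg: "graded_alg A"
  unfolding A_eq by (rule graded_alg_tensor_algebra)

lemma theta_chain: "chain_algebra_map (cobar C') (cobar C) \<theta>"
  using morphism by (simp add: AW_morphism_def)

lemma theta_dif: "p \<in> fmod (cobar C') \<Longrightarrow> \<theta> (dif (cobar C') p) = dif (cobar C) (\<theta> p)"
  using theta_chain unfolding chain_algebra_map_def by blast

lemma theta_hom: "alg_hom (cobar C') (cobar C) \<theta>"
  using theta_chain by (rule chain_algebra_map_alg_hom)

lemma inl_hom: "alg_hom (cobar C') A inl"
  unfolding A_eq cobar_def[of C'] by (rule alg_hom_wmap) (simp del: desusp_simps)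

lemma inr_hom: "alg_hom (cobar PC) A inr"
  unfolding A_eq cobar_def[of PC] by (rule alg_hom_wmap) (simp del: desusp_simps)

lemma prA_hom: "alg_hom A (cobar C) prA"
  unfolding coprod_path_map_def A_eq
proof (rule alg_hom_alg_ext[OF graded_alg_cobar])
  fix z assume "z \<in> gens W"
  then show "homog (cobar C) (int (deg W z)) (case z of Inl x \<Rightarrow> \<theta> (bas [x]) | Inr y \<Rightarrow> pr (bas [y]))"
    using graded_bas[OF alg_homD(3)[OF theta_hom], of "[x]" for x]
      graded_bas[OF alg_homD(3)[OF pr_hom], of "[y]" for y]
    by auto
qed

lemma prA_inl:
  assumes "p \<in> fmod (cobar C')" shows "prA (inl p) = \<theta> p"
proof (rule cobar_eqI[OF alg_mor_comp[OF alg_homD(1)[OF inl_hom] alg_homD(1)[OF prA_hom]] alg_homD(1)[OF theta_hom] _ assms])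
  fix x assume "x \<in> gens (desusp C')"
  then have "\<theta> (bas [x]) \<in> fmod (cobar C)" by (intro flinD(1)[OF alg_homD(2)[OF theta_hom]]) simp
  then show "prA (inl (bas [x])) = \<theta> (bas [x])"
    by (simp add: coprod_path_map_def alg_ext_Cons mult_unit[OF graded_alg_cobar, simplified])
qed

lemma prA_inr:
  assumes "p \<in> fmod (cobar PC)" shows "prA (inr p) = pr p"
proof (rule cobar_eqI[OF alg_mor_comp[OF alg_homD(1)[OF inr_hom] alg_homD(1)[OF prA_hom]] alg_homD(1)[OF pr_hom] _ assms])
  fix x assume "x \<in> gens (desusp PC)"
  then have "pr (bas [x]) \<in> fmod (cobar C)" by (intro flinD(1)[OF alg_homD(2)[OF pr_hom]]) simp
  then show "prA (inr (bas [x])) = pr (bas [x])"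
    by (simp add: coprod_path_map_def alg_ext_Cons mult_unit[OF graded_alg_cobar, simplified])
qed

definition comultA where "comultA = hcomult (coprod_path C' \<Psi>' C \<Psi>)"

lemma comultA_hom: "alg_hom A (tensor_alg A A) comultA"
  and comultA_inl: "x \<in> gens (desusp C') \<Longrightarrow>
    comultA (bas [Inl x]) = tmap (cobar C') 0 inl inl (dom.\<psi> (bas [x]))"
  and comultA_inr: "y \<in> gens (desusp PC) \<Longrightarrow>
    comultA (bas [Inr y]) = tmap (cobar PC) 0 inr inr (path_comult_map (bas [y]))"
proof -
  define F where "F = case_sum
       (\<lambda>x. tmap (cobar C') 0 inl inl (dom.\<psi> (bas [x])))
       (\<lambda>y. tmap (cobar PC) 0 inr inr (path_comult_map (bas [y])))"
  have G: "graded_alg (tensor_alg A A)" by (intro graded_alg_tensor A_alg)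
  have eq: "comultA = alg_ext (tensor_alg A A) F"
    by (simp add: comultA_def coprod_path_def Let_def F_def)
  have hF: "homog (tensor_alg A A) (int (deg W z)) (F z)" if "z \<in> gens W" for z
  proof (cases z)
    case (Inl x)
    have "homog (tensor_basis (cobar C') (cobar C')) (int (deg C' x - 1)) (dom.\<psi> (bas [x]))"
      using graded_bas[OF alg_homD(3)[OF dom.psi_hom], of "[x]"] that Inl by auto
    from graded_homog[OF graded_tmap[OF alg_homD(3)[OF inl_hom] alg_homD(3)[OF inl_hom] refl] this]
    show ?thesis by (simp add: Inl F_def)
  next
    case (Inr y)
    have "homog (tensor_basis (cobar PC) (cobar PC)) (int (deg PC y - 1)) (path_comult_map (bas [y]))"
      using graded_bas[OF alg_homD(3)[OF path_comult_hom], of "[y]"] that Inr by auto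
    from graded_homog[OF graded_tmap[OF alg_homD(3)[OF inr_hom] alg_homD(3)[OF inr_hom] refl] this]
    show ?thesis by (simp add: Inr F_def)
  qed
  show "alg_hom A (tensor_alg A A) comultA"
    unfolding eq A_eq using G[unfolded A_eq] hF[unfolded A_eq] by (rule alg_hom_alg_ext)
  have gen: "comultA (bas [z]) = F z" if "z \<in> gens W" for z
    unfolding eq by (rule alg_ext_gen[where F = F, OF G homog_fmod[OF hF[OF that]]])
  show "comultA (bas [Inl x]) = tmap (cobar C') 0 inl inl (dom.\<psi> (bas [x]))" if "x \<in> gens (desusp C')"
    using gen[of "Inl x"] that by (simp add: F_def)
  show "comultA (bas [Inr y]) = tmap (cobar PC) 0 inr inr (path_comult_map (bas [y]))" if "y \<in> gens (desusp PC)"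
    using gen[of "Inr y"] that by (simp add: F_def del: desusp_simps)
qed

definition nuA where "nuA p = tmap A 0 id prA (comultA p)"

lemma nuA_hom: "alg_hom A (tensor_alg A (cobar C)) nuA"
  unfolding nuA_def tmap_id_left
  by (rule alg_hom_comp[OF comultA_hom alg_hom_tmap[OF A_alg A_alg A_alg graded_alg_cobar alg_hom_id prA_hom]])

lemmas nuA_flin = alg_homD(2)[OF nuA_hom, simplified]

text \<open>The second factor is projected by \<open>\<theta>\<close>, so \<open>inl\<close> is a
  map of comodules along \<open>\<theta>\<close>, as required by
  \<open>coassoc_transfer\<close>.\<close>

lemma nuA_inl:
  assumes p: "p \<in> fmod (cobar C')" shows "nuA (inl p) = tmap (cobar C') 0 inl \<theta> (dom.\<psi> p)"
proof (rule cobar_eqI[OF alg_mor_comp[OF alg_homD(1)[OF inl_hom] alg_homD(1)[OF nuA_hom]] _ _ p])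
  show "alg_mor (cobar C') (tensor_alg A (cobar C)) (\<lambda>p. tmap (cobar C') 0 inl \<theta> (dom.\<psi> p))"
    by (rule alg_mor_comp[OF alg_homD(1)[OF dom.psi_hom] alg_homD(1)[OF alg_hom_tmap[OF graded_alg_cobar A_alg graded_alg_cobar graded_alg_cobar inl_hom theta_hom]]])
  fix x assume x: "x \<in> gens (desusp C')"
  have t: "dom.\<psi> (bas [x]) \<in> fmod (tensor_basis (cobar C') (cobar C'))"
    using flinD(1)[OF dom.psi_flin, of "bas [x]"] x by simp
  note il = alg_homD(2)[OF inl_hom]
  have "nuA (inl (bas [x])) = tmap (cobar C') 0 (\<lambda>p. id (inl p)) (\<lambda>p. prA (inl p)) (dom.\<psi> (bas [x]))"
    using tmap0_comp0[OF il il flin_id(2) alg_homD(2)[OF prA_hom] t] by (simp add: nuA_def comultA_inl[OF x])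
  also have "\<dots> = tmap (cobar C') 0 inl \<theta> (dom.\<psi> (bas [x]))"
    by (rule tmap_cong[OF _ _ t]) (simp_all add: prA_inl del: wmap_bas)
  finally show "nuA (inl (bas [x])) = tmap (cobar C') 0 inl \<theta> (dom.\<psi> (bas [x]))" .
qed

text \<open>\<open>prA\<close> restricts to \<open>pr\<close> along \<open>inr\<close>, so the
  coaction already computed for the path-loop algebra is transported.\<close>

lemma nuA_inr:
  assumes y: "y \<in> gens (desusp PC)"
  shows "nuA (bas [Inr y]) = tmap (cobar PC) 0 inr id (nuP (bas [y]))"
proof -
  have t: "path_comult_map (bas [y]) \<in> fmod (tensor_basis (cobar PC) (cobar PC))"
    using flinD(1)[OF alg_homD(2)[OF path_comult_hom], of "bas [y]"] y by simp
  note il = alg_homD(2)[OF inr_hom]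
  have "nuA (bas [Inr y]) = tmap (cobar PC) 0 (\<lambda>p. id (inr p)) (\<lambda>p. prA (inr p)) (path_comult_map (bas [y]))"
    using tmap0_comp0[OF il il flin_id(2) alg_homD(2)[OF prA_hom] t] by (simp add: nuA_def comultA_inr[OF y])
  also have "\<dots> = tmap (cobar PC) 0 (\<lambda>p. inr (id p)) (\<lambda>p. id (pr p)) (path_comult_map (bas [y]))"
    by (rule tmap_cong[OF _ _ t]) (simp_all add: prA_inr del: wmap_bas)
  also have "\<dots> = tmap (cobar PC) 0 inr id (nuP (bas [y]))"
    using tmap0_comp0[OF flin_id(2) alg_homD(2)[OF pr_hom] il flin_id(2) t] by (simp add: nuP_def)
  finally show ?thesis .
qed

lemma inr_kappa: "inr (\<kappa> p) = der_ext (desusp C) (\<lambda>x. Inr (Base x)) (\<lambda>x. - bas [Inr (Bar x)]) p"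
  by (simp add: path_kappa_def wmap_der_ext)

lemma homog_dif_A:
  assumes "z \<in> gens W" shows "homog A (int (deg W z) - 1) (\<delta>A z)"
proof (cases z)
  case (Inl x)
  then have x: "x \<in> gens (desusp C')" using assms by auto
  from graded_homog[OF alg_homD(3)[OF inl_hom] homog_dif_cobar_gen[OF dom.pre x]]
  show ?thesis by (simp add: Inl del: desusp_simps)
next
  case (Inr y)
  then have y: "y \<in> gens (desusp PC)" using assms by auto
  from graded_homog[OF alg_homD(3)[OF inr_hom] homog_dif_cobar_path[OF y]]
  show ?thesis by (simp add: Inr del: desusp_simps)
qed

lemma dif_A_deriv: "deriv A A (\<lambda>p. p) (dif A)"
  unfolding A_eq by (rule tensor_algebra_dif_deriv) (use homog_dif_A in \<open>simp add: A_eq\<close>)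

text \<open>In contrast to the inclusion of \<open>\<Omega>C\<close>, that of
  \<open>\<Omega>C'\<close> is a chain map: both sides are derivations along \<open>inl\<close>,
  equal on letters by the choice of \<open>\<delta>A\<close>.\<close>

lemma dif_A_inl:
  assumes "p \<in> fmod (cobar C')" shows "inl (dif (cobar C') p) = dif A (inl p)"
  by (rule cobar_deriv_eqI[OF A_alg
        deriv_comp_hom[OF graded_alg_cobar graded_alg_cobar flin_id(1) dif_cobar_deriv[OF dom.pre] inl_hom]
        hom_comp_deriv[OF graded_alg_cobar A_alg A_alg flin_id(1) dif_A_deriv inl_hom] _ _ assms])
     (simp_all add: A_eq)

text \<open>\<open>\<theta>\<close> preserves degrees, and nonempty words have positive degree
  because \<open>C'\<close> is simply connected; hence \<open>\<theta>\<close> respects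
  augmentations.\<close>

lemma lookup_theta:
  assumes "w \<in> gens (cobar C')" shows "lookup (\<theta> (bas w)) [] = (if w = [] then 1 else 0)"
proof (cases "w = []")
  case True
  then show ?thesis using alg_homD(4)[OF theta_hom] by (simp add: lookup_single)
next
  case False
  then obtain x u where xu: "w = x # u" by (cases w) auto
  then have "0 < deg C' x - 1" using dom.deg_gt_1[of x] assms by simp
  then have "0 < deg (cobar C') w" using xu by simp
  moreover have "homog (cobar C) (int (deg (cobar C') w)) (\<theta> (bas w))"
    using graded_bas[OF alg_homD(3)[OF theta_hom] assms] by simp
  moreover have "deg (cobar C) [] = 0" by simp
  ultimately have "[] \<notin> keys (\<theta> (bas w))"
    unfolding homog_def by (force simp del: cobar_simps(2))
  then show ?thesis using False by (simp add: in_keys_iff)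
qed

text \<open>The further letters are those of \<open>\<Omega>C'\<close>. There coassociativity rests
  on \<open>\<theta>\<close> respecting the comultiplications, the counit on
  \<open>lookup_theta\<close>, and the differential on \<open>inl\<close> and
  \<open>\<theta>\<close> being chain maps.\<close>

lemma path_ext_coprod:
  "path_ext (desusp C) (\<lambda>x. dif (cobar C) (bas [x])) \<psi> W \<delta>A nuA (\<lambda>x. Inr (Base x)) (\<lambda>x. Inr (Bar x))
     (cobar C) A (wmap (\<lambda>x. Inr (Base x))) (\<lambda>p. inr (\<kappa> p))"
proof
  show "cobar C = tensor_algebra (desusp C) (\<lambda>x. dif (cobar C) (bas [x]))"
    by (rule cobar_eq)
  show "A = tensor_algebra W \<delta>A" by (rule A_eq)
  show "(\<lambda>p. inr (\<kappa> p)) = der_ext (desusp C) (\<lambda>x. Inr (Base x)) (\<lambda>x. - bas [Inr (Bar x)])"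
    by (simp add: inr_kappa fun_eq_iff)
  show "homog (cobar C) (int (deg (desusp C) x) - 1) (dif (cobar C) (bas [x]))" if "x \<in> gens (desusp C)" for x
    by (rule homog_dif_cobar_gen[OF pre that])
  show "homog A (int (deg W z) - 1) (\<delta>A z)" if "z \<in> gens W" for z
    by (rule homog_dif_A[OF that])
  fix x assume x: "x \<in> gens (desusp C)"
  then have g: "Base x \<in> gens (desusp PC)" "Bar x \<in> gens (desusp PC)"
    using desusp_path(3,4)[of x] by simp_all
  have t: "\<psi> (bas [x]) \<in> fmod (tensor_basis (cobar C) (cobar C))"
    using flinD(1)[OF psi_flin, of "bas [x]"] x by simp
  note il = alg_homD(2)[OF inr_hom]
  show "0 < deg (desusp C) x" using x deg_gt_1[of x] by simp
  show "Inr (Base x) \<in> gens W \<and> deg W (Inr (Base x)) = deg (desusp C) x"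
    using g by (simp add: desusp_path(1) del: desusp_simps(1))
  show "Inr (Bar x) \<in> gens W \<and> int (deg W (Inr (Bar x))) = int (deg (desusp C) x) - 1"
    using g int_deg_bar[OF x] by (simp add: desusp_path(2) del: desusp_simps(1))
  show "\<delta>A (Inr (Base x)) = wmap (\<lambda>x. Inr (Base x)) (dif (cobar C) (bas [x])) + bas [Inr (Bar x)]"
    by (simp add: dif_cobar_path_base[OF x] wmap_wmap)
  show "\<delta>A (Inr (Bar x)) = inr (\<kappa> (dif (cobar C) (bas [x])))"
    by (simp add: dif_cobar_path_bar[OF x])
  show "nuA (bas [Inr (Base x)]) = tmap (cobar C) 0 (wmap (\<lambda>x. Inr (Base x))) id (\<psi> (bas [x]))"
    unfolding nuA_inr[OF g(1)] nuP_gen(1)[OF x]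
    using tmap0_comp0[OF alg_homD(2)[OF inc_hom] flin_id(2) il flin_id(2) t] by (simp add: wmap_wmap id_def)
  show "nuA (bas [Inr (Bar x)]) = - tmap (cobar C) 0 (\<lambda>p. inr (\<kappa> p)) id (\<psi> (bas [x]))"
    unfolding nuA_inr[OF g(2)] nuP_gen(2)[OF x]
    using tmap0_comp0[OF deriv_flin[OF kappa_deriv] flin_id(2) il flin_id(2) t] by (simp add: id_def)
next
  fix z assume z: "z \<in> gens W" "z \<notin> (\<lambda>x. Inr (Base x)) ` gens (desusp C)" "z \<notin> (\<lambda>x. Inr (Bar x)) ` gens (desusp C)"
  \<comment> \<open>All letters of the path-loop summand are a \<open>Base\<close> or a
    \<open>Bar\<close>, which the hypotheses on \<open>z\<close> exclude.\<close>
  obtain x where x: "x \<in> gens (desusp C')" "z = Inl x"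
  proof (cases z)
    case (Inr y)
    then have "y \<in> gens (desusp PC)" using z by auto
    then show ?thesis using z Inr by (cases rule: desusp_path_cases) auto
  qed (use z that in auto)
  have p: "bas [x] \<in> fmod (cobar C')" using x by simp
  have zx: "bas [z] = inl (bas [x])" by (simp add: x)
  note t = flinD(1)[OF dom.psi_flin p]
  have psi_theta: "\<psi> (\<theta> q) = tmap (cobar C') 0 \<theta> \<theta> (dom.\<psi> q)" if "q \<in> fmod (cobar C')" for q
    by (rule psi_morphism[OF dom.AW AW morphism that])
  have 1: "assoc (tmap A 0 nuA id (nuA (bas [z]))) = tmap A 0 id \<psi> (nuA (bas [z]))"
    unfolding zx
    by (rule coassoc_transfer[OF alg_homD(2)[OF inl_hom] alg_homD(2)[OF theta_hom] psi_flin dom.psi_flin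
          nuA_flin nuA_inl dom.psi_assoc psi_theta p])
  have 2: "cut_right [] (nuA (bas [z])) = bas [z]"
    unfolding zx nuA_inl[OF p]
    using cut_right_tmap[OF alg_homD(2)[OF inl_hom] alg_homD(2)[OF theta_hom] lookup_theta t] dom.psi_right[OF p]
    by (simp del: wmap_bas)
  have dp: "dif (cobar C') (bas [x]) \<in> fmod (cobar C')"
    by (rule flinD(1)[OF deriv_flin[OF dif_cobar_deriv[OF dom.pre]] p])
  \<comment> \<open>Since \<open>inl\<close> and \<open>\<theta>\<close> are chain maps of degree 0,
    their tensor product commutes with the tensor differentials.\<close>
  have "tmap (cobar C') 0 inl \<theta> (tdif (cobar C') (cobar C') (dom.\<psi> (bas [x]))) =
      tdif A (cobar C) (tmap (cobar C') 0 inl \<theta> (dom.\<psi> (bas [x])))"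
    by (rule tdif_tmap[OF deriv_flin[OF dif_cobar_deriv[OF dom.pre]] deriv_flin[OF dif_cobar_deriv[OF dom.pre]]
          deriv_flin[OF dif_A_deriv] deriv_flin[OF dif_cobar_deriv[OF pre]] alg_homD(3)[OF inl_hom]
          alg_homD(2)[OF theta_hom] dif_A_inl theta_dif t])
  then have 3: "nuA (\<delta>A z) = tdif A (cobar C) (nuA (bas [z]))"
    unfolding zx nuA_inl[OF p] by (simp add: x nuA_inl[OF dp] dom.psi_dif[OF p])
  show "assoc (tmap A 0 nuA id (nuA (bas [z]))) = tmap A 0 id \<psi> (nuA (bas [z])) \<and>
      cut_right [] (nuA (bas [z])) = bas [z] \<and> nuA (\<delta>A z) = tdif A (cobar C) (nuA (bas [z]))"
    using 1 2 3 by blast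
qed (simp_all add: psi_hom psi_assoc psi_right psi_left psi_dif nuA_hom)

lemma coprod_path_result:
  defines "H' \<equiv> coprod_path C' \<Psi>' C \<Psi>"
  shows "cofree_comodule H' (coaction H' prA) (AW_cobar C \<Psi>) H' (cotensor H' (coaction H' prA) (AW_cobar C \<Psi>))
    \<and> sub_chain_algebra H' (cotensor H' (coaction H' prA) (AW_cobar C \<Psi>))"
proof -
  interpret pe: path_ext "desusp C" "\<lambda>x. dif (cobar C) (bas [x])" \<psi> W \<delta>A nuA "\<lambda>x. Inr (Base x)" "\<lambda>x. Inr (Bar x)"
     "cobar C" A "wmap (\<lambda>x. Inr (Base x))" "\<lambda>p. inr (\<kappa> p)"
    by (rule path_ext_coprod)
  have H': "H' = with_comult A comultA"
    by (simp add: H'_def comultA_def coprod_path_def Let_def)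
  have nu: "coaction H' prA = nuA"
    by (intro ext) (simp add: coaction_def H' nuA_def)
  have cot: "cotensor H' nuA (AW_cobar C \<Psi>) = pe.coinvariants"
    by (simp add: cotensor_def pe.coinvariants_def H' AW_cobar_def)
  show ?thesis
    unfolding nu cot using pe.cofree pe.coinvariants_sub_chain_algebra
    by (simp add: H' AW_cobar_def cofree_with_comult)
qed

end

theorem corollary4p7:
  fixes C :: "('x, 'r::pid) coalg"
    and \<Psi> :: "('x list \<Rightarrow>\<^sub>0 'r) \<Rightarrow> (('x \<times> 'x) list \<Rightarrow>\<^sub>0 'r)"
  assumes "AW_coalgebra C \<Psi>"
    and "\<forall>x\<in>gens C. deg C x \<noteq> 1 \<and> deg C x \<noteq> 2"
  shows "(let H = AW_cobar C \<Psi>;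
              H' = path_loop C \<Psi>;
              \<nu> = coaction H' (cobar_path_proj C)
          in cofree_comodule H' \<nu> H H' (cotensor H' \<nu> H)
             \<and> sub_chain_algebra H' (cotensor H' \<nu> H))
       \<and> (\<forall>(C' :: ('y, 'r) coalg) \<Psi>' \<theta>.
            AW_coalgebra C' \<Psi>' \<longrightarrow> AW_morphism C' \<Psi>' C \<Psi> \<theta> \<longrightarrow>
            (let H = AW_cobar C \<Psi>;
                 H' = coprod_path C' \<Psi>' C \<Psi>;
                 \<nu> = coaction H' (coprod_path_map C \<theta>)
             in cofree_comodule H' \<nu> H H' (cotensor H' \<nu> H)
                \<and> sub_chain_algebra H' (cotensor H' \<nu> H)))"
proof -
  interpret path_aw C \<Psi> by standard (use assms in auto)
  have "cofree_comodule H' \<nu> H H' (cotensor H' \<nu> H) \<and> sub_chain_algebra H' (cotensor H' \<nu> H)"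
    if "AW_coalgebra C' \<Psi>'" "AW_morphism C' \<Psi>' C \<Psi> \<theta>"
      and [simp]: "H = AW_cobar C \<Psi>" "H' = coprod_path C' \<Psi>' C \<Psi>" "\<nu> = coaction H' (coprod_path_map C \<theta>)"
    for C' :: "('y, 'r) coalg" and \<Psi>' \<theta> H H' \<nu>
  proof -
    interpret coprod_path_aw C \<Psi> C' \<Psi>' \<theta> by standard (use that in auto)
    show ?thesis using coprod_path_result by simp
  qed
  then show ?thesis using path_loop_result by (simp add: Let_def)
qed

end
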